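(* The following statements are equivalent: (a) Crouzeix's conjecture holds for all truncated Toeplitz operators on three dimensional model spaces with analytic symbols; (b) Crouzeix's conjecture holds for all $3\times 3$ symmetric matrices; (c) Crouzeix's conjecture holds for all truncated Toeplitz operators on three dimensional model spaces.
   Context: Matrices have complex entries. A matrix $S$ is symmetric if it equals its transpose, $S=S^T$. For a linear operator $A$ on a finite-dimensional complex Hilbert space (in particular a square complex matrix acting on Euclidean $\mathbb{C}^n$), $W(A)=\{\langle Ax,x\rangle:\langle x,x\rangle=1\}$, and "Crouzeix's conjecture holds for $A$" means $\|p(A)\|\le 2\sup_{z\in W(A)}|p(z)|$ for every complex polynomial $p$, where $\|\cdot\|$ is the operator norm. $H^2$ is the Hardy space of analytic functions on the open unit disc $\mathbb{D}$ with square summable Taylor coefficients, identified via radial boundary values with the closed subspace of $L^2(\mathbb{T})$, $\mathbb{T}=\partial\mathbb{D}$, of functions whose negative Fourier coefficients vanish. A function $\theta\in H^2$ is inner if $|\theta|=1$ a.e. on $\mathbb{T}$; its model space is $K_\theta^2=(\theta H^2)^{\perp}\cap H^2$. For $g\in L^\infty(\mathbb{T})$ the truncated Toeplitz operator with symbol $g$ is $A_g^\theta:K_\theta^2\to K_\theta^2$, $A_g^\theta(f)=P_\theta(gf)$, where $P_\theta$ is the orthogonal projection $L^2(\mathbb{T})\to K_\theta^2$. The symbol is analytic if $g\in L^\infty(\mathbb{T})\cap H^2$ (i.e. $g\in H^\infty$). *)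

theory Defs
  imports "HOL-Analysis.Analysis" "HOL-Computational_Algebra.Polynomial"
begin

subsection \<open>Crouzeix's conjecture for an operator on an inner product space\<close>

text \<open>
  The distribution has no class of complex inner product spaces. The space is therefore given
  by a carrier \<open>V\<close>, a scalar multiplication \<open>sc\<close> and an inner product \<open>ip\<close> (linear in the first,
  conjugate linear in the second argument); the operator \<open>A\<close> only matters on \<open>V\<close>.
\<close>

definition numerical_range :: "('v \<Rightarrow> 'v \<Rightarrow> complex) \<Rightarrow> 'v set \<Rightarrow> ('v \<Rightarrow> 'v) \<Rightarrow> complex set"
  where "numerical_range ip V A = {ip (A x) x | x. x \<in> V \<and> ip x x = 1}"

definition operator_norm :: "('v \<Rightarrow> 'v \<Rightarrow> complex) \<Rightarrow> 'v set \<Rightarrow> ('v \<Rightarrow> 'v) \<Rightarrow> real"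
  where "operator_norm ip V A =
    (SUP x \<in> {x \<in> V. sqrt (Re (ip x x)) \<le> 1}. sqrt (Re (ip (A x) (A x))))"

definition poly_operator ::
    "(complex \<Rightarrow> 'v \<Rightarrow> 'v) \<Rightarrow> complex poly \<Rightarrow> ('v \<Rightarrow> 'v) \<Rightarrow> 'v \<Rightarrow> 'v::comm_monoid_add"
  where "poly_operator sc p A x = (\<Sum>i\<le>degree p. sc (coeff p i) ((A ^^ i) x))"

text \<open>
  Both suprema are suprema of sets of reals. They are bounded and nonempty
  whenever \<open>V\<close> is finite-dimensional and nonzero and \<open>A\<close> is a linear operator on \<open>V\<close>.
\<close>

definition crouzeix ::
    "(complex \<Rightarrow> 'v \<Rightarrow> 'v) \<Rightarrow> ('v \<Rightarrow> 'v \<Rightarrow> complex) \<Rightarrow> 'v set \<Rightarrow> ('v \<Rightarrow> 'v::comm_monoid_add) \<Rightarrow> bool"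
  where "crouzeix sc ip V A \<longleftrightarrow>
    (\<forall>p :: complex poly. operator_norm ip V (poly_operator sc p A)
        \<le> 2 * (SUP z \<in> numerical_range ip V A. cmod (poly p z)))"

definition cvec_inner :: "complex ^ 'n \<Rightarrow> complex ^ 'n \<Rightarrow> complex"
  where "cvec_inner x y = (\<Sum>i\<in>UNIV. x $ i * cnj (y $ i))"

definition crouzeix_matrix :: "complex ^ 'n ^ 'n \<Rightarrow> bool"
  where "crouzeix_matrix S \<longleftrightarrow> crouzeix (*s) cvec_inner UNIV ((*v) S)"

subsection \<open>The space $L^2$ of the unit circle\<close>

text \<open>
  Normalized arc length, as a Borel measure on the whole plane that is concentrated on the unit
  circle: functions on the circle are represented by functions on the plane, whose values off
  the circle are irrelevant.
\<close>

definition circle_measure :: "complex measure"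
  where "circle_measure = distr (uniform_measure lborel {0..<2 * pi}) borel cis"

lemma sets_circle_measure [simp, measurable_cong]: "sets circle_measure = sets borel"
  by (simp add: circle_measure_def)

definition square_integrable :: "(complex \<Rightarrow> complex) \<Rightarrow> bool"
  where "square_integrable f \<longleftrightarrow>
    f \<in> borel_measurable circle_measure \<and> integrable circle_measure (\<lambda>z. (cmod (f z))\<^sup>2)"

lemma square_integrable_0: "square_integrable (\<lambda>z. 0)"
  by (simp add: square_integrable_def)

lemma square_integrable_add:
  assumes "square_integrable f" "square_integrable g"
  shows "square_integrable (\<lambda>z. f z + g z)"
proof -
  have [measurable]: "f \<in> borel_measurable circle_measure" "g \<in> borel_measurable circle_measure"
    and int: "integrable circle_measure (\<lambda>z. 2 * (cmod (f z))\<^sup>2 + 2 * (cmod (g z))\<^sup>2)"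
    using assms by (auto simp: square_integrable_def)
  have "(cmod (f z + g z))\<^sup>2 \<le> 2 * (cmod (f z))\<^sup>2 + 2 * (cmod (g z))\<^sup>2" for z
  proof -
    have "(cmod (f z + g z))\<^sup>2 \<le> (cmod (f z) + cmod (g z))\<^sup>2"
      by (intro power_mono norm_triangle_ineq) simp
    also have "\<dots> \<le> 2 * (cmod (f z))\<^sup>2 + 2 * (cmod (g z))\<^sup>2"
      using sum_squares_bound[of "cmod (f z)" "cmod (g z)"] by (simp add: power2_sum)
    finally show ?thesis .
  qed
  then have "integrable circle_measure (\<lambda>z. (cmod (f z + g z))\<^sup>2)"
    by (intro Bochner_Integration.integrable_bound[OF int]) auto
  then show ?thesis
    by (simp add: square_integrable_def)
qed

lemma square_integrable_scale:
  assumes "square_integrable f"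
  shows "square_integrable (\<lambda>z. c * f z)"
  using assms by (auto simp: square_integrable_def norm_mult power_mult_distrib)

definition L2_rel :: "(complex \<Rightarrow> complex) \<Rightarrow> (complex \<Rightarrow> complex) \<Rightarrow> bool"
  where "L2_rel f g \<longleftrightarrow>
    square_integrable f \<and> square_integrable g \<and> (AE z in circle_measure. f z = g z)"

lemma part_equivp_L2_rel: "part_equivp L2_rel"
proof (rule part_equivpI)
  show "\<exists>f. L2_rel f f"
    using square_integrable_0 by (auto simp: L2_rel_def)
  show "symp L2_rel"
    by (auto simp: symp_def L2_rel_def)
  show "transp L2_rel"
  proof (rule transpI)
    fix f g h
    assume fg: "L2_rel f g" and gh: "L2_rel g h"
    then have "AE z in circle_measure. f z = g z" "AE z in circle_measure. g z = h z"
      by (simp_all add: L2_rel_def)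
    then have "AE z in circle_measure. f z = h z"
      by eventually_elim simp
    with fg gh show "L2_rel f h"
      by (simp add: L2_rel_def)
  qed
qed

quotient_type circle_L2 = "complex \<Rightarrow> complex" / partial: L2_rel
  by (rule part_equivp_L2_rel)

instantiation circle_L2 :: ab_group_add
begin

lift_definition zero_circle_L2 :: circle_L2 is "\<lambda>z. 0"
  by (simp add: L2_rel_def square_integrable_0)

lift_definition plus_circle_L2 :: "circle_L2 \<Rightarrow> circle_L2 \<Rightarrow> circle_L2" is "\<lambda>f g z. f z + g z"
  by (auto simp: L2_rel_def square_integrable_add)

lift_definition uminus_circle_L2 :: "circle_L2 \<Rightarrow> circle_L2" is "\<lambda>f z. - f z"
  using square_integrable_scale[where c = "-1"] by (auto simp: L2_rel_def)

definition minus_circle_L2 :: "circle_L2 \<Rightarrow> circle_L2 \<Rightarrow> circle_L2"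
  where "minus_circle_L2 f g = f + - g"

instance
proof
  fix f g h :: circle_L2
  show "f + g + h = f + (g + h)"
    by transfer (auto simp: L2_rel_def square_integrable_add add.assoc)
  show "f + g = g + f"
    by transfer (auto simp: L2_rel_def square_integrable_add add.commute)
  show "0 + f = f"
    by transfer (auto simp: L2_rel_def)
  show "- f + f = 0"
    by transfer (auto simp: L2_rel_def square_integrable_0)
  show "f - g = f + - g"
    by (rule minus_circle_L2_def)
qed

end

lift_definition L2_scale :: "complex \<Rightarrow> circle_L2 \<Rightarrow> circle_L2" is "\<lambda>c f z. c * f z"
  by (auto simp: L2_rel_def square_integrable_scale)

global_interpretation L2: vector_space L2_scale
proof
  fix a b :: complex and f g :: circle_L2
  show "L2_scale a (f + g) = L2_scale a f + L2_scale a g"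
    by transfer (auto simp: L2_rel_def square_integrable_add square_integrable_scale distrib_left)
  show "L2_scale (a + b) f = L2_scale a f + L2_scale b f"
    by transfer (auto simp: L2_rel_def square_integrable_add square_integrable_scale distrib_right
        intro: square_integrable_add[OF square_integrable_scale square_integrable_scale])
  show "L2_scale a (L2_scale b f) = L2_scale (a * b) f"
    by transfer (auto simp: L2_rel_def square_integrable_scale mult.assoc
        intro: square_integrable_scale[OF square_integrable_scale])
  show "L2_scale 1 f = f"
    by transfer (auto simp: L2_rel_def)
qed

lift_definition L2_inner :: "circle_L2 \<Rightarrow> circle_L2 \<Rightarrow> complex"
  is "\<lambda>f g. \<integral>z. f z * cnj (g z) \<partial>circle_measure"
proof -
  fix f f' g g'
  assume f: "L2_rel f f'" and g: "L2_rel g g'"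
  have [measurable]: "cnj \<in> borel_measurable borel"
    by (intro borel_measurable_continuous_onI continuous_intros)
  from f g have [measurable]:
      "f \<in> borel_measurable circle_measure" "f' \<in> borel_measurable circle_measure"
      "g \<in> borel_measurable circle_measure" "g' \<in> borel_measurable circle_measure"
    by (auto simp: L2_rel_def square_integrable_def)
  from f g have "AE z in circle_measure. f z = f' z" "AE z in circle_measure. g z = g' z"
    by (auto simp: L2_rel_def)
  then have "AE z in circle_measure. f z * cnj (g z) = f' z * cnj (g' z)"
    by eventually_elim simp
  then show "(\<integral>z. f z * cnj (g z) \<partial>circle_measure) = (\<integral>z. f' z * cnj (g' z) \<partial>circle_measure)"
    by (intro integral_cong_AE) measurable
qed

lift_definition fourier_coeff :: "circle_L2 \<Rightarrow> int \<Rightarrow> complex"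
  is "\<lambda>f n. \<integral>z. f z * z powi (- n) \<partial>circle_measure"
proof (rule ext)
  fix f g :: "complex \<Rightarrow> complex" and n :: int
  assume fg: "L2_rel f g"
  have [measurable]: "(\<lambda>z::complex. z powi (- n)) \<in> borel_measurable borel"
    by (auto simp: power_int_def)
  from fg have [measurable]:
      "f \<in> borel_measurable circle_measure" "g \<in> borel_measurable circle_measure"
    by (auto simp: L2_rel_def square_integrable_def)
  from fg have "AE z in circle_measure. f z = g z"
    by (simp add: L2_rel_def)
  then have "AE z in circle_measure. f z * z powi (- n) = g z * z powi (- n)"
    by eventually_elim simp
  then show "(\<integral>z. f z * z powi (- n) \<partial>circle_measure) = (\<integral>z. g z * z powi (- n) \<partial>circle_measure)"
    by (intro integral_cong_AE) measurable
qed

text \<open>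
  Pointwise multiplication. It is made total by the convention that a product that is not square
  integrable is \<open>0\<close>; this does not occur if one of the factors is essentially bounded.
\<close>

lift_definition L2_mult :: "circle_L2 \<Rightarrow> circle_L2 \<Rightarrow> circle_L2"
  is "\<lambda>f g. if square_integrable (\<lambda>z. f z * g z) then (\<lambda>z. f z * g z) else (\<lambda>z. 0)"
proof -
  fix f f' g g'
  assume f: "L2_rel f f'" and g: "L2_rel g g'"
  then have [measurable]:
      "f \<in> borel_measurable circle_measure" "f' \<in> borel_measurable circle_measure"
      "g \<in> borel_measurable circle_measure" "g' \<in> borel_measurable circle_measure"
    by (auto simp: L2_rel_def square_integrable_def)
  from f g have "AE z in circle_measure. f z = f' z" "AE z in circle_measure. g z = g' z"
    by (auto simp: L2_rel_def)
  then have eq: "AE z in circle_measure. f z * g z = f' z * g' z"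
    by eventually_elim simp
  then have "AE z in circle_measure. (cmod (f z * g z))\<^sup>2 = (cmod (f' z * g' z))\<^sup>2"
    by eventually_elim simp
  then have "integrable circle_measure (\<lambda>z. (cmod (f z * g z))\<^sup>2) \<longleftrightarrow>
      integrable circle_measure (\<lambda>z. (cmod (f' z * g' z))\<^sup>2)"
    by (intro integrable_cong_AE) auto
  then have "square_integrable (\<lambda>z. f z * g z) \<longleftrightarrow> square_integrable (\<lambda>z. f' z * g' z)"
    by (simp add: square_integrable_def)
  with eq show "L2_rel
      (if square_integrable (\<lambda>z. f z * g z) then (\<lambda>z. f z * g z) else (\<lambda>z. 0))
      (if square_integrable (\<lambda>z. f' z * g' z) then (\<lambda>z. f' z * g' z) else (\<lambda>z. 0))"
    by (auto simp: L2_rel_def square_integrable_0)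
qed

lift_definition essentially_bounded :: "circle_L2 \<Rightarrow> bool"
  is "\<lambda>f. \<exists>C. AE z in circle_measure. cmod (f z) \<le> C"
proof -
  fix f g
  assume "L2_rel f g"
  then have eq: "AE z in circle_measure. f z = g z"
    by (simp add: L2_rel_def)
  have "(AE z in circle_measure. cmod (f z) \<le> C) \<longleftrightarrow> (AE z in circle_measure. cmod (g z) \<le> C)" for C
    by (rule eventually_subst) (use eq in eventually_elim, simp)
  then show "(\<exists>C. AE z in circle_measure. cmod (f z) \<le> C) \<longleftrightarrow>
      (\<exists>C. AE z in circle_measure. cmod (g z) \<le> C)"
    by simp
qed

lift_definition unimodular :: "circle_L2 \<Rightarrow> bool"
  is "\<lambda>f. AE z in circle_measure. cmod (f z) = 1"
proof -
  fix f g
  assume "L2_rel f g"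
  then have eq: "AE z in circle_measure. f z = g z"
    by (simp add: L2_rel_def)
  show "(AE z in circle_measure. cmod (f z) = 1) \<longleftrightarrow> (AE z in circle_measure. cmod (g z) = 1)"
    by (rule eventually_subst) (use eq in eventually_elim, simp)
qed

subsection \<open>Model spaces and truncated Toeplitz operators\<close>

text \<open>Since the circle has finite measure, $L^\infty$ is a subset of $L^2$.\<close>

definition Linf :: "circle_L2 set"
  where "Linf = {g. essentially_bounded g}"

text \<open>
  The Hardy space, given by the boundary values of its elements. The Taylor coefficients of the
  corresponding analytic function on the disc are the Fourier coefficients with index \<open>n \<ge> 0\<close>.
\<close>

definition H2 :: "circle_L2 set"
  where "H2 = {f. \<forall>n<0. fourier_coeff f n = 0}"

definition inner_function :: "circle_L2 \<Rightarrow> bool"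
  where "inner_function \<theta> \<longleftrightarrow> \<theta> \<in> H2 \<and> unimodular \<theta>"

definition L2_orth_complement :: "circle_L2 set \<Rightarrow> circle_L2 set"
  where "L2_orth_complement S = {f. \<forall>h\<in>S. L2_inner f h = 0}"

definition model_space :: "circle_L2 \<Rightarrow> circle_L2 set"
  where "model_space \<theta> = L2_orth_complement (L2_mult \<theta> ` H2) \<inter> H2"

definition L2_proj :: "circle_L2 set \<Rightarrow> circle_L2 \<Rightarrow> circle_L2"
  where "L2_proj K f = (THE h. h \<in> K \<and> f - h \<in> L2_orth_complement K)"

definition truncated_toeplitz :: "circle_L2 \<Rightarrow> circle_L2 \<Rightarrow> circle_L2 \<Rightarrow> circle_L2"
  where "truncated_toeplitz \<theta> g f = L2_proj (model_space \<theta>) (L2_mult g f)"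

definition crouzeix_truncated_toeplitz :: "circle_L2 \<Rightarrow> circle_L2 \<Rightarrow> bool"
  where "crouzeix_truncated_toeplitz \<theta> g \<longleftrightarrow>
    crouzeix L2_scale L2_inner (model_space \<theta>) (truncated_toeplitz \<theta> g)"

end

theory Submission
  imports Defs "HOL-Computational_Algebra.Fundamental_Theorem_Algebra"
begin

text \<open>
  From (b) to (c): the antilinear map \<open>f \<mapsto> \<theta> * cnj (z f)\<close> is a conjugation on the model space, and the
  matrix of a truncated Toeplitz operator in an orthonormal basis of fixed vectors is symmetric.

  From (a) to (b): Crouzeix's inequality is a closed condition, so a dense set of symmetric matrices
  suffices. A symmetric matrix with distinct eigenvalues is \<open>X \<Lambda> X\<^sup>T\<close> with \<open>X\<^sup>T X = 1\<close>, and the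
  Gram matrix \<open>G = X\<^sup>* X\<close> of its eigenvectors is then complex orthogonal. For size \<open>3\<close> this is
  exactly what is needed for \<open>G\<close> to be, up to scaling of the vectors, the Gram matrix of Szego kernels
  at three points of the disc, provided that no entry of \<open>G\<close> vanishes, which holds after a small
  complex rotation of \<open>X\<close>. Sending the conjugate eigenvectors to these kernels turns the matrix
  into multiplication by an interpolating polynomial, compressed to the model space of the Blaschke
  product.
\<close>

text \<open>Why size 3: the positive Hermitian complex orthogonal matrices (exponentials of i times
  a real antisymmetric matrix) have three real parameters, as have three points of the disc up to
  disc automorphisms. Concretely, an orthogonal 3 x 3 matrix of determinant 1 is its own matrix of
  cofactors, so the diagonal of the Gram matrix fixes the moduli of all other entries, and the
  equations for the points can be solved explicitly. A Gram matrix of kernels has no zero entry,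
  because \<open>1 / (1 - cnj \<mu> * \<nu>)\<close> never vanishes; this obstacle forces the
  rotation of X. Conjugates of eigenvectors appear because kernels are eigenvectors of the adjoint
  of compressed multiplication, and the adjoint of a symmetric matrix is its entrywise conjugate.
  The Hardy space is handled through Fourier coefficients on the circle only: the value at a point
  of the disc is the pairing with a kernel, and a zero is divided out by a recursion for
  coefficients. The one fact that needs approximation by trigonometric polynomials is that z times a
  product of two Hardy functions has mean 0, which keeps the conjugation inside the model
  space.\<close>

lemma space_circle_measure [simp]: "space circle_measure = UNIV"
  by (simp add: circle_measure_def)

lemma measurable_circle_measure [simp]: "measurable circle_measure N = measurable borel N"
  by (rule measurable_cong_sets) simp_all

lemma cis_measurable [measurable]: "cis \<in> borel_measurable borel"
  by (intro borel_measurable_continuous_onI continuous_intros)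

lemma emeasure_circle_measure: "emeasure circle_measure UNIV = 1"
  by (simp add: circle_measure_def emeasure_distr measurable_cong_sets[OF sets_uniform_measure refl])

lemma measure_circle_measure [simp]: "measure circle_measure UNIV = 1"
  by (simp add: measure_def emeasure_circle_measure)

interpretation circle: finite_measure circle_measure
  by (rule finite_measureI) (simp add: emeasure_circle_measure)

lemma AE_circle: "AE z in circle_measure. cmod z = 1"
  unfolding circle_measure_def
  by (subst AE_distr_iff) (auto simp: measurable_cong_sets[OF sets_uniform_measure refl])

lemma AE_circleI: "(\<And>z. cmod z = 1 \<Longrightarrow> P z) \<Longrightarrow> AE z in circle_measure. P z"
  by (rule eventually_mono[OF AE_circle])

lemma integral_circle_measure:
  fixes f :: "complex \<Rightarrow> complex"
  assumes [measurable]: "f \<in> borel_measurable borel"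
  shows "(\<integral>z. f z \<partial>circle_measure) =
    (1 / (2 * pi)) *\<^sub>R (\<integral>t. indicator {0..<2*pi} t *\<^sub>R f (cis t) \<partial>lborel)"
proof -
  have *: "uniform_measure lborel {0..<2*pi} = density lborel (\<lambda>t. ennreal (indicator {0..<2*pi} t / (2*pi)))"
    unfolding uniform_measure_def
    by (rule density_cong) (use divide_ennreal[of 1 "2*pi"] in \<open>auto split: split_indicator\<close>)
  show ?thesis
    unfolding circle_measure_def
    by (subst integral_distr) (auto simp: * integral_density simp flip: integral_scaleR_right)
qed

lemma integral_circle_1 [simp]: "(\<integral>z. c \<partial>circle_measure) = (c::complex)"
  by (simp add: measure_def emeasure_circle_measure)

lemma integral_circle_power:
  assumes "m \<ge> 1"
  shows "(\<integral>z. z ^ m \<partial>circle_measure) = (0::complex)"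
proof -
  have "(\<integral>t. indicator {0..2*pi} t *\<^sub>R cis (m * t) \<partial>lborel)
      = cis (m * (2 * pi)) / (\<i> * m) - cis (real m * 0) / (\<i> * m)"
  proof (rule integral_FTC_Icc)
    fix x :: real
    show "((\<lambda>t. cis (m * t) / (\<i> * m)) has_vector_derivative cis (m * x)) (at x within {0..2*pi})"
      using assms unfolding cis_conv_exp
      by (auto intro!: derivative_eq_intros has_vector_derivative_real_field
          simp: exp_of_real field_simps)
  qed (auto intro!: continuous_intros)
  moreover have "cis (m * (2 * pi)) = 1"
    by (metis cis_multiple_2pi mult.commute Ints_of_nat)
  \<comment> \<open>The circle is parametrized by the half-open interval, the fundamental theorem of
    calculus uses the closed one; the endpoint is a null set.\<close>
  moreover have "(\<integral>t. indicator {0..<2*pi} t *\<^sub>R cis (m * t) \<partial>lborel)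
      = (\<integral>t. indicator {0..2*pi} t *\<^sub>R cis (m * t) \<partial>lborel)"
  proof (rule integral_cong_AE)
    show "AE t in lborel. indicator {0..<2*pi} t *\<^sub>R cis (m * t) = indicator {0..2*pi} t *\<^sub>R cis (m * t)"
      using AE_lborel_singleton[of "2*pi"] by eventually_elim (auto split: split_indicator)
  qed (auto intro!: borel_measurable_continuous_onI continuous_intros measurable_compose[OF _ borel_measurable_continuous_onI])
  moreover have "cis t ^ m = cis (real m * t)" for t
    by (rule Complex.DeMoivre)
  ultimately show ?thesis
    by (simp add: integral_circle_measure)
qed

lemma square_integrable_measurable [measurable_dest]:
  "square_integrable f \<Longrightarrow> f \<in> borel_measurable borel"
  by (simp add: square_integrable_def)

lemma borel_measurable_cnj [measurable]: "cnj \<in> borel_measurable borel"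
  by (intro borel_measurable_continuous_onI continuous_intros)

lemma square_integrable_bounded_mult:
  assumes f: "square_integrable f" and [measurable]: "a \<in> borel_measurable borel"
    and bd: "AE z in circle_measure. cmod (a z) \<le> C"
  shows "square_integrable (\<lambda>z. a z * f z)"
proof -
  note [measurable] = square_integrable_measurable[OF f]
  have "integrable circle_measure (\<lambda>z. C\<^sup>2 * (cmod (f z))\<^sup>2)"
    using f by (simp add: square_integrable_def)
  then have "integrable circle_measure (\<lambda>z. (cmod (a z * f z))\<^sup>2)"
  proof (rule Bochner_Integration.integrable_bound)
    show "AE z in circle_measure. norm ((cmod (a z * f z))\<^sup>2) \<le> norm (C\<^sup>2 * (cmod (f z))\<^sup>2)"
      using bd by eventually_elim (auto simp: norm_mult power_mult_distrib intro!: mult_right_mono power_mono)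
  qed auto
  then show ?thesis
    by (simp add: square_integrable_def)
qed

lemma square_integrable_1: "square_integrable (\<lambda>z. 1)"
  by (simp add: square_integrable_def)

lemma square_integrable_cnj: "square_integrable f \<Longrightarrow> square_integrable (\<lambda>z. cnj (f z))"
  by (auto simp: square_integrable_def)

lemma integrable_mult:
  assumes "square_integrable f" "square_integrable g"
  shows "integrable circle_measure (\<lambda>z. f z * g z)"
proof (rule Bochner_Integration.integrable_bound)
  note [measurable] = assms[THEN square_integrable_measurable]
  show "integrable circle_measure (\<lambda>z. (cmod (f z))\<^sup>2 + (cmod (g z))\<^sup>2)"
    using assms by (simp add: square_integrable_def)
  show "(\<lambda>z. f z * g z) \<in> borel_measurable circle_measure" by simp
  have "cmod (f z * g z) \<le> (cmod (f z))\<^sup>2 + (cmod (g z))\<^sup>2" for z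
  proof -
    have "2 * (cmod (f z) * cmod (g z)) \<le> (cmod (f z))\<^sup>2 + (cmod (g z))\<^sup>2"
      using sum_squares_bound[of "cmod (f z)" "cmod (g z)"] by simp
    moreover have "0 \<le> cmod (f z) * cmod (g z)" by simp
    ultimately show ?thesis unfolding norm_mult by linarith
  qed
  then show "AE z in circle_measure. norm (f z * g z) \<le> norm ((cmod (f z))\<^sup>2 + (cmod (g z))\<^sup>2)"
    by auto
qed

lemma square_integrable_integrable: "square_integrable f \<Longrightarrow> integrable circle_measure f"
  using integrable_mult[OF _ square_integrable_1] by simp

lemma square_integrable_id_mult: "square_integrable f \<Longrightarrow> square_integrable (\<lambda>z. z * f z)"
  by (rule square_integrable_bounded_mult[where C = 1]) (auto intro: AE_circleI)

lemma square_integrable_power_mult: "square_integrable f \<Longrightarrow> square_integrable (\<lambda>z. f z * z ^ m)"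
proof (induction m)
  case (Suc m)
  then show ?case using square_integrable_id_mult[of "\<lambda>z. f z * z ^ m"] by (simp add: ac_simps)
qed simp

subsection \<open>Functions of Hardy class\<close>

text \<open>\<open>H2\<close> on the level of representatives, with natural exponents instead of
  negative indices: the integral against \<open>z ^ m\<close> is the Fourier coefficient of index
  \<open>- m\<close>.\<close>

definition hardy :: "(complex \<Rightarrow> complex) \<Rightarrow> bool"
  where "hardy f \<longleftrightarrow> square_integrable f \<and> (\<forall>m\<ge>1. (\<integral>z. f z * z ^ m \<partial>circle_measure) = 0)"

lemma hardy_square_integrable: "hardy f \<Longrightarrow> square_integrable f"
  by (simp add: hardy_def)

lemma hardy_integral: "hardy f \<Longrightarrow> m \<ge> 1 \<Longrightarrow> (\<integral>z. f z * z ^ m \<partial>circle_measure) = 0"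
  by (simp add: hardy_def)

lemma integral_cong_circle:
  fixes f g :: "complex \<Rightarrow> complex"
  assumes "f \<in> borel_measurable borel" "g \<in> borel_measurable borel" "\<And>z. cmod z = 1 \<Longrightarrow> f z = g z"
  shows "integral\<^sup>L circle_measure f = integral\<^sup>L circle_measure g"
  using assms by (intro integral_cong_AE AE_circleI) auto

lemma hardy_1: "hardy (\<lambda>z. 1)"
  by (simp add: hardy_def square_integrable_1 integral_circle_power)

lemma hardy_add: "hardy f \<Longrightarrow> hardy g \<Longrightarrow> hardy (\<lambda>z. f z + g z)"
  by (auto simp: hardy_def square_integrable_add distrib_right Bochner_Integration.integral_add
      square_integrable_integrable square_integrable_power_mult)

lemma hardy_scale: "hardy f \<Longrightarrow> hardy (\<lambda>z. c * f z)"
  by (auto simp: hardy_def square_integrable_scale mult.assoc)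

lemma hardy_id_mult: "hardy f \<Longrightarrow> hardy (\<lambda>z. z * f z)"
  unfolding hardy_def
proof (intro conjI allI impI; (elim conjE)?)
  fix m :: nat assume *: "\<forall>m\<ge>1. (\<integral>z. f z * z ^ m \<partial>circle_measure) = 0" "1 \<le> m"
  have "(\<integral>z. z * f z * z ^ m \<partial>circle_measure) = (\<integral>z. f z * z ^ Suc m \<partial>circle_measure)"
    by (simp add: ac_simps)
  then show "(\<integral>z. z * f z * z ^ m \<partial>circle_measure) = 0"
    using *(1)[rule_format, of "Suc m"] by simp
qed (simp add: square_integrable_id_mult)

lemma hardy_poly_mult: "hardy f \<Longrightarrow> hardy (\<lambda>z. poly p z * f z)"
proof (induction p)
  case 0
  then show ?case using hardy_scale[of f 0] by simp
next
  case (pCons a p)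
  then have "hardy (\<lambda>z. a * f z + z * (poly p z * f z))"
    by (intro hardy_add hardy_scale hardy_id_mult)
  then show ?case by (simp add: algebra_simps)
qed

section \<open>Szego kernels as point evaluations, and division by linear factors\<close>

definition szego :: "complex \<Rightarrow> complex \<Rightarrow> complex"
  where "szego \<mu> z = 1 / (1 - cnj \<mu> * z)"

lemma szego_measurable [measurable]: "szego \<mu> \<in> borel_measurable borel"
  unfolding szego_def[abs_def] by measurable

lemma szego_denominator_nonzero:
  assumes "cmod \<mu> < 1" "cmod z \<le> 1" shows "1 - cnj \<mu> * z \<noteq> 0"
proof
  assume "1 - cnj \<mu> * z = 0"
  then have "cmod \<mu> * cmod z = 1" by (metis complex_mod_cnj eq_iff_diff_eq_0 norm_mult norm_one)
  moreover have "cmod \<mu> * cmod z \<le> cmod \<mu> * 1" using assms by (intro mult_left_mono) auto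
  ultimately show False using assms by simp
qed

lemma szego_bounded:
  assumes "cmod \<mu> < 1" "cmod z = 1" shows "cmod (szego \<mu> z) \<le> 1 / (1 - cmod \<mu>)"
proof -
  have "1 - cmod \<mu> \<le> cmod (1 - cnj \<mu> * z)"
    using norm_triangle_ineq2[of 1 "cnj \<mu> * z"] assms by (simp add: norm_mult)
  then show ?thesis using assms by (auto simp: szego_def norm_divide intro!: divide_left_mono mult_pos_pos)
qed

lemma square_integrable_szego_mult:
  assumes "square_integrable f" "cmod \<mu> < 1"
  shows "square_integrable (\<lambda>z. szego \<mu> z * f z)"
  using assms szego_bounded
  by (intro square_integrable_bounded_mult[where C = "1 / (1 - cmod \<mu>)"] AE_circleI) auto

text \<open>The Fourier coefficients \<open>a m\<close> of index \<open>- m\<close> satisfy \<open>a m = cnj \<mu> * a (m + 1)\<close> and are bounded.\<close>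

lemma hardy_szego_mult:
  assumes f: "hardy f" and \<mu>: "cmod \<mu> < 1"
  shows "hardy (\<lambda>z. szego \<mu> z * f z)"
proof -
  let ?g = "\<lambda>z. szego \<mu> z * f z"
  have sf: "square_integrable f" using f by (rule hardy_square_integrable)
  have sg: "square_integrable ?g" by (rule square_integrable_szego_mult[OF sf \<mu>])
  note [measurable] = square_integrable_measurable[OF sf]
  define a where "a m = (\<integral>z. ?g z * z ^ m \<partial>circle_measure)" for m
  have step: "a m = cnj \<mu> * a (Suc m)" if "m \<ge> 1" for m
  proof -
    have "0 = (\<integral>z. f z * z ^ m \<partial>circle_measure)" using hardy_integral[OF f that] by simp
    also have "\<dots> = (\<integral>z. ?g z * z ^ m - cnj \<mu> * (?g z * z ^ Suc m) \<partial>circle_measure)"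
    proof (rule integral_cong_circle)
      fix z assume "cmod z = 1"
      then have "f z = szego \<mu> z * f z * (1 - cnj \<mu> * z)"
        using szego_denominator_nonzero[OF \<mu>, of z] by (simp add: szego_def)
      also have "\<dots> * z ^ m = ?g z * z ^ m - cnj \<mu> * (?g z * z ^ Suc m)"
        by (simp add: algebra_simps)
      finally show "f z * z ^ m = ?g z * z ^ m - cnj \<mu> * (?g z * z ^ Suc m)" .
    qed auto
    also have "\<dots> = a m - cnj \<mu> * a (Suc m)"
      unfolding a_def
      by (subst Bochner_Integration.integral_diff)
        (auto intro!: square_integrable_integrable square_integrable_power_mult sg
          square_integrable_scale simp del: power_Suc)
    finally show ?thesis by simp
  qed
  have bound: "cmod (a m) \<le> (\<integral>z. cmod (?g z) \<partial>circle_measure)" for m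
  proof -
    have "cmod (a m) \<le> (\<integral>z. cmod (?g z * z ^ m) \<partial>circle_measure)"
      unfolding a_def by (rule integral_norm_bound)
    also have "\<dots> = (\<integral>z. cmod (?g z) \<partial>circle_measure)"
      by (intro integral_cong_AE AE_circleI) (auto simp: norm_mult norm_power)
    finally show ?thesis .
  qed
  have "a m = 0" if m: "m \<ge> 1" for m
  proof -
    have iter: "a m = cnj \<mu> ^ j * a (m + j)" for j
    proof (induction j)
      case (Suc j)
      then show ?case using step[of "m + j"] m by simp
    qed simp
    have "cmod (a m) = cmod \<mu> ^ j * cmod (a (m + j))" for j
      by (subst iter[of j]) (simp add: norm_mult norm_power)
    then have "cmod (a m) \<le> cmod \<mu> ^ j * (\<integral>z. cmod (?g z) \<partial>circle_measure)" for j
      using mult_left_mono[OF bound, of "cmod \<mu> ^ j" "m + j" for j] by simp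
    moreover have "(\<lambda>j. cmod \<mu> ^ j * (\<integral>z. cmod (?g z) \<partial>circle_measure)) \<longlonglongrightarrow> 0"
      using \<mu> by (intro tendsto_mult_left_zero LIMSEQ_realpow_zero) auto
    ultimately have "cmod (a m) \<le> 0" by (intro LIMSEQ_le_const) auto
    then show ?thesis by simp
  qed
  then show ?thesis using sg by (simp add: hardy_def a_def)
qed

lemma hardy_szego: "cmod \<mu> < 1 \<Longrightarrow> hardy (szego \<mu>)"
  using hardy_szego_mult[OF hardy_1, of \<mu>] by simp

text \<open>As \<open>cnj z\<close> is the inverse of z on the circle, the conjugated kernel is z/(z
  - \<mu>) there, so pairing with a kernel amounts to dividing by a linear factor.\<close>

lemma cnj_szego_circle:
  assumes "cmod \<mu> < 1" "cmod z = 1"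
  shows "z * cnj (szego \<mu> z) = z + \<mu> * cnj (szego \<mu> z)"
    and "(z - \<mu>) * cnj (szego \<mu> z) = z" and "z \<noteq> \<mu>"
proof -
  have z: "z * cnj z = 1" using assms(2) by (simp add: complex_norm_square[symmetric])
  have nz: "1 - \<mu> * cnj z \<noteq> 0"
    using szego_denominator_nonzero[OF assms(1), of z] assms(2)
    by (metis complex_cnj_cnj complex_cnj_diff complex_cnj_mult complex_cnj_one complex_cnj_zero_iff less_eq_real_def)
  have k: "cnj (szego \<mu> z) * (1 - \<mu> * cnj z) = 1" using nz by (simp add: szego_def)
  show 1: "(z - \<mu>) * cnj (szego \<mu> z) = z" using k z by algebra
  show "z * cnj (szego \<mu> z) = z + \<mu> * cnj (szego \<mu> z)" using 1 by (simp add: algebra_simps)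
  show "z \<noteq> \<mu>" using assms by auto
qed

text \<open>The kernel is an eigenvector of the adjoint of multiplication by z: by
  \<open>cnj_szego_circle\<close> the two sides differ by the integral of
  \<open>f z * z ^ 1\<close>, a negative Fourier coefficient of f. Here and below, pairing with
  \<open>szego \<mu>\<close> plays the role of the value at \<mu>.\<close>

lemma szego_inner_id_mult:
  assumes f: "hardy f" and \<mu>: "cmod \<mu> < 1"
  shows "(\<integral>z. (z * f z) * cnj (szego \<mu> z) \<partial>circle_measure)
    = \<mu> * (\<integral>z. f z * cnj (szego \<mu> z) \<partial>circle_measure)"
proof -
  note sf = hardy_square_integrable[OF f]
  note [measurable] = square_integrable_measurable[OF sf]
  note sk = hardy_square_integrable[OF hardy_szego[OF \<mu>]]
  have "(\<integral>z. (z * f z) * cnj (szego \<mu> z) \<partial>circle_measure)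
      = (\<integral>z. f z * z ^ 1 + \<mu> * (f z * cnj (szego \<mu> z)) \<partial>circle_measure)"
  proof (rule integral_cong_circle)
    fix z assume "cmod z = 1"
    from cnj_szego_circle(1)[OF \<mu> this]
    show "z * f z * cnj (szego \<mu> z) = f z * z ^ 1 + \<mu> * (f z * cnj (szego \<mu> z))"
      by algebra
  qed auto
  also have "\<dots> = \<mu> * (\<integral>z. f z * cnj (szego \<mu> z) \<partial>circle_measure)"
    using hardy_integral[OF f, of 1] square_integrable_integrable[OF square_integrable_power_mult[OF sf, of 1]]
      integrable_mult[OF sf square_integrable_cnj[OF sk]]
    by (subst Bochner_Integration.integral_add) auto
  finally show ?thesis .
qed

lemma szego_inner_poly_mult:
  assumes f: "hardy f" and \<mu>: "cmod \<mu> < 1"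
  shows "(\<integral>z. (poly p z * f z) * cnj (szego \<mu> z) \<partial>circle_measure)
    = poly p \<mu> * (\<integral>z. f z * cnj (szego \<mu> z) \<partial>circle_measure)"
proof (induction p)
  case (pCons a p)
  note sk = square_integrable_cnj[OF hardy_square_integrable[OF hardy_szego[OF \<mu>]]]
  note hp = hardy_poly_mult[OF f, of p]
  have "(\<integral>z. (poly (pCons a p) z * f z) * cnj (szego \<mu> z) \<partial>circle_measure)
     = (\<integral>z. a * (f z * cnj (szego \<mu> z)) + z * (poly p z * f z) * cnj (szego \<mu> z) \<partial>circle_measure)"
    by (simp add: algebra_simps)
  also have "\<dots> = a * (\<integral>z. f z * cnj (szego \<mu> z) \<partial>circle_measure)
      + \<mu> * (\<integral>z. (poly p z * f z) * cnj (szego \<mu> z) \<partial>circle_measure)"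
    using integrable_mult[OF hardy_square_integrable[OF f] sk]
      integrable_mult[OF hardy_square_integrable[OF hardy_id_mult[OF hp]] sk]
    by (subst Bochner_Integration.integral_add) (auto simp: szego_inner_id_mult[OF hp \<mu>])
  finally show ?case using pCons by (simp add: algebra_simps)
qed simp

text \<open>Multiplying \<open>szego \<nu>\<close> by its own denominator, a polynomial, gives 1 on
  the circle. By \<open>szego_inner_poly_mult\<close> that denominator comes out of the integral as
  its value at \<mu>, and what remains is the mean of a kernel, which is 1.\<close>

lemma szego_inner_szego:
  assumes \<nu>: "cmod \<nu> < 1" and \<mu>: "cmod \<mu> < 1"
  shows "(\<integral>z. szego \<nu> z * cnj (szego \<mu> z) \<partial>circle_measure) = 1 / (1 - cnj \<nu> * \<mu>)"
proof -
  note hm = hardy_szego[OF \<mu>] and hn = hardy_szego[OF \<nu>]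
  note sk = square_integrable_cnj[OF hardy_square_integrable[OF hm]]
  have "(\<integral>z. poly [:1, - cnj \<nu>:] z * szego \<nu> z * cnj (szego \<mu> z) \<partial>circle_measure)
      = (1 - cnj \<nu> * \<mu>) * (\<integral>z. szego \<nu> z * cnj (szego \<mu> z) \<partial>circle_measure)"
    by (subst szego_inner_poly_mult[OF hn \<mu>]) (simp add: algebra_simps)
  moreover have "(\<integral>z. poly [:1, - cnj \<nu>:] z * szego \<nu> z * cnj (szego \<mu> z) \<partial>circle_measure)
      = (\<integral>z. cnj (szego \<mu> z) \<partial>circle_measure)"
    using szego_denominator_nonzero[OF \<nu>]
    by (intro integral_cong_circle) (auto simp: szego_def[of \<nu>] algebra_simps)
  moreover have "(\<integral>z. szego \<mu> z \<partial>circle_measure) = 1"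
  proof -
    have "(\<integral>z. szego \<mu> z \<partial>circle_measure) = (\<integral>z. 1 + cnj \<mu> * (szego \<mu> z * z ^ 1) \<partial>circle_measure)"
      using szego_denominator_nonzero[OF \<mu>]
      by (intro integral_cong_circle) (auto simp: szego_def field_simps)
    also have "\<dots> = 1"
      using hardy_integral[OF hm, of 1]
        square_integrable_integrable[OF square_integrable_power_mult[OF hardy_square_integrable[OF hm], of 1]]
      by (subst Bochner_Integration.integral_add) auto
    finally show ?thesis .
  qed
  ultimately show ?thesis
    using szego_denominator_nonzero[OF \<nu>, of \<mu>] \<mu> by (simp add: field_simps)
qed

text \<open>The third assumption says that f vanishes at \<mu>. It is precisely the vanishing of the
  coefficient of index -1 of the quotient, and z/(z - \<mu>) = 1 + \<mu>/(z - \<mu>) carries this to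
  all further negative indices.\<close>

lemma hardy_divide:
  assumes f: "hardy f" and \<mu>: "cmod \<mu> < 1"
    and 0: "(\<integral>z. f z * cnj (szego \<mu> z) \<partial>circle_measure) = 0"
  shows "hardy (\<lambda>z. f z / (z - \<mu>))"
proof -
  note sf = hardy_square_integrable[OF f]
  note [measurable] = square_integrable_measurable[OF sf]
  have bd: "AE z in circle_measure. cmod (1 / (z - \<mu>)) \<le> 1 / (1 - cmod \<mu>)"
    using AE_circle
  proof eventually_elim
    case (elim z)
    have "1 - cmod \<mu> \<le> cmod (z - \<mu>)" using norm_triangle_ineq2[of z \<mu>] elim by simp
    then show ?case using \<mu> by (auto simp: norm_divide intro!: divide_left_mono mult_pos_pos)
  qed
  have sg: "square_integrable (\<lambda>z. f z / (z - \<mu>))"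
    using square_integrable_bounded_mult[OF sf _ bd] by simp
  have "(\<integral>z. f z / (z - \<mu>) * z ^ Suc m \<partial>circle_measure) = 0" for m
  proof (induction m)
    case 0
    have "(\<integral>z. f z / (z - \<mu>) * z ^ Suc 0 \<partial>circle_measure) = (\<integral>z. f z * cnj (szego \<mu> z) \<partial>circle_measure)"
    proof (rule integral_cong_circle)
      fix z assume "cmod z = 1"
      from cnj_szego_circle(2,3)[OF \<mu> this]
      show "f z / (z - \<mu>) * z ^ Suc 0 = f z * cnj (szego \<mu> z)"
        by (simp add: field_simps)
    qed auto
    then show ?case using assms(3) by simp
  next
    case (Suc m)
    have "(\<integral>z. f z / (z - \<mu>) * z ^ Suc (Suc m) \<partial>circle_measure)
        = (\<integral>z. f z * z ^ Suc m + \<mu> * (f z / (z - \<mu>) * z ^ Suc m) \<partial>circle_measure)"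
    proof (rule integral_cong_circle)
      fix z assume "cmod z = 1"
      from cnj_szego_circle(3)[OF \<mu> this]
      show "f z / (z - \<mu>) * z ^ Suc (Suc m) = f z * z ^ Suc m + \<mu> * (f z / (z - \<mu>) * z ^ Suc m)"
        by (simp add: field_simps)
    qed auto
    also have "\<dots> = 0"
      using hardy_integral[OF f, of "Suc m"] Suc
        square_integrable_integrable[OF square_integrable_power_mult[OF sf, of "Suc m"]]
        square_integrable_integrable[OF square_integrable_power_mult[OF sg, of "Suc m"]]
      by (simp del: power_Suc times_divide_eq_left times_divide_eq_right)
    finally show ?case .
  qed
  then show ?thesis
    using sg unfolding hardy_def by (metis One_nat_def Suc_le_D)
qed

subsection \<open>Density of the trigonometric polynomials\<close>

text \<open>A trigonometric polynomial is, on the circle, of the form \<open>poly P z * cnj z ^ N\<close>.\<close>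

definition trig_approximable :: "(complex \<Rightarrow> complex) \<Rightarrow> bool"
  where "trig_approximable f \<longleftrightarrow> square_integrable f \<and>
    (\<forall>e>0. \<exists>P N. (\<integral>z. (cmod (f z - poly P z * cnj z ^ N))\<^sup>2 \<partial>circle_measure) < e)"

lemma trig_approximableD:
  "trig_approximable f \<Longrightarrow> e > 0 \<Longrightarrow>
    \<exists>P N. (\<integral>z. (cmod (f z - poly P z * cnj z ^ N))\<^sup>2 \<partial>circle_measure) < e"
  by (simp add: trig_approximable_def)

lemma square_integrable_continuous:
  assumes "continuous_on UNIV f" shows "square_integrable f"
proof -
  have [measurable]: "f \<in> borel_measurable borel"
    by (rule borel_measurable_continuous_onI[OF assms])
  have "compact (f ` sphere 0 1)"
    using assms by (intro compact_continuous_image) (auto intro: continuous_on_subset)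
  then obtain C where C: "\<And>z. cmod z = 1 \<Longrightarrow> cmod (f z) \<le> C"
    by (metis bounded_iff compact_imp_bounded image_eqI mem_sphere_0)
  have "square_integrable (\<lambda>z. f z * 1)"
    by (rule square_integrable_bounded_mult[OF square_integrable_1, where C = C])
      (auto intro: AE_circleI C)
  then show ?thesis by simp
qed

lemma poly_measurable [measurable]: "poly (p::complex poly) \<in> borel_measurable borel"
  by (intro borel_measurable_continuous_onI continuous_intros)

lemma square_integrable_trig: "square_integrable (\<lambda>z. poly P z * cnj z ^ N)"
  by (intro square_integrable_continuous continuous_intros)

lemma square_integrable_minus:
  "square_integrable f \<Longrightarrow> square_integrable g \<Longrightarrow> square_integrable (\<lambda>z. f z - g z)"
  using square_integrable_add[of f "\<lambda>z. - 1 * g z"] square_integrable_scale[of g "-1"] by simp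

lemma square_integrable_norm_power2:
  "square_integrable f \<Longrightarrow> integrable circle_measure (\<lambda>z. (cmod (f z))\<^sup>2)"
  by (simp add: square_integrable_def)

lemma norm_add_power2_le: "(norm (a + b))\<^sup>2 \<le> 2 * (norm a)\<^sup>2 + 2 * (norm (b::complex))\<^sup>2"
proof -
  have "(norm (a + b))\<^sup>2 \<le> (norm a + norm b)\<^sup>2"
    by (intro power_mono norm_triangle_ineq) simp
  also have "\<dots> \<le> 2 * (norm a)\<^sup>2 + 2 * (norm b)\<^sup>2"
    using sum_squares_bound[of "norm a" "norm b"] by (simp add: power2_sum)
  finally show ?thesis .
qed

lemma integral_norm_add_power2_le:
  assumes "square_integrable f" "square_integrable g"
  shows "(\<integral>z. (cmod (f z + g z))\<^sup>2 \<partial>circle_measure)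
    \<le> 2 * (\<integral>z. (cmod (f z))\<^sup>2 \<partial>circle_measure) + 2 * (\<integral>z. (cmod (g z))\<^sup>2 \<partial>circle_measure)"
proof -
  note i = assms[THEN square_integrable_norm_power2]
  have "(\<integral>z. (cmod (f z + g z))\<^sup>2 \<partial>circle_measure)
      \<le> (\<integral>z. 2 * (cmod (f z))\<^sup>2 + 2 * (cmod (g z))\<^sup>2 \<partial>circle_measure)"
    using i square_integrable_norm_power2[OF square_integrable_add[OF assms]]
    by (intro integral_mono norm_add_power2_le) auto
  then show ?thesis using i by simp
qed

lemma trig_approximable_limit:
  assumes f: "square_integrable f"
    and lim: "\<And>e. e > 0 \<Longrightarrow> \<exists>g. trig_approximable g \<and> (\<integral>z. (cmod (f z - g z))\<^sup>2 \<partial>circle_measure) < e"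
  shows "trig_approximable f"
  unfolding trig_approximable_def
proof (intro conjI f allI impI)
  fix e :: real assume "e > 0"
  then obtain g where g: "trig_approximable g" "(\<integral>z. (cmod (f z - g z))\<^sup>2 \<partial>circle_measure) < e / 4"
    using lim[of "e / 4"] by auto
  then obtain P N where P: "(\<integral>z. (cmod (g z - poly P z * cnj z ^ N))\<^sup>2 \<partial>circle_measure) < e / 4"
    using \<open>e > 0\<close> trig_approximableD[OF g(1), of "e / 4"] by auto
  have sg: "square_integrable g" using g(1) by (simp add: trig_approximable_def)
  have "(\<integral>z. (cmod ((f z - g z) + (g z - poly P z * cnj z ^ N)))\<^sup>2 \<partial>circle_measure) < e"
    using g(2) P integral_norm_add_power2_le[OF square_integrable_minus[OF f sg]
        square_integrable_minus[OF sg square_integrable_trig[of P N]]] by simp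
  then show "\<exists>P N. (\<integral>z. (cmod (f z - poly P z * cnj z ^ N))\<^sup>2 \<partial>circle_measure) < e"
    by auto
qed

lemma trig_add:
  assumes "cmod z = 1"
  shows "poly P z * cnj z ^ M + poly Q z * cnj z ^ N
    = poly (P * monom 1 N + Q * monom 1 M) z * cnj z ^ (M + N)"
proof -
  have "z * cnj z = 1" using assms by (simp add: complex_norm_square[symmetric])
  then have *: "z ^ n * cnj z ^ n = 1" for n by (simp flip: power_mult_distrib)
  have "poly (P * monom 1 N + Q * monom 1 M) z * cnj z ^ (M + N)
    = poly P z * cnj z ^ M * (z ^ N * cnj z ^ N) + poly Q z * cnj z ^ N * (z ^ M * cnj z ^ M)"
    by (simp add: poly_monom algebra_simps power_add)
  then show ?thesis by (simp add: *)
qed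

lemma trig_approximable_trig: "trig_approximable (\<lambda>z. poly P z * cnj z ^ N)"
  unfolding trig_approximable_def
  by (auto simp: square_integrable_trig intro!: exI[of _ P] exI[of _ N])

lemma trig_approximable_add:
  assumes f: "trig_approximable f" and g: "trig_approximable g"
  shows "trig_approximable (\<lambda>z. f z + g z)"
  unfolding trig_approximable_def
proof (intro conjI allI impI)
  have sf: "square_integrable f" and sg: "square_integrable g"
    using f g by (auto simp: trig_approximable_def)
  note [measurable] = sf[THEN square_integrable_measurable] sg[THEN square_integrable_measurable]
  show "square_integrable (\<lambda>z. f z + g z)" using sf sg by (rule square_integrable_add)
  fix e :: real assume "e > 0"
  then have e4: "e / 4 > 0" by simp
  obtain P M where P: "(\<integral>z. (cmod (f z - poly P z * cnj z ^ M))\<^sup>2 \<partial>circle_measure) < e / 4"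
    using trig_approximableD[OF f e4] by auto
  obtain Q N where Q: "(\<integral>z. (cmod (g z - poly Q z * cnj z ^ N))\<^sup>2 \<partial>circle_measure) < e / 4"
    using trig_approximableD[OF g e4] by auto
  have "(\<integral>z. (cmod (f z + g z - poly (P * monom 1 N + Q * monom 1 M) z * cnj z ^ (M + N)))\<^sup>2 \<partial>circle_measure)
      = (\<integral>z. (cmod ((f z - poly P z * cnj z ^ M) + (g z - poly Q z * cnj z ^ N)))\<^sup>2 \<partial>circle_measure)"
    by (rule integral_cong_AE)
      (measurable, measurable, intro AE_circleI, simp only: trig_add[symmetric] add_diff_add)
  also have "\<dots> < e"
    using P Q integral_norm_add_power2_le[OF square_integrable_minus[OF sf square_integrable_trig[of P M]]
        square_integrable_minus[OF sg square_integrable_trig[of Q N]]] by simp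
  finally show "\<exists>P N. (\<integral>z. (cmod (f z + g z - poly P z * cnj z ^ N))\<^sup>2 \<partial>circle_measure) < e"
    by blast
qed

lemma trig_approximable_scale:
  assumes f: "trig_approximable f"
  shows "trig_approximable (\<lambda>z. c * f z)"
  unfolding trig_approximable_def
proof (intro conjI allI impI)
  have sf: "square_integrable f" using f by (auto simp: trig_approximable_def)
  show "square_integrable (\<lambda>z. c * f z)" using sf by (rule square_integrable_scale)
  fix e :: real assume e: "e > 0"
  have pos: "(cmod c)\<^sup>2 + 1 > 0" by (simp add: add_nonneg_pos)
  obtain P N where
    P: "(\<integral>z. (cmod (f z - poly P z * cnj z ^ N))\<^sup>2 \<partial>circle_measure) < e / ((cmod c)\<^sup>2 + 1)"
    using trig_approximableD[OF f divide_pos_pos[OF e pos]] by auto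
  have "(\<integral>z. (cmod (c * f z - poly (smult c P) z * cnj z ^ N))\<^sup>2 \<partial>circle_measure)
      = (\<integral>z. (cmod c)\<^sup>2 * (cmod (f z - poly P z * cnj z ^ N))\<^sup>2 \<partial>circle_measure)"
    by (intro Bochner_Integration.integral_cong refl)
      (simp add: mult.assoc flip: right_diff_distrib, simp add: norm_mult power_mult_distrib)
  also have "\<dots> \<le> ((cmod c)\<^sup>2 + 1) * (\<integral>z. (cmod (f z - poly P z * cnj z ^ N))\<^sup>2 \<partial>circle_measure)"
    by (auto intro!: mult_right_mono)
  also have "\<dots> < e" using P pos by (simp add: field_simps)
  finally show "\<exists>P N. (\<integral>z. (cmod (c * f z - poly P z * cnj z ^ N))\<^sup>2 \<partial>circle_measure) < e"
    by blast
qed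

lemma trig_approximable_sum:
  assumes "\<And>i. i \<in> I \<Longrightarrow> trig_approximable (f i)"
  shows "trig_approximable (\<lambda>z. \<Sum>i\<in>I. f i z)"
proof -
  have 0: "trig_approximable (\<lambda>z. 0)" using trig_approximable_trig[of 0] by simp
  show ?thesis
    using assms by (induction I rule: infinite_finite_induct) (auto intro: 0 trig_approximable_add)
qed

text \<open>Stone-Weierstrass for the real algebra \<open>R\<close> of continuous functions that
  agree on the circle with trigonometric polynomials. It separates points because it contains Re and
  Im, which are (cnj z + z)/2 and i(cnj z - z)/2. A uniform error below \<open>sqrt (e / 2)\<close>
  bounds the mean square error by \<open>e / 2\<close>.\<close>

lemma trig_approximable_continuous:
  fixes h :: "complex \<Rightarrow> real"
  assumes h: "continuous_on UNIV h"
  shows "trig_approximable (\<lambda>z. complex_of_real (h z))"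
proof -
  define R where "R = {r :: complex \<Rightarrow> real. continuous_on (sphere 0 1) r \<and>
    (\<exists>P N. \<forall>z. cmod z = 1 \<longrightarrow> complex_of_real (r z) = poly P z * cnj z ^ N)}"
  interpret function_ring_on R "sphere 0 1"
  proof
    fix f g assume "f \<in> R" "g \<in> R"
    then obtain P M Q N where fg: "continuous_on (sphere 0 1) f" "continuous_on (sphere 0 1) g"
        "\<And>z. cmod z = 1 \<Longrightarrow> complex_of_real (f z) = poly P z * cnj z ^ M"
        "\<And>z. cmod z = 1 \<Longrightarrow> complex_of_real (g z) = poly Q z * cnj z ^ N"
      unfolding R_def by auto
    show "(\<lambda>x. f x + g x) \<in> R"
      unfolding R_def using fg trig_add[of _ P M Q N]
      by (auto intro!: continuous_intros exI[of _ "P * monom 1 N + Q * monom 1 M"] exI[of _ "M + N"])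
    show "(\<lambda>x. f x * g x) \<in> R"
      unfolding R_def using fg
      by (auto intro!: continuous_intros exI[of _ "P * Q"] exI[of _ "M + N"] simp: power_add)
  next
    fix x y :: complex assume xy: "x \<noteq> y"
    have c: "cnj z * z = 1" if "cmod z = 1" for z
      using that by (simp add: complex_norm_square[symmetric] mult.commute)
    have "complex_of_real (Re z) = poly [:1/2, 0, 1/2:] z * cnj z ^ 1" if "cmod z = 1" for z
    proof -
      have "poly [:1/2, 0, 1/2:] z * cnj z ^ 1 = (cnj z + z * (cnj z * z)) / 2"
        by (simp add: field_simps)
      then show ?thesis using c[OF that] by (simp add: complex_eq_iff)
    qed
    then have "\<exists>P N. \<forall>z. cmod z = 1 \<longrightarrow> complex_of_real (Re z) = poly P z * cnj z ^ N" by blast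
    then have "Re \<in> R" unfolding R_def by (intro CollectI conjI continuous_intros)
    moreover
    have "complex_of_real (Im z) = poly [:\<i>/2, 0, -\<i>/2:] z * cnj z ^ 1" if "cmod z = 1" for z
    proof -
      have "poly [:\<i>/2, 0, -\<i>/2:] z * cnj z ^ 1 = \<i> * (cnj z - z * (cnj z * z)) / 2"
        by (simp add: field_simps)
      then show ?thesis using c[OF that] by (simp add: complex_eq_iff)
    qed
    then have "\<exists>P N. \<forall>z. cmod z = 1 \<longrightarrow> complex_of_real (Im z) = poly P z * cnj z ^ N" by blast
    then have "Im \<in> R" unfolding R_def by (intro CollectI conjI continuous_intros)
    ultimately show "\<exists>f\<in>R. f x \<noteq> f y" using xy complex_eq_iff by metis
  next
    fix c :: real
    have "\<forall>z. cmod z = 1 \<longrightarrow> complex_of_real c = poly [:complex_of_real c:] z * cnj z ^ 0" by simp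
    then have "\<exists>P N. \<forall>z. cmod z = 1 \<longrightarrow> complex_of_real c = poly P z * cnj z ^ N" by blast
    then show "(\<lambda>_. c) \<in> R"
      unfolding R_def by (intro CollectI conjI continuous_intros)
  qed (auto simp: R_def)
  have meas [measurable]: "h \<in> borel_measurable borel"
    by (rule borel_measurable_continuous_onI[OF h])
  show ?thesis
    unfolding trig_approximable_def
  proof (intro conjI allI impI)
    show "square_integrable (\<lambda>z. complex_of_real (h z))"
      using h by (intro square_integrable_continuous continuous_intros)
    fix e :: real assume e: "e > 0"
    then have "sqrt (e / 2) > 0" by simp
    from Stone_Weierstrass_basic[OF continuous_on_subset[OF h subset_UNIV] this]
    obtain g where g: "g \<in> R" "\<And>z. cmod z = 1 \<Longrightarrow> \<bar>h z - g z\<bar> < sqrt (e / 2)"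
      by auto
    then obtain P N where P: "\<And>z. cmod z = 1 \<Longrightarrow> complex_of_real (g z) = poly P z * cnj z ^ N"
      unfolding R_def by blast
    note gP = g(2) P
    have bd: "(cmod (complex_of_real (h z) - poly P z * cnj z ^ N))\<^sup>2 \<le> e / 2" if "cmod z = 1" for z
    proof -
      have "(cmod (complex_of_real (h z) - poly P z * cnj z ^ N))\<^sup>2 = \<bar>h z - g z\<bar>\<^sup>2"
        using gP(2)[OF that] by (metis norm_of_real of_real_diff)
      also have "\<dots> \<le> (sqrt (e / 2))\<^sup>2"
        using gP(1)[OF that] by (intro power_mono) auto
      finally show ?thesis using e by simp
    qed
    have "(\<integral>z. (cmod (complex_of_real (h z) - poly P z * cnj z ^ N))\<^sup>2 \<partial>circle_measure)
        \<le> (\<integral>z. e / 2 \<partial>circle_measure)"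
      using bd by (intro integral_mono_AE AE_circleI square_integrable_norm_power2 square_integrable_minus
          square_integrable_trig square_integrable_continuous continuous_intros h) auto
    also have "\<dots> < e" using e by simp
    finally show "\<exists>P N. (\<integral>z. (cmod (complex_of_real (h z) - poly P z * cnj z ^ N))\<^sup>2 \<partial>circle_measure) < e"
      by blast
  qed
qed

lemma square_integrable_indicator:
  "A \<in> sets borel \<Longrightarrow> square_integrable (\<lambda>z. indicator A z)"
  using square_integrable_bounded_mult[OF square_integrable_1, of "indicator A" 1]
  by (auto simp: indicator_def)

text \<open>Regularity squeezes A between a compact K and an open U whose measures differ by less
  than e. A Urysohn function for K inside U differs from the indicator only on U - K, and there by
  at most 1.\<close>

lemma trig_approximable_indicator:
  assumes A: "A \<in> sets borel"
  shows "trig_approximable (indicator A)"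
proof (rule trig_approximable_limit)
  show "square_integrable (\<lambda>z. indicator A z)" by (rule square_integrable_indicator[OF A])
  fix e :: real assume e: "e > 0"
  have fin: "emeasure circle_measure (space circle_measure) \<noteq> \<infinity>"
    by (simp add: emeasure_circle_measure)
  have m: "emeasure circle_measure B = ennreal (measure circle_measure B)" for B
    by (rule circle.emeasure_eq_measure)
  \<comment> \<open>\<open>ennreal\<close> sends negative numbers to 0, so the strict inequality
    fails for a null set; in that case the empty set serves as K.\<close>
  have "ennreal (measure circle_measure A - e / 2) < emeasure circle_measure A \<or> emeasure circle_measure A = 0"
  proof (cases "measure circle_measure A = 0")
    case False
    then have "measure circle_measure A > 0"
      by (simp add: zero_less_measure_iff)
    then show ?thesis using e unfolding m by (intro disjI1 ennreal_lessI) auto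
  qed (simp add: m)
  then have "ennreal (measure circle_measure A - e / 2) < (SUP K \<in> {K. K \<subseteq> A \<and> compact K}. emeasure circle_measure K)
    \<or> emeasure circle_measure A = 0"
    using inner_regular[OF sets_circle_measure fin A] by simp
  then obtain K where K: "K \<subseteq> A" "compact K" "measure circle_measure A - e / 2 < measure circle_measure K"
  proof
    assume "emeasure circle_measure A = 0"
    then show thesis using that[of "{}"] e by (simp add: m)
  next
    assume "ennreal (measure circle_measure A - e / 2) < (SUP K \<in> {K. K \<subseteq> A \<and> compact K}. emeasure circle_measure K)"
    then obtain K where "K \<subseteq> A" "compact K" "ennreal (measure circle_measure A - e / 2) < ennreal (measure circle_measure K)"
      unfolding less_SUP_iff m by auto
    then show thesis using that[of K] by (auto simp: ennreal_less_iff ennreal_lessI) (metis ennreal_leI not_less)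
  qed
  have "(INF U \<in> {U. A \<subseteq> U \<and> open U}. emeasure circle_measure U) < ennreal (measure circle_measure A + e / 2)"
    using e by (subst outer_regular[symmetric, OF _ fin A]) (auto simp: m ennreal_less_iff)
  then obtain U where U: "A \<subseteq> U" "open U" "measure circle_measure U < measure circle_measure A + e / 2"
    unfolding INF_less_iff m by (auto simp: ennreal_less_iff)
  obtain g :: "complex \<Rightarrow> real" where g: "continuous_on UNIV g" "\<And>x. g x \<in> closed_segment 0 1"
      "\<And>x. x \<in> - U \<Longrightarrow> g x = 0" "\<And>x. x \<in> K \<Longrightarrow> g x = 1"
    using Urysohn[of "- U" K 0 1] U K by (auto simp: compact_imp_closed closed_Compl)
  have [measurable]: "K \<in> sets borel" "U \<in> sets borel" using K U by (auto simp: borel_compact)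
  have bd: "(cmod (indicator A z - complex_of_real (g z)))\<^sup>2 \<le> indicator (U - K) z" for z
  proof (cases "z \<in> U - K")
    case True
    have "\<bar>indicator A z - g z\<bar> \<le> 1"
      using g(2)[of z] by (auto simp: closed_segment_eq_real_ivl indicator_def)
    then have "\<bar>indicator A z - g z\<bar>\<^sup>2 \<le> 1" by (intro power_le_one) auto
    moreover have "cmod (indicator A z - complex_of_real (g z)) = \<bar>indicator A z - g z\<bar>"
      by (metis norm_of_real of_real_diff of_real_indicator)
    ultimately show ?thesis using True by simp
  next
    case False
    then show ?thesis using g(3,4)[of z] K(1) U(1) by (cases "z \<in> K") (auto simp: indicator_def)
  qed
  have "(\<integral>z. (cmod (indicator A z - complex_of_real (g z)))\<^sup>2 \<partial>circle_measure)
      \<le> (\<integral>z. indicator (U - K) z \<partial>circle_measure)"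
    using bd by (intro integral_mono square_integrable_norm_power2 square_integrable_minus
        square_integrable_indicator A square_integrable_continuous continuous_intros g)
      (auto simp: m)
  also have "\<dots> = measure circle_measure U - measure circle_measure K"
    using K U by (simp add: circle.finite_measure_Diff)
  also have "\<dots> < e" using K U by simp
  finally show "\<exists>g. trig_approximable g \<and> (\<integral>z. (cmod (indicator A z - g z))\<^sup>2 \<partial>circle_measure) < e"
    using trig_approximable_continuous[OF g(1)] by blast
qed

theorem trig_approximable:
  assumes f: "square_integrable f"
  shows "trig_approximable f"
proof (rule trig_approximable_limit[OF f])
  fix e :: real assume e: "e > 0"
  note [measurable] = square_integrable_measurable[OF f]
  obtain s where s: "\<And>i. simple_function circle_measure (s i)" "\<And>z. (\<lambda>i. s i z) \<longlonglongrightarrow> f z"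
      "\<And>i z. cmod (s i z) \<le> 2 * cmod (f z)"
    using borel_measurable_implies_sequence_metric[of f circle_measure 0] by auto
  have [measurable]: "s i \<in> borel_measurable borel" for i
    using borel_measurable_simple_function[OF s(1)[of i]] by simp
  have ts: "trig_approximable (s i)" for i
  proof -
    have "finite (range (s i))" using simple_functionD(1)[OF s(1)[of i]] by simp
    then have eq: "s i = (\<lambda>z. \<Sum>y\<in>range (s i). y * indicator (s i -` {y}) z)"
      by (simp add: fun_eq_iff indicator_def if_distrib sum.delta' cong: if_cong)
    have "s i -` {y} \<in> sets borel" for y
      using measurable_sets_borel[of "s i" borel "{y}"] by simp
    then show ?thesis
      by (subst eq) (intro trig_approximable_sum trig_approximable_scale trig_approximable_indicator)
  qed
  have "(\<lambda>i. \<integral>z. (cmod (f z - s i z))\<^sup>2 \<partial>circle_measure) \<longlonglongrightarrow> (\<integral>z. 0 \<partial>circle_measure)"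
  proof (rule integral_dominated_convergence)
    \<comment> \<open>The simple functions satisfy \<open>cmod (s i z) \<le> 2 * cmod (f z)\<close>,
      so the error is at most 3 times \<open>cmod (f z)\<close>; 9 is the square of 3.\<close>
    show "integrable circle_measure (\<lambda>z. 9 * (cmod (f z))\<^sup>2)"
      using square_integrable_norm_power2[OF f] by simp
    show "AE z in circle_measure. (\<lambda>i. (cmod (f z - s i z))\<^sup>2) \<longlonglongrightarrow> 0"
    proof (rule AE_I2)
      fix z
      have "(\<lambda>i. (cmod (f z - s i z))\<^sup>2) \<longlonglongrightarrow> (cmod (f z - f z))\<^sup>2"
        by (intro tendsto_intros s)
      then show "(\<lambda>i. (cmod (f z - s i z))\<^sup>2) \<longlonglongrightarrow> 0" by simp
    qed
    show "AE z in circle_measure. norm ((cmod (f z - s i z))\<^sup>2) \<le> 9 * (cmod (f z))\<^sup>2" for i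
    proof (rule AE_I2)
      fix z
      have "cmod (f z - s i z) \<le> 3 * cmod (f z)"
        using norm_triangle_ineq4[of "f z" "s i z"] s(3)[of i z] by linarith
      then have "(cmod (f z - s i z))\<^sup>2 \<le> (3 * cmod (f z))\<^sup>2" by (intro power_mono) auto
      then show "norm ((cmod (f z - s i z))\<^sup>2) \<le> 9 * (cmod (f z))\<^sup>2" by (simp add: power_mult_distrib)
    qed
  qed auto
  then have "\<forall>\<^sub>F i in sequentially. (\<integral>z. (cmod (f z - s i z))\<^sup>2 \<partial>circle_measure) < e"
    using e by (intro order_tendstoD) auto
  then obtain i where "(\<integral>z. (cmod (f z - s i z))\<^sup>2 \<partial>circle_measure) < e"
    using eventually_happens'[OF sequentially_bot] by blast
  then show "\<exists>g. trig_approximable g \<and> (\<integral>z. (cmod (f z - g z))\<^sup>2 \<partial>circle_measure) < e"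
    using ts by blast
qed

section \<open>Products of two functions of Hardy class\<close>

lemma hardy_poly: "hardy (poly p)"
  using hardy_poly_mult[OF hardy_1, of p] by simp

lemma hardy_poly_integral:
  assumes "hardy f"
  shows "(\<integral>z. z * poly p z * f z \<partial>circle_measure) = 0"
proof -
  have "(\<integral>z. z * poly p z * f z \<partial>circle_measure) = (\<integral>z. poly p z * f z * z ^ 1 \<partial>circle_measure)"
    by (intro Bochner_Integration.integral_cong refl) simp
  then show ?thesis using hardy_integral[OF hardy_poly_mult[OF assms], of 1] by simp
qed

text \<open>Q collects the nonnegative frequencies. The strictly negative ones are written as the
  conjugate of a polynomial divisible by z, which makes them orthogonal to every Hardy function.
  Each induction step moves the constant coefficient of P into R.\<close>

lemma trig_split:
  "\<exists>Q R. \<forall>z. cmod z = 1 \<longrightarrow> poly P z * cnj z ^ N = poly Q z + cnj (z * poly R z)"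
proof (induction N arbitrary: P)
  case 0
  show ?case by (intro exI[of _ P] exI[of _ 0]) simp
next
  case (Suc N)
  obtain a P' where P: "P = pCons a P'" by (cases P)
  obtain Q R where QR: "\<And>z. cmod z = 1 \<Longrightarrow> poly P' z * cnj z ^ N = poly Q z + cnj (z * poly R z)"
    using Suc by blast
  have "poly P z * cnj z ^ Suc N = poly Q z + cnj (z * poly (R + monom (cnj a) N) z)" if z: "cmod z = 1" for z
  proof -
    have "z * cnj z = 1" using z by (simp add: complex_norm_square[symmetric])
    then have "poly P z * cnj z ^ Suc N = a * cnj z ^ Suc N + poly P' z * cnj z ^ N"
      unfolding P by (simp add: algebra_simps)
    then show ?thesis by (simp add: QR[OF z] poly_monom algebra_simps)
  qed
  then show ?case by blast
qed

text \<open>A Cauchy-Schwarz inequality in additive form; the weight d is later tied to the size of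
  the approximation error.\<close>

lemma integral_mult_norm_le:
  assumes f: "square_integrable f" and g: "square_integrable g" and d: "d > 0"
  shows "cmod (\<integral>z. f z * g z \<partial>circle_measure)
    \<le> d * (\<integral>z. (cmod (f z))\<^sup>2 \<partial>circle_measure) + (\<integral>z. (cmod (g z))\<^sup>2 \<partial>circle_measure) / d"
proof -
  have pt: "cmod (f z * g z) \<le> d * (cmod (f z))\<^sup>2 + (cmod (g z))\<^sup>2 / d" for z
  proof -
    have "0 \<le> (d * cmod (f z) - cmod (g z))\<^sup>2 + d * cmod (f z) * cmod (g z)"
      using d by auto
    then have "d * (cmod (f z) * cmod (g z)) \<le> d * (d * (cmod (f z))\<^sup>2) + (cmod (g z))\<^sup>2"
      by (simp add: power2_eq_square algebra_simps)
    then show ?thesis using d by (simp add: norm_mult field_simps)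
  qed
  have "cmod (\<integral>z. f z * g z \<partial>circle_measure) \<le> (\<integral>z. cmod (f z * g z) \<partial>circle_measure)"
    by (rule integral_norm_bound)
  also have "\<dots> \<le> (\<integral>z. d * (cmod (f z))\<^sup>2 + (cmod (g z))\<^sup>2 / d \<partial>circle_measure)"
    using integrable_mult[OF f g] square_integrable_norm_power2[OF f] square_integrable_norm_power2[OF g] pt
    by (intro integral_mono) auto
  also have "\<dots> = d * (\<integral>z. (cmod (f z))\<^sup>2 \<partial>circle_measure) + (\<integral>z. (cmod (g z))\<^sup>2 \<partial>circle_measure) / d"
    using square_integrable_norm_power2[OF f] square_integrable_norm_power2[OF g] by simp
  finally show ?thesis .
qed

text \<open>For a polynomial in place of h the claim is \<open>hardy_poly_integral\<close>. In
  general approximate h by a trigonometric polynomial with analytic part Q and antianalytic part q,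
  and let u be the error. Since h - Q is orthogonal to q, Pythagoras gives that q is no larger than
  u in mean square. Thus h is the polynomial Q plus two small functions.\<close>

lemma hardy_mult_integral:
  assumes f: "hardy f" and h: "hardy h"
  shows "(\<integral>z. z * f z * h z \<partial>circle_measure) = 0"
proof -
  let ?I = "\<integral>z. z * f z * h z \<partial>circle_measure"
  note sf = hardy_square_integrable[OF f] and sh = hardy_square_integrable[OF h]
  note [measurable] = sf[THEN square_integrable_measurable] sh[THEN square_integrable_measurable]
  note szf = square_integrable_id_mult[OF sf]
  define F where "F = (\<integral>z. (cmod (z * f z))\<^sup>2 \<partial>circle_measure)"
  have le: "cmod ?I \<le> d * (2 * F + 2)" if d: "d > 0" for d
  proof -
    have "d\<^sup>2 > 0" using d by simp
    then obtain P N where PN: "(\<integral>z. (cmod (h z - poly P z * cnj z ^ N))\<^sup>2 \<partial>circle_measure) < d\<^sup>2"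
      using trig_approximableD[OF trig_approximable[OF sh]] by blast
    obtain Q R where QR: "\<And>z. cmod z = 1 \<Longrightarrow> poly P z * cnj z ^ N = poly Q z + cnj (z * poly R z)"
      using trig_split[of P N] by blast
    define u where "u z = h z - poly P z * cnj z ^ N" for z
    define v where "v z = h z - poly Q z" for z
    define q where "q z = cnj (z * poly R z)" for z
    have su: "square_integrable u" unfolding u_def
      by (intro square_integrable_minus sh square_integrable_trig)
    have sv: "square_integrable v" unfolding v_def
      by (intro square_integrable_minus sh square_integrable_continuous continuous_intros)
    have sq: "square_integrable q" unfolding q_def
      by (intro square_integrable_continuous continuous_intros)
    note [measurable] = su[THEN square_integrable_measurable] sv[THEN square_integrable_measurable]
      sq[THEN square_integrable_measurable]
    have uv: "u z = v z - q z" if "cmod z = 1" for z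
      unfolding u_def v_def q_def QR[OF that] by simp
    have "(\<integral>z. v z * cnj (q z) \<partial>circle_measure)
        = (\<integral>z. z * poly R z * h z - z * poly R z * poly Q z \<partial>circle_measure)"
      by (intro Bochner_Integration.integral_cong refl) (simp add: v_def q_def algebra_simps)
    also have "\<dots> = (\<integral>z. z * poly R z * h z \<partial>circle_measure) - (\<integral>z. z * poly R z * poly Q z \<partial>circle_measure)"
      by (intro Bochner_Integration.integral_diff integrable_mult sh
          square_integrable_continuous continuous_intros)
    also have "\<dots> = 0"
      by (simp add: hardy_poly_integral[OF h] hardy_poly_integral[OF hardy_poly])
    finally have orth: "(\<integral>z. v z * cnj (q z) \<partial>circle_measure) = 0" .
    note ivq = integrable_mult[OF sv square_integrable_cnj[OF sq]]
    \<comment> \<open>Pythagoras for u = v - q.\<close>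
    have "(\<integral>z. (cmod (u z))\<^sup>2 \<partial>circle_measure)
        = (\<integral>z. (cmod (v z))\<^sup>2 + (cmod (q z))\<^sup>2 - 2 * Re (v z * cnj (q z)) \<partial>circle_measure)"
    proof (rule integral_cong_AE)
      show "AE z in circle_measure. (cmod (u z))\<^sup>2 = (cmod (v z))\<^sup>2 + (cmod (q z))\<^sup>2 - 2 * Re (v z * cnj (q z))"
        by (intro AE_circleI, simp only: uv, unfold cmod_power2)
          (simp add: power2_eq_square algebra_simps)
    qed measurable
    also have "\<dots> = (\<integral>z. (cmod (v z))\<^sup>2 \<partial>circle_measure) + (\<integral>z. (cmod (q z))\<^sup>2 \<partial>circle_measure)
        - 2 * Re (\<integral>z. v z * cnj (q z) \<partial>circle_measure)"
      using square_integrable_norm_power2[OF sv] square_integrable_norm_power2[OF sq] ivq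
      by (simp add: integral_Re del: Re_complex_of_real times_complex.sel)
    finally have "(\<integral>z. (cmod (q z))\<^sup>2 \<partial>circle_measure) \<le> (\<integral>z. (cmod (u z))\<^sup>2 \<partial>circle_measure)"
      by (simp add: orth)
    with PN have qu: "(\<integral>z. (cmod (u z))\<^sup>2 \<partial>circle_measure) \<le> d\<^sup>2" "(\<integral>z. (cmod (q z))\<^sup>2 \<partial>circle_measure) \<le> d\<^sup>2"
      by (auto simp: u_def)
    have "?I = (\<integral>z. (z * f z) * u z + (z * poly Q z * f z + (z * f z) * q z) \<partial>circle_measure)"
    proof (rule integral_cong_circle)
      fix z assume "cmod z = 1"
      from uv[OF this] have "h z = u z + (poly Q z + q z)" by (simp add: v_def)
      then show "z * f z * h z = (z * f z) * u z + (z * poly Q z * f z + (z * f z) * q z)"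
        by (simp add: algebra_simps)
    qed measurable
    also have "\<dots> = (\<integral>z. (z * f z) * u z \<partial>circle_measure) + ((\<integral>z. z * poly Q z * f z \<partial>circle_measure)
        + (\<integral>z. (z * f z) * q z \<partial>circle_measure))"
    proof -
      have "square_integrable (\<lambda>z. z * poly Q z)"
        by (intro square_integrable_continuous continuous_intros)
      note i = integrable_mult[OF szf su] integrable_mult[OF szf sq] integrable_mult[OF this sf]
      show ?thesis
        unfolding Bochner_Integration.integral_add[OF i(1) Bochner_Integration.integrable_add[OF i(3,2)]]
          Bochner_Integration.integral_add[OF i(3,2)] by simp
    qed
    also have "\<dots> = (\<integral>z. (z * f z) * u z \<partial>circle_measure) + (\<integral>z. (z * f z) * q z \<partial>circle_measure)"
      by (simp add: hardy_poly_integral[OF f])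
    finally have "cmod ?I \<le> cmod (\<integral>z. (z * f z) * u z \<partial>circle_measure) + cmod (\<integral>z. (z * f z) * q z \<partial>circle_measure)"
      by (simp add: norm_triangle_ineq)
    \<comment> \<open>The mean squares of u and q are at most \<open>d\<^sup>2\<close>, so with
      weight d every term is of order d.\<close>
    also have "\<dots> \<le> (d * F + d\<^sup>2 / d) + (d * F + d\<^sup>2 / d)"
      unfolding F_def
      by (intro add_mono order_trans[OF integral_mult_norm_le[OF szf su d]]
          order_trans[OF integral_mult_norm_le[OF szf sq d]] order_refl divide_right_mono qu) (use d in auto)
    also have "\<dots> = d * (2 * F + 2)" using d by (simp add: power2_eq_square algebra_simps)
    finally show ?thesis .
  qed
  have "((\<lambda>d. d * (2 * F + 2)) \<longlongrightarrow> 0 * (2 * F + 2)) (at_right 0)"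
    by (intro tendsto_intros)
  moreover have "\<forall>\<^sub>F d in at_right 0. cmod ?I \<le> d * (2 * F + 2)"
    using le by (auto simp: eventually_at_right_less intro: eventually_mono[OF eventually_at_right_less])
  ultimately have "cmod ?I \<le> 0"
    using tendsto_lowerbound[of "\<lambda>d. d * (2 * F + 2)" 0 "at_right 0" "cmod ?I"] by simp
  then show ?thesis by simp
qed

subsection \<open>The space of equivalence classes\<close>

lemma L2_rel_refl: "L2_rel f f \<longleftrightarrow> square_integrable f"
  by (auto simp: L2_rel_def)

lemma L2_cases:
  obtains f where "square_integrable f" "x = abs_circle_L2 f"
  by (induction x rule: circle_L2.abs_induct) (auto simp: L2_rel_refl)

lemma abs_L2_eq_iff:
  assumes "square_integrable f" "square_integrable g"
  shows "abs_circle_L2 f = abs_circle_L2 g \<longleftrightarrow> (AE z in circle_measure. f z = g z)"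
  using Quotient_rel_abs2[OF Quotient_circle_L2] Quotient_rel[OF Quotient_circle_L2, of f g] assms
  by (auto simp: L2_rel_refl) (auto simp: L2_rel_def)

lemmas L2_abs_simps = L2_rel_refl plus_circle_L2.abs_eq uminus_circle_L2.abs_eq L2_scale.abs_eq
  L2_inner.abs_eq L2_mult.abs_eq zero_circle_L2.abs_eq

lemma L2_inner_add_left: "L2_inner (x + y) w = L2_inner x w + L2_inner y w"
proof -
  obtain f g h where [simp]: "x = abs_circle_L2 f" "y = abs_circle_L2 g" "w = abs_circle_L2 h"
    and s: "square_integrable f" "square_integrable g" "square_integrable h"
    using L2_cases by metis
  show ?thesis using s
    by (simp add: L2_abs_simps square_integrable_add distrib_right Bochner_Integration.integral_add
        integrable_mult square_integrable_cnj)
qed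

lemma L2_inner_scale_left: "L2_inner (L2_scale c x) y = c * L2_inner x y"
proof -
  obtain f g where [simp]: "x = abs_circle_L2 f" "y = abs_circle_L2 g"
    and s: "square_integrable f" "square_integrable g"
    using L2_cases by metis
  show ?thesis using s
    by (simp add: L2_abs_simps square_integrable_scale mult.assoc)
qed

lemma L2_inner_commute: "L2_inner x y = cnj (L2_inner y x)"
proof -
  obtain f g where [simp]: "x = abs_circle_L2 f" "y = abs_circle_L2 g"
    and s: "square_integrable f" "square_integrable g"
    using L2_cases by metis
  have "(\<integral>z. f z * cnj (g z) \<partial>circle_measure) = (\<integral>z. cnj (g z * cnj (f z)) \<partial>circle_measure)"
    by (rule Bochner_Integration.integral_cong) simp_all
  also have "\<dots> = cnj (\<integral>z. g z * cnj (f z) \<partial>circle_measure)"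
    by (rule Bochner_Integration.integral_cnj)
  finally show ?thesis using s
    by (simp only: \<open>x = _\<close> \<open>y = _\<close> L2_abs_simps)
qed

lemma L2_inner_self: "Im (L2_inner x x) = 0" "0 \<le> Re (L2_inner x x)"
  and L2_inner_self_eq_0: "L2_inner x x = 0 \<longleftrightarrow> x = 0"
proof -
  obtain f where x: "x = abs_circle_L2 f" and s: "square_integrable f"
    using L2_cases by metis
  note [measurable] = square_integrable_measurable[OF s]
  have "L2_inner x x = (\<integral>z. complex_of_real ((cmod (f z))\<^sup>2) \<partial>circle_measure)"
    using s by (simp only: x L2_abs_simps complex_norm_square)
  also have "\<dots> = complex_of_real (\<integral>z. (cmod (f z))\<^sup>2 \<partial>circle_measure)"
    by (rule integral_complex_of_real)
  finally have eq: "L2_inner x x = complex_of_real (\<integral>z. (cmod (f z))\<^sup>2 \<partial>circle_measure)" .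
  then show "Im (L2_inner x x) = 0" "0 \<le> Re (L2_inner x x)" by simp_all
  have "(\<integral>z. (cmod (f z))\<^sup>2 \<partial>circle_measure) = 0 \<longleftrightarrow> (AE z in circle_measure. (cmod (f z))\<^sup>2 = 0)"
    using square_integrable_norm_power2[OF s] by (intro integral_nonneg_eq_0_iff_AE) auto
  then show "L2_inner x x = 0 \<longleftrightarrow> x = 0"
    unfolding eq using s by (simp add: x zero_circle_L2.abs_eq abs_L2_eq_iff square_integrable_0)
qed

lemma L2_inner_add_right: "L2_inner x (y + w) = L2_inner x y + L2_inner x w"
  by (subst (1 2 3) L2_inner_commute) (simp add: L2_inner_add_left)

lemma L2_inner_scale_right: "L2_inner x (L2_scale c y) = cnj c * L2_inner x y"
  by (subst (1 2) L2_inner_commute) (simp add: L2_inner_scale_left)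

lemma L2_inner_0_left [simp]: "L2_inner 0 x = 0"
  using L2_inner_scale_left[of 0 0 x] by simp

lemma L2_inner_0_right [simp]: "L2_inner x 0 = 0"
  using L2_inner_scale_right[of x 0 0] by simp

lemma L2_inner_minus_left: "L2_inner (- x) y = - L2_inner x y"
  using L2_inner_scale_left[of "-1" x y] by simp

lemma L2_inner_diff_left: "L2_inner (x - y) w = L2_inner x w - L2_inner y w"
  by (simp only: diff_conv_add_uminus L2_inner_add_left L2_inner_minus_left)

lemma L2_inner_sum_left: "L2_inner (\<Sum>i\<in>I. f i) x = (\<Sum>i\<in>I. L2_inner (f i) x)"
  by (induction I rule: infinite_finite_induct) (auto simp: L2_inner_add_left)

lemma L2_inner_sum_right: "L2_inner x (\<Sum>i\<in>I. f i) = (\<Sum>i\<in>I. L2_inner x (f i))"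
  by (induction I rule: infinite_finite_induct) (auto simp: L2_inner_add_right)

section \<open>Hardy space and multiplication on equivalence classes\<close>

lemma H2_iff_hardy:
  assumes f: "square_integrable f"
  shows "abs_circle_L2 f \<in> H2 \<longleftrightarrow> hardy f"
proof -
  have "(\<forall>n<0. (\<integral>z. f z * z powi (- n) \<partial>circle_measure) = 0)
      \<longleftrightarrow> (\<forall>m\<ge>1. (\<integral>z. f z * z ^ m \<partial>circle_measure) = 0)"
  proof (intro iffI allI impI)
    fix m :: nat assume *: "\<forall>n<0. (\<integral>z. f z * z powi (- n) \<partial>circle_measure) = 0" and "1 \<le> m"
    then show "(\<integral>z. f z * z ^ m \<partial>circle_measure) = 0"
      using *[rule_format, of "- int m"] by simp
  next
    fix n :: int assume *: "\<forall>m\<ge>1. (\<integral>z. f z * z ^ m \<partial>circle_measure) = 0" and "n < 0"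
    then show "(\<integral>z. f z * z powi (- n) \<partial>circle_measure) = 0"
      using *[rule_format, of "nat (- n)"] by (simp add: power_int_def)
  qed
  then show ?thesis
    using f by (simp add: H2_def fourier_coeff.abs_eq L2_rel_refl hardy_def)
qed

lemma Linf_iff:
  "square_integrable f \<Longrightarrow>
    abs_circle_L2 f \<in> Linf \<longleftrightarrow> (\<exists>C. AE z in circle_measure. cmod (f z) \<le> C)"
  by (simp add: Linf_def essentially_bounded.abs_eq L2_rel_refl)

lemma L2_mult_abs:
  assumes "square_integrable g" "square_integrable f" "abs_circle_L2 g \<in> Linf"
  shows "square_integrable (\<lambda>z. g z * f z)"
    and "L2_mult (abs_circle_L2 g) (abs_circle_L2 f) = abs_circle_L2 (\<lambda>z. g z * f z)"
proof -
  show "square_integrable (\<lambda>z. g z * f z)"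
    using assms square_integrable_bounded_mult square_integrable_measurable by (auto simp: Linf_iff)
  with assms show "L2_mult (abs_circle_L2 g) (abs_circle_L2 f) = abs_circle_L2 (\<lambda>z. g z * f z)"
    by (simp add: L2_abs_simps)
qed

lemma L2_mult_add_right:
  assumes "g \<in> Linf" shows "L2_mult g (x + y) = L2_mult g x + L2_mult g y"
proof -
  obtain u f h where [simp]: "g = abs_circle_L2 u" "x = abs_circle_L2 f" "y = abs_circle_L2 h"
    and s: "square_integrable u" "square_integrable f" "square_integrable h"
    using L2_cases by metis
  show ?thesis using s assms
    by (simp add: plus_circle_L2.abs_eq L2_rel_refl L2_mult_abs square_integrable_add distrib_left)
qed

lemma L2_mult_scale_right:
  assumes "g \<in> Linf" shows "L2_mult g (L2_scale c x) = L2_scale c (L2_mult g x)"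
proof -
  obtain u f where [simp]: "g = abs_circle_L2 u" "x = abs_circle_L2 f"
    and s: "square_integrable u" "square_integrable f"
    using L2_cases by metis
  show ?thesis using s assms
    by (simp add: L2_scale.abs_eq L2_rel_refl L2_mult_abs square_integrable_scale mult.left_commute)
qed

lemma L2_mult_sum_right:
  assumes "g \<in> Linf" shows "L2_mult g (\<Sum>i\<in>I. f i) = (\<Sum>i\<in>I. L2_mult g (f i))"
proof -
  have "L2_mult g 0 = 0" using L2_mult_scale_right[OF assms, of 0 0] by simp
  then show ?thesis
    by (induction I rule: infinite_finite_induct) (auto simp: L2_mult_add_right[OF assms])
qed

subsection \<open>Unitary equivalence\<close>

definition L2_unitary :: "(complex ^ 'n \<Rightarrow> circle_L2) \<Rightarrow> circle_L2 set \<Rightarrow> bool"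
  where "L2_unitary U K \<longleftrightarrow> range U = K \<and> (\<forall>x y. U (x + y) = U x + U y) \<and>
    (\<forall>c x. U (c *s x) = L2_scale c (U x)) \<and> (\<forall>x y. L2_inner (U x) (U y) = cvec_inner x y)"

lemma crouzeix_unitary:
  fixes U :: "complex ^ 'n \<Rightarrow> circle_L2"
  assumes U: "L2_unitary U K" and A: "\<And>x. A (U x) = U (S *v x)"
  shows "crouzeix L2_scale L2_inner K A \<longleftrightarrow> crouzeix_matrix S"
proof -
  have K: "K = range U" and add: "\<And>x y. U (x + y) = U x + U y"
    and sc: "\<And>c x. U (c *s x) = L2_scale c (U x)"
    and ip: "\<And>x y. L2_inner (U x) (U y) = cvec_inner x y"
    using U by (auto simp: L2_unitary_def)
  have 0: "U 0 = 0" using sc[of 0 0] by simp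
  have sum: "U (\<Sum>i\<in>I. f i) = (\<Sum>i\<in>I. U (f i))" for I :: "nat set" and f
    by (induction I rule: infinite_finite_induct) (auto simp: 0 add)
  have pow: "(A ^^ i) (U x) = U ((((*v) S) ^^ i) x)" for i x
    by (induction i) (auto simp: A)
  have poly: "poly_operator L2_scale p A (U x) = U (poly_operator (*s) p ((*v) S) x)" for p x
    by (simp add: poly_operator_def sum sc pow)
  have 1: "numerical_range L2_inner K A = numerical_range cvec_inner UNIV ((*v) S)"
    unfolding numerical_range_def K by (auto simp: A ip) (metis A ip rangeI)
  have 2: "operator_norm L2_inner K (poly_operator L2_scale p A)
      = operator_norm cvec_inner UNIV (poly_operator (*s) p ((*v) S))" for p
  proof -
    have "{x \<in> K. sqrt (Re (L2_inner x x)) \<le> 1} = U ` {x \<in> UNIV. sqrt (Re (cvec_inner x x)) \<le> 1}"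
      by (auto simp: K ip)
    then show ?thesis by (simp add: operator_norm_def image_image poly ip)
  qed
  show ?thesis by (simp add: crouzeix_def crouzeix_matrix_def 1 2)
qed

text \<open>Two candidates differ by an element of K orthogonal to K, hence to itself. Existence of
  the projection is settled each time by exhibiting the value h.\<close>

lemma L2_proj_eqI:
  assumes K: "L2.subspace K" and h: "h \<in> K" "f - h \<in> L2_orth_complement K"
  shows "L2_proj K f = h"
  unfolding L2_proj_def
proof (rule the_equality)
  fix h' assume h': "h' \<in> K \<and> f - h' \<in> L2_orth_complement K"
  have "h - h' \<in> K" using K h(1) h' by (simp add: L2.subspace_diff)
  then have "L2_inner (f - h') (h - h') = 0" "L2_inner (f - h) (h - h') = 0"
    using h h' by (auto simp: L2_orth_complement_def)
  then have "L2_inner (h - h') (h - h') = 0"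
    by (simp add: L2_inner_diff_left)
  then show "h' = h" by (simp add: L2_inner_self_eq_0)
qed (use h in auto)

text \<open>The compression of a multiplication is determined by its sesquilinear form on the model
  space. Comparing forms makes \<open>U (S *v x)\<close> the projection of
  \<open>L2_mult g (U x)\<close>.\<close>

lemma truncated_toeplitz_unitary:
  fixes U :: "complex ^ 'n \<Rightarrow> circle_L2"
  assumes U: "L2_unitary U (model_space \<theta>)"
    and eq: "\<And>x y. L2_inner (L2_mult g (U x)) (U y) = cvec_inner (S *v x) y"
  shows "crouzeix_truncated_toeplitz \<theta> g \<longleftrightarrow> crouzeix_matrix S"
  unfolding crouzeix_truncated_toeplitz_def
proof (rule crouzeix_unitary[OF U])
  have K: "model_space \<theta> = range U" and add: "\<And>x y. U (x + y) = U x + U y"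
    and sc: "\<And>c x. U (c *s x) = L2_scale c (U x)"
    and ip: "\<And>x y. L2_inner (U x) (U y) = cvec_inner x y"
    using U by (auto simp: L2_unitary_def)
  have 0: "U 0 = 0" using sc[of 0 0] by simp
  have sub: "L2.subspace (range U)"
    unfolding L2.subspace_def
    by (auto simp flip: add sc intro: range_eqI[where x = 0] simp: 0)
  fix x
  show "truncated_toeplitz \<theta> g (U x) = U (S *v x)"
    unfolding truncated_toeplitz_def K
    by (rule L2_proj_eqI[OF sub]) (auto simp: L2_orth_complement_def L2_inner_diff_left eq ip)
qed

subsection \<open>Orthonormal bases\<close>

lemma orthonormal_coeff:
  assumes "finite E" "\<And>x y. x \<in> E \<Longrightarrow> y \<in> E \<Longrightarrow> L2_inner x y = (if x = y then 1 else 0)" "y \<in> E"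
  shows "L2_inner (\<Sum>x\<in>E. L2_scale (c x) x) y = c y"
proof -
  have "L2_inner (\<Sum>x\<in>E. L2_scale (c x) x) y = (\<Sum>x\<in>E. if x = y then c x else 0)"
    unfolding L2_inner_sum_left L2_inner_scale_left
    by (rule sum.cong) (simp_all add: assms(2,3))
  then show ?thesis using assms(1,3) by simp
qed

lemma orthonormal_independent:
  assumes "finite E" "\<And>x y. x \<in> E \<Longrightarrow> y \<in> E \<Longrightarrow> L2_inner x y = (if x = y then 1 else 0)"
  shows "L2.independent E"
  unfolding L2.dependent_finite[OF assms(1)]
proof safe
  fix u v assume "(\<Sum>v\<in>E. L2_scale (u v) v) = 0" "v \<in> E" "u v \<noteq> 0"
  then show False using orthonormal_coeff[OF assms, where c = u and y = v] by simp
qed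

text \<open>The factor is real so that normalizing a fixed vector of an antilinear map keeps it
  fixed.\<close>

lemma L2_normalize:
  assumes "w \<noteq> 0"
  obtains r :: real where "L2_inner (L2_scale r w) (L2_scale r w) = 1"
proof -
  have pos: "Re (L2_inner w w) > 0"
    using L2_inner_self[of w] L2_inner_self_eq_0[of w] assms
    by (metis complex_eq_iff less_eq_real_def zero_complex.sel)
  then have "L2_inner (L2_scale (1 / sqrt (Re (L2_inner w w))) w) (L2_scale (1 / sqrt (Re (L2_inner w w))) w) = 1"
    using L2_inner_self(1)[of w]
    by (simp add: L2_inner_scale_left L2_inner_scale_right complex_eq_iff Re_divide Im_divide
       real_sqrt_mult_self power2_eq_square flip: of_real_mult)
  then show thesis using that[of "1 / sqrt (Re (L2_inner w w))"] by simp
qed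

text \<open>A maximal orthonormal set of fixed vectors spans, since for a vector \<open>v\<close> orthogonal to it
  either \<open>v + C v\<close> or \<open>\<i> v\<close> is a further fixed vector.\<close>

lemma conjugation_basis:
  assumes K: "L2.subspace K" and dim: "L2.dim K = n" "n > 0"
    and C_K: "\<And>x. x \<in> K \<Longrightarrow> C x \<in> K"
    and C_add: "\<And>x y. C (x + y) = C x + C y"
    and C_scale: "\<And>c x. C (L2_scale c x) = L2_scale (cnj c) (C x)"
    and C_C: "\<And>x. C (C x) = x"
    and C_inner: "\<And>x y. L2_inner (C x) (C y) = L2_inner y x"
  obtains E where "finite E" "card E = n" "L2.span E = K" "\<And>x. x \<in> E \<Longrightarrow> C x = x"
    "\<And>x y. x \<in> E \<Longrightarrow> y \<in> E \<Longrightarrow> L2_inner x y = (if x = y then 1 else 0)"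
proof -
  obtain B where B: "B \<subseteq> K" "L2.independent B" "K \<subseteq> L2.span B" "card B = n"
    using L2.basis_exists[of K] dim(1) by blast
  \<comment> \<open>Infinite sets have cardinality 0, so a positive dimension \<open>n\<close>
    carries the finite-dimensionality of K.\<close>
  have finB: "finite B" using B(4) dim(2) by (simp add: card_ge_0_finite)
  define good where "good E \<longleftrightarrow> finite E \<and> E \<subseteq> K \<and> (\<forall>x\<in>E. C x = x) \<and>
    (\<forall>x\<in>E. \<forall>y\<in>E. L2_inner x y = (if x = y then 1 else 0))" for E
  have bound: "card E \<le> n" if E: "good E" for E
  proof -
    have "L2.independent E" using E by (intro orthonormal_independent) (auto simp: good_def)
    moreover have "E \<subseteq> L2.span B" using E B(3) by (auto simp: good_def)
    ultimately show ?thesis using L2.independent_span_bound[OF finB] B(4) by blast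
  qed
  have "good {}" by (simp add: good_def)
  then have "\<exists>E. good E \<and> (\<forall>E'. good E' \<longrightarrow> card E' \<le> card E)"
    using bound by (intro Lattices_Big.ex_has_greatest_nat[where b = "Suc n"]) (auto simp: less_Suc_eq_le)
  then obtain E where E: "good E" and max: "\<And>E'. good E' \<Longrightarrow> card E' \<le> card E" by blast
  have fin: "finite E" and EK: "E \<subseteq> K" and EC: "\<And>x. x \<in> E \<Longrightarrow> C x = x"
    and on: "\<And>x y. x \<in> E \<Longrightarrow> y \<in> E \<Longrightarrow> L2_inner x y = (if x = y then 1 else 0)"
    using E by (auto simp: good_def)
  have "K \<subseteq> L2.span E"
  proof
    fix v assume v: "v \<in> K"
    define v' where "v' = v - (\<Sum>x\<in>E. L2_scale (L2_inner v x) x)"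
    have v'K: "v' \<in> K" unfolding v'_def
      using v EK by (intro L2.subspace_diff[OF K] L2.subspace_sum[OF K] L2.subspace_scale[OF K]) auto
    have orth: "L2_inner v' y = 0" if "y \<in> E" for y
      unfolding v'_def using orthonormal_coeff[OF fin on, of y "L2_inner v"] that
      by (simp add: L2_inner_diff_left)
    have orthC: "L2_inner (C v') y = 0" if "y \<in> E" for y
      using C_inner[of v' y] EC[OF that] orth[OF that] L2_inner_commute[of y v'] by simp
    have no: False if w: "w \<in> K" "w \<noteq> 0" "C w = w" "\<And>y. y \<in> E \<Longrightarrow> L2_inner w y = 0" for w
    proof -
      obtain r :: real where r: "L2_inner (L2_scale r w) (L2_scale r w) = 1"
        by (rule L2_normalize[OF w(2)])
      let ?w = "L2_scale r w"
      have o: "L2_inner ?w y = 0" "L2_inner y ?w = 0" if "y \<in> E" for y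
        using w(4)[OF that] L2_inner_commute[of y w] by (simp_all add: L2_inner_scale_left L2_inner_scale_right)
      have nE: "?w \<notin> E" using o r by force
      moreover have "good (insert ?w E)"
        unfolding good_def using nE fin EK EC on o r w(3) L2.subspace_scale[OF K w(1)]
        by (auto simp: C_scale)
      ultimately show False using max[of "insert ?w E"] fin by simp
    qed
    have "v' = 0"
    proof (rule ccontr)
      assume nz: "v' \<noteq> 0"
      have "v' + C v' = 0"
      proof (rule ccontr)
        assume "v' + C v' \<noteq> 0"
        moreover have "C (v' + C v') = v' + C v'" by (simp add: C_add C_C add.commute)
        moreover have "v' + C v' \<in> K" by (intro L2.subspace_add[OF K] v'K C_K)
        ultimately show False using no[of "v' + C v'"] by (simp add: L2_inner_add_left orth orthC)
      qed
      then have "C v' = - v'" by (simp add: eq_neg_iff_add_eq_0 add.commute)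
      then have "C (L2_scale \<i> v') = L2_scale \<i> v'" by (simp add: C_scale)
      moreover have "L2_scale \<i> v' \<noteq> 0" using nz by simp
      ultimately show False
        using no[of "L2_scale \<i> v'"] L2.subspace_scale[OF K v'K] orth by (simp add: L2_inner_scale_left)
    qed
    then have "v = (\<Sum>x\<in>E. L2_scale (L2_inner v x) x)" by (simp add: v'_def)
    moreover have "(\<Sum>x\<in>E. L2_scale (L2_inner v x) x) \<in> L2.span E"
      by (intro L2.span_sum L2.span_scale L2.span_base)
    ultimately show "v \<in> L2.span E" by simp
  qed
  then have sp: "L2.span E = K" using L2.span_minimal[OF EK K] by auto
  then have "card E = n"
    using L2.dim_span_eq_card_independent[OF orthonormal_independent[OF fin on]] dim(1) by simp
  then show thesis using that fin sp EC on by blast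
qed

lemma unitary_of_basis:
  fixes e :: "'n::finite \<Rightarrow> circle_L2"
  assumes on: "\<And>i j. L2_inner (e i) (e j) = (if i = j then 1 else 0)"
    and sp: "L2.span (range e) = K"
  shows "L2_unitary (\<lambda>x. \<Sum>i\<in>UNIV. L2_scale (x $ i) (e i)) K"
proof -
  have inj: "inj e" using on by (metis injI zero_neq_one)
  have "range (\<lambda>x :: complex ^ 'n. \<Sum>i\<in>UNIV. L2_scale (x $ i) (e i)) = K"
  proof -
    have "(\<Sum>i\<in>UNIV. L2_scale (x $ i) (e i)) \<in> K" for x :: "complex ^ 'n"
      unfolding sp[symmetric] by (intro L2.span_sum L2.span_scale L2.span_base) auto
    moreover have "y \<in> range (\<lambda>x :: complex ^ 'n. \<Sum>i\<in>UNIV. L2_scale (x $ i) (e i))" if "y \<in> K" for y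
    proof -
      have "y \<in> range (\<lambda>u. \<Sum>v\<in>range e. L2_scale (u v) v)"
        using that L2.span_finite[of "range e"] sp by simp
      then obtain u where "y = (\<Sum>v\<in>range e. L2_scale (u v) v)" by blast
      then have "y = (\<Sum>i\<in>UNIV. L2_scale ((\<chi> i. u (e i)) $ i) (e i))"
        by (simp add: sum.reindex[OF inj])
      then show ?thesis by blast
    qed
    ultimately show ?thesis by blast
  qed
  then show ?thesis
    by (auto simp: L2_unitary_def L2.scale_left_distrib sum.distrib L2.scale_sum_right cvec_inner_def
        L2_inner_sum_left L2_inner_sum_right L2_inner_scale_left L2_inner_scale_right on if_distrib
        mult.commute cong: if_cong)
qed

subsection \<open>Truncated Toeplitz operators are complex symmetric\<close>

text \<open>On the circle this antilinear isometry exchanges the frequencies n and -1 - n, so it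
  swaps \<open>H2\<close> with its orthogonal complement. Multiplication by the inner function is
  kept apart, where one factor is bounded and \<open>L2_mult\<close> is a true product.\<close>

lift_definition L2_flip :: "circle_L2 \<Rightarrow> circle_L2" is "\<lambda>f z. cnj (z * f z)"
  by (auto simp: L2_rel_def simp del: complex_cnj_mult intro!: square_integrable_cnj square_integrable_id_mult
      elim: eventually_mono)

lemma L2_flip_abs:
  "square_integrable f \<Longrightarrow> L2_flip (abs_circle_L2 f) = abs_circle_L2 (\<lambda>z. cnj (z * f z))"
  by (simp add: L2_flip.abs_eq L2_rel_refl)

lemma square_integrable_flip: "square_integrable f \<Longrightarrow> square_integrable (\<lambda>z. cnj (z * f z))"
  by (intro square_integrable_cnj square_integrable_id_mult)

lemma inner_function_abs:
  assumes "inner_function \<theta>"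
  obtains t where "\<theta> = abs_circle_L2 t" "hardy t" "AE z in circle_measure. cmod (t z) = 1"
    "abs_circle_L2 t \<in> Linf"
proof -
  obtain t where t: "square_integrable t" "\<theta> = abs_circle_L2 t" using L2_cases by metis
  have u: "AE z in circle_measure. cmod (t z) = 1" and "hardy t"
    using assms t by (auto simp: inner_function_def unimodular.abs_eq L2_rel_refl H2_iff_hardy)
  moreover have "AE z in circle_measure. cmod (t z) \<le> 1"
    using u by eventually_elim simp
  then have "abs_circle_L2 t \<in> Linf" using t by (auto simp: Linf_iff)
  ultimately show thesis using that t by blast
qed

definition model_conj :: "circle_L2 \<Rightarrow> circle_L2 \<Rightarrow> circle_L2"
  where "model_conj \<theta> x = L2_mult \<theta> (L2_flip x)"

context
  fixes \<theta> t
  assumes \<theta>: "\<theta> = abs_circle_L2 t" and t: "hardy t" "AE z in circle_measure. cmod (t z) = 1"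
    and tL: "abs_circle_L2 t \<in> Linf"
begin

lemma model_conj_abs:
  assumes "square_integrable f"
  shows "square_integrable (\<lambda>z. t z * cnj (z * f z))"
    and "model_conj \<theta> (abs_circle_L2 f) = abs_circle_L2 (\<lambda>z. t z * cnj (z * f z))"
  using L2_mult_abs[OF hardy_square_integrable[OF t(1)] square_integrable_flip[OF assms] tL]
  by (simp_all only: \<theta> model_conj_def L2_flip_abs[OF assms])

lemma model_conj_add: "model_conj \<theta> (x + y) = model_conj \<theta> x + model_conj \<theta> y"
proof -
  obtain f g where [simp]: "x = abs_circle_L2 f" "y = abs_circle_L2 g"
    and s: "square_integrable f" "square_integrable g" using L2_cases by metis
  have "model_conj \<theta> (x + y) = abs_circle_L2 (\<lambda>z. t z * cnj (z * (f z + g z)))"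
    using s by (simp only: \<open>x = _\<close> \<open>y = _\<close> plus_circle_L2.abs_eq L2_rel_refl
        square_integrable_add model_conj_abs(2))
  moreover have "model_conj \<theta> x + model_conj \<theta> y
      = abs_circle_L2 (\<lambda>z. t z * cnj (z * f z) + t z * cnj (z * g z))"
    using s by (simp only: \<open>x = _\<close> \<open>y = _\<close> plus_circle_L2.abs_eq L2_rel_refl model_conj_abs)
  ultimately show ?thesis by (simp add: distrib_left)
qed

lemma model_conj_scale: "model_conj \<theta> (L2_scale c x) = L2_scale (cnj c) (model_conj \<theta> x)"
proof -
  obtain f where [simp]: "x = abs_circle_L2 f" and s: "square_integrable f" using L2_cases by metis
  have "model_conj \<theta> (L2_scale c x) = abs_circle_L2 (\<lambda>z. t z * cnj (z * (c * f z)))"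
    using s by (simp only: \<open>x = _\<close> L2_scale.abs_eq L2_rel_refl square_integrable_scale model_conj_abs(2))
  moreover have "L2_scale (cnj c) (model_conj \<theta> x) = abs_circle_L2 (\<lambda>z. cnj c * (t z * cnj (z * f z)))"
    using s by (simp only: \<open>x = _\<close> L2_scale.abs_eq L2_rel_refl model_conj_abs)
  ultimately show ?thesis by (simp add: mult_ac)
qed

lemma model_conj_conj: "model_conj \<theta> (model_conj \<theta> x) = x"
proof -
  obtain f where [simp]: "x = abs_circle_L2 f" and s: "square_integrable f" using L2_cases by metis
  note s1 = model_conj_abs(1)[OF s]
  have "AE z in circle_measure. t z * cnj (z * (t z * cnj (z * f z))) = f z"
    using t(2) AE_circle
  proof eventually_elim
    case (elim z)
    have "t z * cnj (z * (t z * cnj (z * f z))) = (t z * cnj (t z)) * (z * cnj z) * f z"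
      by (simp add: mult_ac)
    then show ?case using elim by (simp add: complex_norm_square[symmetric])
  qed
  then show ?thesis
    using s s1 model_conj_abs(1)[OF s1] by (simp only: \<open>x = _\<close> model_conj_abs(2) abs_L2_eq_iff)
qed

lemma model_conj_inner: "L2_inner (model_conj \<theta> x) (model_conj \<theta> y) = L2_inner y x"
proof -
  obtain f g where [simp]: "x = abs_circle_L2 f" "y = abs_circle_L2 g"
    and s: "square_integrable f" "square_integrable g" using L2_cases by metis
  note [measurable] = s[THEN square_integrable_measurable]
    square_integrable_measurable[OF hardy_square_integrable[OF t(1)]]
  have "(\<integral>z. t z * cnj (z * f z) * cnj (t z * cnj (z * g z)) \<partial>circle_measure)
      = (\<integral>z. g z * cnj (f z) \<partial>circle_measure)"
  proof (rule integral_cong_AE)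
    show "AE z in circle_measure. t z * cnj (z * f z) * cnj (t z * cnj (z * g z)) = g z * cnj (f z)"
      using t(2) AE_circle
    proof eventually_elim
      case (elim z)
      have "t z * cnj (z * f z) * cnj (t z * cnj (z * g z))
          = (t z * cnj (t z)) * (z * cnj z) * (g z * cnj (f z))"
        by (simp add: mult_ac)
      then show ?case using elim by (simp add: complex_norm_square[symmetric])
    qed
  qed measurable
  then show ?thesis using s model_conj_abs
    by (simp only: \<open>x = _\<close> \<open>y = _\<close> model_conj_abs(2) L2_inner.abs_eq L2_rel_refl)
qed

text \<open>The conjugation exchanges the two defining conditions of the model space. The
  coefficient of index \<open>- m\<close> of the image is the conjugate of the pairing of f with
  \<open>t * z ^ (m - 1)\<close>, which vanishes because f is orthogonal to the multiples of t. The
  pairing of the image with \<open>t * h\<close> is the conjugated mean of \<open>z * f * h\<close>,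
  which vanishes by \<open>hardy_mult_integral\<close>.\<close>

lemma model_conj_model_space:
  assumes "x \<in> model_space \<theta>" shows "model_conj \<theta> x \<in> model_space \<theta>"
proof -
  obtain f where x: "x = abs_circle_L2 f" and s: "square_integrable f" using L2_cases by metis
  have st: "square_integrable t" using t(1) by (rule hardy_square_integrable)
  note [measurable] = square_integrable_measurable[OF s] square_integrable_measurable[OF st]
  have hf: "hardy f" using assms by (simp add: model_space_def x H2_iff_hardy s)
  have orth: "(\<integral>z. f z * cnj (t z * h z) \<partial>circle_measure) = 0" if h: "hardy h" for h
  proof -
    note sh = hardy_square_integrable[OF h]
    have "abs_circle_L2 h \<in> H2" using h sh by (simp add: H2_iff_hardy)
    then have "L2_inner x (L2_mult \<theta> (abs_circle_L2 h)) = 0"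
      using assms by (auto simp: model_space_def L2_orth_complement_def)
    then show ?thesis
      by (simp only: x \<theta> L2_mult_abs[OF st sh tL] L2_inner.abs_eq L2_rel_refl s)
  qed
  let ?g = "\<lambda>z. t z * cnj (z * f z)"
  note sg = model_conj_abs(1)[OF s]
  have "hardy ?g"
    unfolding hardy_def
  proof (intro conjI sg allI impI)
    fix m :: nat assume "1 \<le> m"
    then obtain k where m: "m = Suc k" by (cases m) auto
    have "(\<integral>z. ?g z * z ^ m \<partial>circle_measure) = (\<integral>z. cnj (f z * cnj (t z * (poly (monom 1 k) z))) \<partial>circle_measure)"
    proof (rule integral_cong_circle)
      fix z assume "cmod z = 1"
      then have "z * cnj z = 1" by (simp add: complex_norm_square[symmetric])
      moreover have "?g z * z ^ m = t z * cnj (f z) * z ^ k * (z * cnj z)"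
        by (simp add: m mult_ac)
      ultimately show "?g z * z ^ m = cnj (f z * cnj (t z * (poly (monom 1 k) z)))"
        by (simp add: poly_monom mult_ac)
    qed measurable
    also have "\<dots> = cnj (\<integral>z. f z * cnj (t z * (poly (monom 1 k) z)) \<partial>circle_measure)"
      by (rule Bochner_Integration.integral_cnj)
    finally show "(\<integral>z. ?g z * z ^ m \<partial>circle_measure) = 0"
      using orth[OF hardy_poly] by simp
  qed
  moreover have "L2_inner (model_conj \<theta> x) (L2_mult \<theta> y) = 0" if "y \<in> H2" for y
  proof -
    obtain h where y: "y = abs_circle_L2 h" and sh: "square_integrable h" using L2_cases by metis
    have hh: "hardy h" using that sh by (simp add: y H2_iff_hardy)
    note [measurable] = square_integrable_measurable[OF sh]
    have "(\<integral>z. ?g z * cnj (t z * h z) \<partial>circle_measure) = (\<integral>z. cnj (z * f z * h z) \<partial>circle_measure)"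
    proof (rule integral_cong_AE)
      show "AE z in circle_measure. ?g z * cnj (t z * h z) = cnj (z * f z * h z)"
        using t(2)
      proof eventually_elim
        case (elim z)
        have "?g z * cnj (t z * h z) = (t z * cnj (t z)) * cnj (z * f z * h z)"
          by (simp add: mult_ac)
        then show ?case using elim by (simp add: complex_norm_square[symmetric])
      qed
    qed measurable
    also have "\<dots> = cnj (\<integral>z. z * f z * h z \<partial>circle_measure)"
      by (rule Bochner_Integration.integral_cnj)
    also have "\<dots> = 0" using hardy_mult_integral[OF hf hh] by simp
    finally show ?thesis
      by (simp only: x y model_conj_abs(2)[OF s])
        (simp only: \<theta> L2_mult_abs[OF st sh tL] L2_inner.abs_eq L2_rel_refl sg)
  qed
  ultimately show ?thesis
    using sg by (auto simp: model_space_def L2_orth_complement_def x model_conj_abs(2)[OF s] H2_iff_hardy)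
qed

text \<open>For fixed vectors the integrand \<open>u z * f z * cnj (h z)\<close> equals
  \<open>u z * t z * cnj (z * f z * h z)\<close>, which is symmetric in f and h for every symbol
  u.\<close>

lemma truncated_toeplitz_symmetric:
  assumes g: "g \<in> Linf" and x: "model_conj \<theta> x = x" and y: "model_conj \<theta> y = y"
  shows "L2_inner (L2_mult g x) y = L2_inner (L2_mult g y) x"
proof -
  have st: "square_integrable t" using t(1) by (rule hardy_square_integrable)
  obtain u f h where [simp]: "g = abs_circle_L2 u" "x = abs_circle_L2 f" "y = abs_circle_L2 h"
    and s: "square_integrable u" "square_integrable f" "square_integrable h" using L2_cases by metis
  note [measurable] = s[THEN square_integrable_measurable] square_integrable_measurable[OF st]
  have f: "AE z in circle_measure. t z * cnj (z * f z) = f z"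
    using x s model_conj_abs by (simp only: \<open>x = _\<close> model_conj_abs(2) abs_L2_eq_iff)
  have h: "AE z in circle_measure. t z * cnj (z * h z) = h z"
    using y s model_conj_abs by (simp only: \<open>y = _\<close> model_conj_abs(2) abs_L2_eq_iff)
  have "(\<integral>z. u z * f z * cnj (h z) \<partial>circle_measure) = (\<integral>z. u z * h z * cnj (f z) \<partial>circle_measure)"
  proof (rule integral_cong_AE)
    show "AE z in circle_measure. u z * f z * cnj (h z) = u z * h z * cnj (f z)"
      using f h
    proof eventually_elim
      case (elim z)
      have "f z * cnj (h z) = t z * cnj (z * f z) * cnj (h z)" using elim by simp
      also have "\<dots> = t z * cnj (z * h z) * cnj (f z)" by (simp add: mult_ac)
      also have "\<dots> = h z * cnj (f z)" using elim by simp
      finally show ?case by (simp add: mult.assoc)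
    qed
  qed measurable
  then show ?thesis
    using s g L2_mult_abs by (simp only: \<open>g = _\<close> \<open>x = _\<close> \<open>y = _\<close> L2_mult_abs L2_inner.abs_eq L2_rel_refl)
qed

end

lemma subspace_model_space:
  "L2.subspace (model_space \<theta>)"
proof -
  have "L2.subspace H2"
    unfolding L2.subspace_def
  proof (intro conjI ballI allI)
    show "0 \<in> H2"
      using hardy_scale[OF hardy_1, of 0]
      by (simp add: zero_circle_L2.abs_eq H2_iff_hardy square_integrable_0)
    fix x assume x: "x \<in> H2"
    obtain f where f: "x = abs_circle_L2 f" "square_integrable f" using L2_cases by metis
    show "x + y \<in> H2" if y: "y \<in> H2" for y
    proof -
      obtain g where "y = abs_circle_L2 g" "square_integrable g" using L2_cases by metis
      then show ?thesis using x y f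
        by (simp add: plus_circle_L2.abs_eq L2_rel_refl H2_iff_hardy square_integrable_add hardy_add)
    qed
    show "L2_scale c x \<in> H2" for c using x f
      by (simp add: L2_scale.abs_eq L2_rel_refl H2_iff_hardy square_integrable_scale hardy_scale)
  qed
  moreover have "L2.subspace (L2_orth_complement S)" for S
    by (auto simp: L2.subspace_def L2_orth_complement_def L2_inner_add_left L2_inner_scale_left)
  ultimately show ?thesis unfolding model_space_def by (intro L2.subspace_inter)
qed

theorem truncated_toeplitz_unitarily_equivalent_symmetric:
  assumes \<theta>: "inner_function \<theta>" and dim: "L2.dim (model_space \<theta>) = CARD('n::finite)" and g: "g \<in> Linf"
  obtains S :: "complex ^ 'n ^ 'n" where "S = transpose S"
    "crouzeix_truncated_toeplitz \<theta> g \<longleftrightarrow> crouzeix_matrix S"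
proof -
  obtain t where t: "\<theta> = abs_circle_L2 t" "hardy t" "AE z in circle_measure. cmod (t z) = 1"
    "abs_circle_L2 t \<in> Linf" by (rule inner_function_abs[OF \<theta>])
  note C = model_conj_model_space[OF t] model_conj_add[OF t] model_conj_scale[OF t]
    model_conj_conj[OF t] model_conj_inner[OF t]
  obtain E where E: "finite E" "card E = CARD('n)" "L2.span E = model_space \<theta>"
    "\<And>x. x \<in> E \<Longrightarrow> model_conj \<theta> x = x"
    "\<And>x y. x \<in> E \<Longrightarrow> y \<in> E \<Longrightarrow> L2_inner x y = (if x = y then 1 else 0)"
    using conjugation_basis[OF subspace_model_space dim _ C] by auto
  obtain e where e: "bij_betw e (UNIV :: 'n set) E"
    using finite_same_card_bij[of "UNIV :: 'n set" E] E(1,2) by auto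
  then have eE: "range e = E" "\<And>i. e i \<in> E" "inj e" by (auto simp: bij_betw_def)
  have on: "L2_inner (e i) (e j) = (if i = j then 1 else 0)" for i j
    using E(5)[OF eE(2) eE(2), of i j] eE(3) by (simp add: inj_eq)
  let ?U = "\<lambda>x :: complex ^ 'n. \<Sum>i\<in>UNIV. L2_scale (x $ i) (e i)"
  define S :: "complex ^ 'n ^ 'n" where "S = (\<chi> i j. L2_inner (L2_mult g (e j)) (e i))"
  have U: "L2_unitary ?U (model_space \<theta>)"
    by (rule unitary_of_basis[OF on]) (simp add: eE E(3))
  have "L2_inner (L2_mult g (?U x)) (?U y) = cvec_inner (S *v x) y" for x y
    by (simp add: L2_mult_sum_right[OF g] L2_mult_scale_right[OF g] L2_inner_sum_left L2_inner_sum_right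
        L2_inner_scale_left L2_inner_scale_right cvec_inner_def matrix_vector_mult_def S_def
        sum_distrib_left sum_distrib_right mult_ac)
  then have "crouzeix_truncated_toeplitz \<theta> g \<longleftrightarrow> crouzeix_matrix S"
    by (rule truncated_toeplitz_unitary[OF U])
  moreover have "S = transpose S"
    using truncated_toeplitz_symmetric[OF t g E(4)[OF eE(2)] E(4)[OF eE(2)]]
    by (simp add: S_def transpose_def vec_eq_iff)
  ultimately show thesis using that by blast
qed

subsection \<open>Finite Blaschke products\<close>

text \<open>The finite Blaschke product with zeros \<alpha>, without unimodular normalizing
  constants. The split into a polynomial and a product of kernels lets both
  \<open>hardy_poly_mult\<close> and \<open>hardy_szego_mult\<close> apply.\<close>

definition blaschke :: "('n::finite \<Rightarrow> complex) \<Rightarrow> complex \<Rightarrow> complex"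
  where "blaschke \<alpha> z = (\<Prod>i\<in>UNIV. (z - \<alpha> i) * szego (\<alpha> i) z)"

definition L2_szego :: "complex \<Rightarrow> circle_L2"
  where "L2_szego \<mu> = abs_circle_L2 (szego \<mu>)"

lemma hardy_prod_szego_mult:
  assumes "hardy f" "\<And>i. i \<in> I \<Longrightarrow> cmod (\<alpha> i) < 1"
  shows "hardy (\<lambda>z. (\<Prod>i\<in>I. szego (\<alpha> i) z) * f z)"
  using assms(2)
proof (induction I rule: infinite_finite_induct)
  case (insert a I)
  then have "hardy (\<lambda>z. szego (\<alpha> a) z * ((\<Prod>i\<in>I. szego (\<alpha> i) z) * f z))"
    by (intro hardy_szego_mult) auto
  with insert show ?case by (simp add: mult.assoc)
qed (use assms(1) in auto)

lemma poly_prod_linear: "poly (\<Prod>i\<in>I. [:- \<alpha> i, 1:]) z = (\<Prod>i\<in>I. z - (\<alpha> i :: complex))"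
  by (simp add: poly_prod)

lemma hardy_blaschke_mult:
  assumes "hardy f" "\<And>i. cmod (\<alpha> i) < 1"
  shows "hardy (\<lambda>z. blaschke \<alpha> z * f z)"
proof -
  have "hardy (\<lambda>z. poly (\<Prod>i\<in>UNIV. [:- \<alpha> i, 1:]) z * ((\<Prod>i\<in>UNIV. szego (\<alpha> i) z) * f z))"
    by (intro hardy_poly_mult hardy_prod_szego_mult assms)
  then show ?thesis by (simp add: blaschke_def prod.distrib poly_prod_linear mult.assoc)
qed

lemma hardy_blaschke: "(\<And>i. cmod (\<alpha> i) < 1) \<Longrightarrow> hardy (blaschke \<alpha>)"
  using hardy_blaschke_mult[OF hardy_1, of \<alpha>] by simp

lemma cmod_blaschke:
  assumes "\<And>i. cmod (\<alpha> i) < 1" "cmod z = 1"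
  shows "cmod (blaschke \<alpha> z) = 1"
proof -
  have "cmod ((z - \<alpha> i) * szego (\<alpha> i) z) = 1" for i
  proof -
    have "cmod ((z - \<alpha> i) * szego (\<alpha> i) z) = cmod ((z - \<alpha> i) * cnj (szego (\<alpha> i) z))"
      by (simp add: norm_mult)
    then show ?thesis using cnj_szego_circle(2)[OF assms(1,2)] assms(2) by simp
  qed
  then show ?thesis by (simp add: blaschke_def flip: prod_norm)
qed

lemma inner_function_blaschke:
  assumes "\<And>i. cmod (\<alpha> i) < 1"
  shows "inner_function (abs_circle_L2 (blaschke \<alpha>))" "abs_circle_L2 (blaschke \<alpha>) \<in> Linf"
proof -
  have h: "hardy (blaschke \<alpha>)" by (rule hardy_blaschke[OF assms])
  note s = hardy_square_integrable[OF h]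
  show "inner_function (abs_circle_L2 (blaschke \<alpha>))"
    using h s cmod_blaschke[of \<alpha>, OF assms]
    by (auto simp: inner_function_def H2_iff_hardy unimodular.abs_eq L2_rel_refl intro: AE_circleI)
  show "abs_circle_L2 (blaschke \<alpha>) \<in> Linf"
    unfolding Linf_iff[OF s] using cmod_blaschke[of \<alpha>, OF assms] by (intro exI[of _ 1] AE_circleI) simp
qed

text \<open>Zeros are divided out one at a time. Pairing f with the kernel at a new point
  \<open>\<alpha> a\<close> gives the pairing of the current quotient times the product of the
  differences \<open>\<alpha> a - \<alpha> i\<close>; this is nonzero by injectivity, so the
  quotient still vanishes at \<open>\<alpha> a\<close>.\<close>

lemma hardy_divide_prod:
  assumes f: "hardy f" and fin: "finite I" and inj: "inj_on \<alpha> I"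
    and \<alpha>: "\<And>i. i \<in> I \<Longrightarrow> cmod (\<alpha> i) < 1"
    and 0: "\<And>i. i \<in> I \<Longrightarrow> (\<integral>z. f z * cnj (szego (\<alpha> i) z) \<partial>circle_measure) = 0"
  shows "\<exists>b. hardy b \<and> (\<forall>z. cmod z = 1 \<longrightarrow> f z = (\<Prod>i\<in>I. z - \<alpha> i) * b z)"
  using fin inj \<alpha> 0
proof (induction I rule: finite_induct)
  case empty
  then show ?case using f by auto
next
  case (insert a I)
  have "inj_on \<alpha> I" using insert.prems(1) by (rule inj_on_subset) auto
  then obtain b where b: "hardy b" "\<And>z. cmod z = 1 \<Longrightarrow> f z = (\<Prod>i\<in>I. z - \<alpha> i) * b z"
    using insert.IH insert.prems by auto
  note a = insert.prems(2)[of a, simplified]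
  let ?P = "\<Prod>i\<in>I. [:- \<alpha> i, 1:]"
  note [measurable] = square_integrable_measurable[OF hardy_square_integrable[OF f]]
    square_integrable_measurable[OF hardy_square_integrable[OF b(1)]]
  have "0 = (\<integral>z. f z * cnj (szego (\<alpha> a) z) \<partial>circle_measure)"
    using insert.prems(3)[of a] by simp
  also have "\<dots> = (\<integral>z. poly ?P z * b z * cnj (szego (\<alpha> a) z) \<partial>circle_measure)"
    by (rule integral_cong_circle) (auto simp: b(2) poly_prod_linear[symmetric] simp del: poly_prod)
  also have "\<dots> = (\<Prod>i\<in>I. \<alpha> a - \<alpha> i) * (\<integral>z. b z * cnj (szego (\<alpha> a) z) \<partial>circle_measure)"
    by (subst szego_inner_poly_mult[OF b(1) a]) (simp only: poly_prod_linear)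
  finally have "(\<integral>z. b z * cnj (szego (\<alpha> a) z) \<partial>circle_measure) = 0"
    using insert.hyps insert.prems(1) by (auto simp: inj_on_def)
  then have "hardy (\<lambda>z. b z / (z - \<alpha> a))" by (rule hardy_divide[OF b(1) a])
  moreover have "f z = (\<Prod>i\<in>insert a I. z - \<alpha> i) * (b z / (z - \<alpha> a))" if "cmod z = 1" for z
    using b(2)[OF that] cnj_szego_circle(3)[OF a that] insert.hyps by simp
  ultimately show ?case by blast
qed

text \<open>Dividing by the Blaschke product instead of its numerator only multiplies the quotient
  by the polynomial of denominators.\<close>

lemma hardy_divide_blaschke:
  fixes \<alpha> :: "'n::finite \<Rightarrow> complex"
  assumes f: "hardy f" and inj: "inj \<alpha>" and \<alpha>: "\<And>i. cmod (\<alpha> i) < 1"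
    and 0: "\<And>i. (\<integral>z. f z * cnj (szego (\<alpha> i) z) \<partial>circle_measure) = 0"
  shows "\<exists>b. hardy b \<and> (\<forall>z. cmod z = 1 \<longrightarrow> f z = blaschke \<alpha> z * b z)"
proof -
  obtain b where b: "hardy b" "\<And>z. cmod z = 1 \<Longrightarrow> f z = (\<Prod>i\<in>UNIV. z - \<alpha> i) * b z"
    using hardy_divide_prod[OF f finite inj \<alpha> 0] by auto
  let ?Q = "\<Prod>i\<in>UNIV. [:1, - cnj (\<alpha> i):]"
  have Q: "poly ?Q z = (\<Prod>i\<in>UNIV. 1 - cnj (\<alpha> i) * z)" for z
    by (simp add: poly_prod mult.commute)
  have "f z = blaschke \<alpha> z * (poly ?Q z * b z)" if "cmod z = 1" for z
  proof -
    have "(\<Prod>i\<in>UNIV. szego (\<alpha> i) z) * poly ?Q z = 1"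
      unfolding Q prod.distrib[symmetric]
      using szego_denominator_nonzero[OF \<alpha>, of z] that by (simp add: szego_def)
    then have "blaschke \<alpha> z * poly ?Q z = (\<Prod>i\<in>UNIV. z - \<alpha> i)"
      by (simp add: blaschke_def prod.distrib mult.assoc del: poly_prod)
    then show ?thesis using b(2)[OF that] by (simp add: mult.assoc[symmetric] del: poly_prod)
  qed
  then show ?thesis using hardy_poly_mult[OF b(1)] by blast
qed

lemma L2_szego_H2: "cmod \<mu> < 1 \<Longrightarrow> L2_szego \<mu> \<in> H2"
  by (simp add: L2_szego_def H2_iff_hardy hardy_square_integrable hardy_szego)

lemma L2_inner_szego:
  "cmod \<mu> < 1 \<Longrightarrow> cmod \<nu> < 1 \<Longrightarrow> L2_inner (L2_szego \<mu>) (L2_szego \<nu>) = 1 / (1 - cnj \<mu> * \<nu>)"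
  by (simp add: L2_szego_def L2_inner.abs_eq L2_rel_refl hardy_square_integrable hardy_szego
      szego_inner_szego)

lemma L2_poly:
  "abs_circle_L2 (poly p) \<in> Linf" "abs_circle_L2 (poly p) \<in> H2"
proof -
  have s: "square_integrable (poly p)" by (intro hardy_square_integrable hardy_poly)
  have "compact (poly p ` sphere 0 1)"
    by (intro compact_continuous_image continuous_intros) auto
  then obtain C where "\<And>z. cmod z = 1 \<Longrightarrow> cmod (poly p z) \<le> C"
    by (metis bounded_iff compact_imp_bounded image_eqI mem_sphere_0)
  then show "abs_circle_L2 (poly p) \<in> Linf"
    unfolding Linf_iff[OF s] by (intro exI[of _ C] AE_circleI)
  show "abs_circle_L2 (poly p) \<in> H2" using s by (simp add: H2_iff_hardy hardy_poly)
qed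

lemma L2_inner_poly_mult_szego:
  assumes x: "x \<in> H2" and \<mu>: "cmod \<mu> < 1"
  shows "L2_inner (L2_mult (abs_circle_L2 (poly p)) x) (L2_szego \<mu>) = poly p \<mu> * L2_inner x (L2_szego \<mu>)"
proof -
  obtain f where f: "x = abs_circle_L2 f" "square_integrable f" using L2_cases by metis
  have hf: "hardy f" using x f by (simp add: H2_iff_hardy)
  have s: "square_integrable (poly p)" by (intro hardy_square_integrable hardy_poly)
  note m = L2_mult_abs[OF s f(2) L2_poly(1)]
  have sz: "square_integrable (szego \<mu>)" by (intro hardy_square_integrable hardy_szego \<mu>)
  show ?thesis
    unfolding f(1) m(2) L2_szego_def using m(1) sz f(2)
    by (simp add: L2_inner.abs_eq L2_rel_refl szego_inner_poly_mult[OF hf \<mu>])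
qed

lemma cvec_inner_axis:
  "cvec_inner (axis i 1 :: complex ^ 'n) (axis j 1) = (if i = j then 1 else 0)"
proof -
  have "cvec_inner (axis i 1 :: complex ^ 'n) (axis j 1)
      = (\<Sum>k\<in>UNIV. if k = i then (if i = j then 1 else 0) else 0)"
    unfolding cvec_inner_def by (rule sum.cong) (auto simp: axis_def)
  then show ?thesis by simp
qed

lemma unitary_expansion:
  fixes U :: "complex ^ 'n \<Rightarrow> circle_L2"
  assumes "L2_unitary U K"
  shows "U w = (\<Sum>i\<in>UNIV. L2_scale (w $ i) (U (axis i 1)))"
proof -
  have U: "\<And>x y. U (x + y) = U x + U y" "\<And>c x. U (c *s x) = L2_scale c (U x)"
    using assms by (auto simp: L2_unitary_def)
  have 0: "U 0 = 0" using U(2)[of 0 0] by simp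
  have "U (\<Sum>i\<in>I. w $ i *s axis i 1) = (\<Sum>i\<in>I. L2_scale (w $ i) (U (axis i 1)))" for I
    by (induction I rule: infinite_finite_induct) (simp_all add: U 0)
  then show ?thesis by (metis basis_expansion)
qed

text \<open>The unitary \<open>U\<close> is only used for the existence of the orthogonal projection onto the span.\<close>

theorem model_space_blaschke:
  fixes \<alpha> :: "'n::finite \<Rightarrow> complex" and U :: "complex ^ 'm \<Rightarrow> circle_L2"
  assumes inj: "inj \<alpha>" and \<alpha>: "\<And>i. cmod (\<alpha> i) < 1"
    and U: "L2_unitary U (L2.span (range (\<lambda>i. L2_szego (\<alpha> i))))"
  shows "model_space (abs_circle_L2 (blaschke \<alpha>)) = L2.span (range (\<lambda>i. L2_szego (\<alpha> i)))"
proof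
  let ?\<theta> = "abs_circle_L2 (blaschke \<alpha>)"
  note hB = hardy_blaschke[of \<alpha>, OF \<alpha>]
  note sB = hardy_square_integrable[OF hB]
  note BL = inner_function_blaschke(2)[of \<alpha>, OF \<alpha>]
  have "L2_szego (\<alpha> j) \<in> model_space ?\<theta>" for j
  proof -
    have "L2_inner (L2_szego (\<alpha> j)) (L2_mult ?\<theta> y) = 0" if y: "y \<in> H2" for y
    proof -
      obtain h where h: "y = abs_circle_L2 h" "square_integrable h" using L2_cases by metis
      have hh: "hardy h" using y h by (simp add: H2_iff_hardy)
      have sz: "square_integrable (szego (\<alpha> j))" by (intro hardy_square_integrable hardy_szego \<alpha>)
      note m = L2_mult_abs[OF sB h(2) BL]
      have hp: "hardy (\<lambda>z. (\<Prod>i\<in>UNIV. szego (\<alpha> i) z) * h z)"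
        by (intro hardy_prod_szego_mult hh \<alpha>)
      have "L2_inner (L2_mult ?\<theta> y) (L2_szego (\<alpha> j))
          = (\<integral>z. (poly (\<Prod>i\<in>UNIV. [:- \<alpha> i, 1:]) z * ((\<Prod>i\<in>UNIV. szego (\<alpha> i) z) * h z))
              * cnj (szego (\<alpha> j) z) \<partial>circle_measure)"
        unfolding h(1) m(2) L2_szego_def using m(1) sz
        by (simp add: L2_inner.abs_eq L2_rel_refl blaschke_def prod.distrib poly_prod_linear mult.assoc del: poly_prod)
      \<comment> \<open>Pairing with the kernel at \<open>\<alpha> j\<close> evaluates the numerator
        of the Blaschke product at one of its zeros.\<close>
      also have "\<dots> = 0"
        by (subst szego_inner_poly_mult[OF hp \<alpha>]) (auto simp: poly_prod_linear simp del: poly_prod)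
      finally show ?thesis by (metis L2_inner_commute complex_cnj_zero)
    qed
    then show ?thesis
      using L2_szego_H2[OF \<alpha>] by (auto simp: model_space_def L2_orth_complement_def)
  qed
  then show sub: "L2.span (range (\<lambda>i. L2_szego (\<alpha> i))) \<subseteq> model_space ?\<theta>"
    by (intro L2.span_minimal subspace_model_space) auto
  show "model_space ?\<theta> \<subseteq> L2.span (range (\<lambda>i. L2_szego (\<alpha> i)))"
  proof
    fix x assume x: "x \<in> model_space ?\<theta>"
    define e where "e = (\<lambda>i :: 'm. U (axis i 1))"
    define y where "y = (\<Sum>i\<in>UNIV. L2_scale (L2_inner x (e i)) (e i))"
    have U': "range U = L2.span (range (\<lambda>i. L2_szego (\<alpha> i)))" "\<And>x y. U (x + y) = U x + U y"
      "\<And>c x. U (c *s x) = L2_scale c (U x)" "\<And>x y. L2_inner (U x) (U y) = cvec_inner x y"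
      using U by (auto simp: L2_unitary_def)
    have on: "L2_inner (e i) (e j) = (if i = j then 1 else 0)" for i j
      by (simp add: e_def U' cvec_inner_axis)
    have yU: "y \<in> range U"
      unfolding U'(1) y_def e_def
      by (intro L2.span_sum L2.span_scale) (use U'(1) in auto)
    have orth: "L2_inner (x - y) (U w) = 0" for w
    proof -
      have "U w = (\<Sum>i\<in>UNIV. L2_scale (w $ i) (e i))"
        unfolding e_def by (rule unitary_expansion[OF U])
      moreover have "L2_inner (x - y) (e i) = 0" for i
        by (simp add: y_def L2_inner_diff_left L2_inner_sum_left L2_inner_scale_left on if_distrib cong: if_cong)
      ultimately show ?thesis by (simp add: L2_inner_sum_right L2_inner_scale_right)
    qed
    have xy: "x - y \<in> model_space ?\<theta>"
      using x sub yU unfolding U'(1) by (intro L2.subspace_diff[OF subspace_model_space]) auto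
    obtain f where f: "x - y = abs_circle_L2 f" "square_integrable f" using L2_cases by metis
    have hf: "hardy f" using xy f by (simp add: model_space_def H2_iff_hardy)
    have 0: "(\<integral>z. f z * cnj (szego (\<alpha> i) z) \<partial>circle_measure) = 0" for i
    proof -
      have "L2_szego (\<alpha> i) \<in> range U" unfolding U'(1) by (intro L2.span_base) auto
      then have "L2_inner (x - y) (L2_szego (\<alpha> i)) = 0" using orth by auto
      then show ?thesis
        using f by (simp add: L2_szego_def L2_inner.abs_eq L2_rel_refl hardy_square_integrable hardy_szego[OF \<alpha>])
    qed
    obtain b where b: "hardy b" "\<And>z. cmod z = 1 \<Longrightarrow> f z = blaschke \<alpha> z * b z"
      using hardy_divide_blaschke[OF hf inj \<alpha> 0] by blast
    note sb = hardy_square_integrable[OF b(1)]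
    note m = L2_mult_abs[OF sB sb BL]
    \<comment> \<open>The remainder vanishes at all points, so it is a multiple of the inner
      function; lying in the model space too, it is orthogonal to itself.\<close>
    have "x - y = L2_mult ?\<theta> (abs_circle_L2 b)"
      unfolding f(1) m(2) abs_L2_eq_iff[OF f(2) m(1)] using b(2) by (rule AE_circleI)
    moreover have "abs_circle_L2 b \<in> H2" using b(1) sb by (simp add: H2_iff_hardy)
    ultimately have "L2_inner (x - y) (x - y) = 0"
      using xy by (auto simp: model_space_def L2_orth_complement_def)
    then have "x = y" by (simp add: L2_inner_self_eq_0)
    then show "x \<in> L2.span (range (\<lambda>i. L2_szego (\<alpha> i)))" using yU U'(1) by simp
  qed
qed

lemma dim_unitary:
  fixes U :: "complex ^ 'n \<Rightarrow> circle_L2"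
  assumes U: "L2_unitary U K" shows "L2.dim K = CARD('n)"
proof -
  have U': "range U = K" "\<And>x y. U (x + y) = U x + U y"
      "\<And>c x. U (c *s x) = L2_scale c (U x)" "\<And>x y. L2_inner (U x) (U y) = cvec_inner x y"
      using U by (auto simp: L2_unitary_def)
  define e where "e = (\<lambda>i :: 'n. U (axis i 1))"
  have on: "L2_inner (e i) (e j) = (if i = j then 1 else 0)" for i j
    by (simp add: e_def U' cvec_inner_axis)
  have inj: "inj e" using on by (metis injI zero_neq_one)
  have ind: "L2.independent (range e)"
    by (rule orthonormal_independent) (auto simp: on inj_eq[OF inj])
  have "K \<subseteq> L2.span (range e)"
  proof
    fix y assume "y \<in> K"
    then obtain w where w: "y = U w" using U'(1) by blast
    have "y = (\<Sum>i\<in>UNIV. L2_scale (w $ i) (e i))"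
      unfolding w e_def by (rule unitary_expansion[OF U])
    moreover have "(\<Sum>i\<in>UNIV. L2_scale (w $ i) (e i)) \<in> L2.span (range e)"
      by (intro L2.span_sum L2.span_scale L2.span_base rangeI)
    ultimately show "y \<in> L2.span (range e)" by simp
  qed
  moreover have "range e \<subseteq> K" unfolding U'(1)[symmetric] e_def by auto
  ultimately have "L2.dim K = card (range e)" using ind L2.basis_card_eq_dim by metis
  then show ?thesis using inj by (simp add: card_image)
qed

subsection \<open>Gram matrices of complex orthogonal bases\<close>

text \<open>With \<open>cvec_inner\<close> linear in its first argument, this is the Gram matrix of
  the entrywise conjugated columns of X, the vectors that are sent to kernels.\<close>

definition gram :: "complex ^ 'n ^ 'n \<Rightarrow> 'n \<Rightarrow> 'n \<Rightarrow> complex"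
  where "gram X i j = (\<Sum>m\<in>UNIV. cnj (X $ m $ i) * X $ m $ j)"

lemma gram_commute: "gram X j i = cnj (gram X i j)"
  by (simp add: gram_def mult.commute)

lemma gram_self: "gram X i i = complex_of_real (\<Sum>m\<in>UNIV. (cmod (X $ m $ i))\<^sup>2)"
proof -
  have "gram X i i = (\<Sum>m\<in>UNIV. complex_of_real ((cmod (X $ m $ i))\<^sup>2))"
    unfolding gram_def by (simp only: complex_norm_square mult.commute)
  then show ?thesis by simp
qed

lemma orthogonal_columns:
  fixes X :: "complex ^ 'n ^ 'n"
  assumes "transpose X ** X = mat 1"
  shows "(\<Sum>m\<in>UNIV. X $ m $ i * X $ m $ j) = (if i = j then 1 else 0)"
  using assms by (simp add: vec_eq_iff matrix_matrix_mult_def transpose_def mat_def)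

lemma orthogonal_rows:
  fixes X :: "complex ^ 'n ^ 'n"
  assumes "transpose X ** X = mat 1"
  shows "(\<Sum>m\<in>UNIV. X $ i $ m * X $ j $ m) = (if i = j then 1 else 0)"
proof -
  have "X ** transpose X = mat 1" using assms matrix_left_right_inverse by blast
  then show ?thesis by (simp add: vec_eq_iff matrix_matrix_mult_def transpose_def mat_def)
qed

lemma gram_self_pos:
  assumes "transpose X ** X = mat 1"
  obtains p where "gram X i i = complex_of_real p" "p > 0"
proof
  show "gram X i i = complex_of_real (\<Sum>m\<in>UNIV. (cmod (X $ m $ i))\<^sup>2)" by (rule gram_self)
  have "\<exists>m. X $ m $ i \<noteq> 0"
    using orthogonal_columns[OF assms, of i i] by (rule contrapos_pp) simp
  then show "(\<Sum>m\<in>UNIV. (cmod (X $ m $ i))\<^sup>2) > 0"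
    by (meson sum_pos2 finite UNIV_I zero_less_norm_iff zero_less_power zero_le_power2)
qed

text \<open>With G the Gram matrix and bars for conjugates, G^T G is X^T times the conjugate of X
  X^T times X. The rows of X are orthonormal for the bilinear form as well, so the middle factor is
  1, and X^T X remains.\<close>

lemma gram_orthogonal:
  fixes X :: "complex ^ 'n ^ 'n"
  assumes "transpose X ** X = mat 1"
  shows "(\<Sum>k\<in>UNIV. gram X k i * gram X k j) = (if i = j then 1 else 0)"
proof -
  have "(\<Sum>k\<in>UNIV. gram X k i * gram X k j)
      = (\<Sum>k\<in>UNIV. \<Sum>m\<in>UNIV. \<Sum>l\<in>UNIV. cnj (X $ m $ k * X $ l $ k) * (X $ m $ i * X $ l $ j))"
    unfolding gram_def sum_product by (intro sum.cong refl) (simp add: mult_ac)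
  also have "\<dots> = (\<Sum>m\<in>UNIV. \<Sum>l\<in>UNIV. cnj (\<Sum>k\<in>UNIV. X $ m $ k * X $ l $ k) * (X $ m $ i * X $ l $ j))"
    unfolding cnj_sum sum_distrib_right
    by (rule trans[OF sum.swap]) (rule sum.cong[OF refl sum.swap])
  also have "\<dots> = (\<Sum>m\<in>UNIV. \<Sum>l\<in>UNIV. if l = m then X $ m $ i * X $ l $ j else 0)"
    by (intro sum.cong refl) (auto simp: orthogonal_rows[OF assms])
  also have "\<dots> = (if i = j then 1 else 0)"
    using orthogonal_columns[OF assms, of i j] by simp
  finally show ?thesis .
qed

text \<open>The determinant of X is 1 or -1, and the Gram determinant is its squared modulus, so the
  sign disappears.\<close>

lemma gram_det:
  fixes X :: "complex ^ 3 ^ 3"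
  assumes "transpose X ** X = mat 1"
  shows "det (\<chi> i j. gram X i j) = 1"
proof -
  let ?Y = "\<chi> i j. cnj (X $ i $ j)"
  have 1: "det X * det X = 1"
    using arg_cong[OF assms, of det] by (simp add: det_mul det_transpose det_I)
  have "(\<chi> i j. gram X i j) = transpose ?Y ** X"
    by (simp add: vec_eq_iff matrix_matrix_mult_def transpose_def gram_def)
  then have "det (\<chi> i j. gram X i j) = det ?Y * det X"
    by (simp add: det_mul det_transpose)
  also have "det ?Y = cnj (det X)" by (simp add: det_3)
  also have "cnj (det X) * det X = 1"
  proof -
    have "(det X - 1) * (det X + 1) = 0" using 1 by (simp add: algebra_simps)
    then have "det X = 1 \<or> det X = - 1" by (simp add: eq_neg_iff_add_eq_0)
    then show ?thesis by auto
  qed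
  finally show ?thesis .
qed

text \<open>The inverse is the transpose, and for determinant 1 it is also the adjugate. Only the
  cofactors of the last row are treated; the other rows come from renaming the letters.\<close>

lemma orthogonal_cofactors:
  fixes a b c d e f g h i :: "'a :: comm_ring_1"
  assumes "a * a + d * d + g * g = 1" "b * b + e * e + h * h = 1" "c * c + f * f + i * i = 1"
    "a * b + d * e + g * h = 0" "a * c + d * f + g * i = 0" "b * c + e * f + h * i = 0"
    "a * (e * i - f * h) - b * (d * i - f * g) + c * (d * h - e * g) = 1"
  shows "a * e - b * d = i" "b * f - c * e = g" "c * d - a * f = h"
proof -
  \<comment> \<open>The cross product of the first two rows is paired with the combination of the
    rows with coefficients x, y, z: only the third row contributes, giving z times the determinant.
    Taking a column for (x, y, z) turns the combination into a unit vector and isolates one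
    cofactor.\<close>
  have *: "(b * f - c * e) * (a * x + d * y + g * z) + (c * d - a * f) * (b * x + e * y + h * z)
      + (a * e - b * d) * (c * x + f * y + i * z) = z" for x y z
  proof -
    have "(b * f - c * e) * (a * x + d * y + g * z) + (c * d - a * f) * (b * x + e * y + h * z)
      + (a * e - b * d) * (c * x + f * y + i * z)
      = z * (a * (e * i - f * h) - b * (d * i - f * g) + c * (d * h - e * g))"
      by (simp add: algebra_simps)
    then show ?thesis by (simp add: assms(7))
  qed
  show "a * e - b * d = i" "b * f - c * e = g" "c * d - a * f = h"
    using *[of c f i] *[of a d g] *[of b e h] assms(1-6) by (simp_all add: mult.commute)
qed

text \<open>The Gram matrix is Hermitian, positive and complex orthogonal of determinant \<open>1\<close>, hence
  equal to its matrix of cofactors.\<close>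

lemma gram_cofactors:
  fixes X :: "complex ^ 3 ^ 3"
  assumes X: "transpose X ** X = mat 1"
  obtains p q r :: real and u v w :: complex where
    "p > 0" "q > 0" "r > 0"
    "gram X 1 1 = p" "gram X 2 2 = q" "gram X 3 3 = r"
    "gram X 1 2 = u" "gram X 1 3 = v" "gram X 2 3 = w"
    "gram X 2 1 = cnj u" "gram X 3 1 = cnj v" "gram X 3 2 = cnj w"
    "p * q - u * cnj u = r" "p * r - v * cnj v = q" "q * r - w * cnj w = p"
    "p * w - v * cnj u = - cnj w" "r * cnj u - w * cnj v = - u" "cnj u * cnj w - q * cnj v = v"
proof -
  obtain p where p: "gram X 1 1 = complex_of_real p" "p > 0" by (rule gram_self_pos[OF X])
  obtain q where q: "gram X 2 2 = complex_of_real q" "q > 0" by (rule gram_self_pos[OF X])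
  obtain r where r: "gram X 3 3 = complex_of_real r" "r > 0" by (rule gram_self_pos[OF X])
  define u v w where uvw: "u = gram X 1 2" "v = gram X 1 3" "w = gram X 2 3"
  have c: "gram X 2 1 = cnj u" "gram X 3 1 = cnj v" "gram X 3 2 = cnj w"
    unfolding uvw by (rule gram_commute)+
  note o = gram_orthogonal[OF X, unfolded sum_3]
  note o1 = o[of 1 1, simplified] o[of 2 2, simplified] o[of 3 3, simplified]
    o[of 1 2, simplified] o[of 1 3, simplified] o[of 2 3, simplified]
  note e = o1[unfolded p(1) q(1) r(1) c uvw[symmetric]]
  have d: "p * q * r + u * w * cnj v + v * cnj u * cnj w - p * w * cnj w - u * cnj u * r - v * q * cnj v = (1 :: complex)"
    using gram_det[OF X] by (simp add: det_3 p q r c uvw[symmetric])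
  let ?p = "complex_of_real p" and ?q = "complex_of_real q" and ?r = "complex_of_real r"
  have 1: "?p * ?q - u * cnj u = ?r" "u * w - v * ?q = cnj v" "v * cnj u - ?p * w = cnj w"
    by (rule orthogonal_cofactors[where a = ?p and b = u and c = v and d = "cnj u" and e = ?q and f = w
          and g = "cnj v" and h = "cnj w" and i = ?r]; use e d in \<open>simp add: algebra_simps\<close>)+
  \<comment> \<open>The same lemma after renumbering rows and columns together, in the order 1, 3, 2
    here and 2, 3, 1 below; this leaves the determinant unchanged.\<close>
  have 2: "?p * ?r - v * cnj v = ?q"
    by (rule orthogonal_cofactors(1)[where a = ?p and b = v and c = u and d = "cnj v" and e = ?r and f = "cnj w"
          and g = "cnj u" and h = w and i = ?q]; use e d in \<open>simp add: algebra_simps\<close>)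
  have 3: "?q * ?r - w * cnj w = ?p" "w * cnj v - cnj u * ?r = u" "cnj u * cnj w - ?q * cnj v = v"
    by (rule orthogonal_cofactors[where a = ?q and b = w and c = "cnj u" and d = "cnj w" and e = ?r and f = "cnj v"
          and g = u and h = v and i = ?p]; use e d in \<open>simp add: algebra_simps\<close>)+
  have "p * w - v * cnj u = - cnj w" "r * cnj u - w * cnj v = - u"
    using 1(3) 3(2) by (simp_all add: algebra_simps)
  with 1(1) 2 3(1,3) show thesis using that[of p q r u v w] p q r c uvw by simp
qed

text \<open>The points are normalized by \<open>\<alpha> 1 = 0\<close>, \<open>\<alpha> 2 > 0\<close>; this is the freedom of a disc automorphism.\<close>

theorem gram_szego:
  fixes X :: "complex ^ 3 ^ 3"
  assumes X: "transpose X ** X = mat 1"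
    and nz: "gram X 1 2 \<noteq> 0" "gram X 1 3 \<noteq> 0" "gram X 2 3 \<noteq> 0"
  obtains \<alpha> s :: "3 \<Rightarrow> complex" where "inj \<alpha>" "\<And>i. cmod (\<alpha> i) < 1" "\<And>i. s i \<noteq> 0"
    "\<And>i j. gram X i j = s i * cnj (s j) / (1 - cnj (\<alpha> i) * \<alpha> j)"
proof -
  obtain p q r :: real and u v w :: complex where pos: "p > 0" "q > 0" "r > 0"
    and g: "gram X 1 1 = p" "gram X 2 2 = q" "gram X 3 3 = r"
    "gram X 1 2 = u" "gram X 1 3 = v" "gram X 2 3 = w"
    "gram X 2 1 = cnj u" "gram X 3 1 = cnj v" "gram X 3 2 = cnj w"
    and c: "p * q - u * cnj u = r" "p * r - v * cnj v = q" "q * r - w * cnj w = p"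
    "p * w - v * cnj u = - cnj w"
    by (rule gram_cofactors[OF X])
  have uvw: "u \<noteq> 0" "v \<noteq> 0" "w \<noteq> 0" using nz g by auto
  have norms: "(cmod u)\<^sup>2 = p * q - r" "(cmod v)\<^sup>2 = p * r - q" "(cmod w)\<^sup>2 = q * r - p"
  proof -
    have *: "(cmod z)\<^sup>2 = x - y" if "complex_of_real x - z * cnj z = complex_of_real y" for x y z
    proof -
      have "complex_of_real ((cmod z)\<^sup>2) = complex_of_real (x - y)"
        using that by (simp only: complex_norm_square of_real_diff) (simp add: algebra_simps)
      then show ?thesis by (simp only: of_real_eq_iff)
    qed
    show "(cmod u)\<^sup>2 = p * q - r" "(cmod v)\<^sup>2 = p * r - q" "(cmod w)\<^sup>2 = q * r - p"
      using c(1-3) by (auto intro!: *)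
  qed
  define P where "P = complex_of_real (sqrt p)"
  have P: "P * P = p" "cnj P = P" "P \<noteq> 0"
    using pos by (simp_all add: P_def flip: of_real_mult)
  \<comment> \<open>With the first point at 0, the first row of the Gram matrix dictates s. Then
    \<open>gram X 2 2\<close> requires 1 - a^2 to be the squared modulus of u over p q, which is (p
    q - r)/(p q) by the cofactor relation.\<close>
  define a where "a = sqrt (r / (p * q))"
  have a: "a > 0" "a * a = r / (p * q)" using pos by (simp_all add: a_def)
  \<comment> \<open>Solves the equation for \<open>gram X 2 3\<close>: it asks for 1 - a b = v cnj
    u/(p w), and the cofactor relation turns the right side into 1 + cnj w/(p w).\<close>
  define b where "b = - cnj w / (p * w * a)"
  have cb: "cmod b = 1 / (p * a)"
    using uvw pos a by (simp add: b_def norm_mult norm_divide)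
  have "a\<^sup>2 < 1"
  proof -
    have "p * q - r > 0" using norms(1) uvw by (metis zero_less_norm_iff zero_less_power)
    then show ?thesis using pos by (simp add: power2_eq_square a(2))
  qed
  then have a1: "a < 1" using a(1) by (simp add: power_less_one_iff)
  \<comment> \<open>No freedom is left, yet \<open>gram X 3 3\<close> also prescribes the modulus of
    b, through 1 - (p r - q)/(p r). The cofactor relations make the two values agree.\<close>
  have cb2: "(cmod b)\<^sup>2 = q / (p * r)"
  proof -
    have "(cmod b)\<^sup>2 = 1 / (p * p * (a * a))"
      by (simp add: cb power2_eq_square)
    then show ?thesis using pos by (simp add: a(2))
  qed
  have "(cmod b)\<^sup>2 < 1"
  proof -
    note cb2
    moreover have "p * r - q > 0" using norms(2) uvw by (metis zero_less_norm_iff zero_less_power)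
    ultimately show ?thesis using pos by simp
  qed
  then have b1: "cmod b < 1" by (simp add: power_less_one_iff)
  define \<alpha> where "\<alpha> = (\<lambda>i :: 3. if i = 1 then 0 else if i = 2 then complex_of_real a else b)"
  define s where "s = (\<lambda>i :: 3. if i = 1 then P else if i = 2 then cnj u / P else cnj v / P)"
  show thesis
  proof (rule that[of \<alpha> s])
    show "cmod (\<alpha> i) < 1" for i using a a1 b1 by (simp add: \<alpha>_def)
    show "s i \<noteq> 0" for i using P uvw by (simp add: s_def)
    show gram: "gram X i j = s i * cnj (s j) / (1 - cnj (\<alpha> i) * \<alpha> j)" for i j
    proof -
      have A: "complex_of_real a * complex_of_real a = r / (p * q)"
        using a(2) by (metis of_real_mult)
      have B: "b * cnj b = q / (p * r)"
      proof -
        have "b * cnj b = complex_of_real ((cmod b)\<^sup>2)" by (simp only: complex_norm_square)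
        then show ?thesis by (simp only: cb2)
      qed
      have AB: "a * b = - cnj w / (p * w)" using a(1) by (simp add: b_def)
      then have AB': "a * cnj b = - w / (p * cnj w)"
        by (metis complex_cnj_cnj complex_cnj_complex_of_real complex_cnj_divide complex_cnj_minus complex_cnj_mult)
      have pqr: "complex_of_real p \<noteq> 0" "complex_of_real q \<noteq> 0" "complex_of_real r \<noteq> 0" using pos by auto
      have u: "u * cnj u = p * q - r" "p * q - r \<noteq> (0 :: complex)" and v: "v * cnj v = p * r - q" "p * r - q \<noteq> (0 :: complex)"
        using c uvw by (auto simp: algebra_simps)
      have uv: "v * cnj u = p * w + cnj w" "u * cnj v = p * cnj w + w"
      proof -
        show "v * cnj u = p * w + cnj w" using c(4) by (simp add: algebra_simps)
        from arg_cong[OF this, of cnj] have "cnj v * u = p * cnj w + w" by simp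
        then show "u * cnj v = p * cnj w + w" by (subst mult.commute)
      qed
      have "u = P * (cnj (cnj u / P)) / (1 - 0)" "v = P * (cnj (cnj v / P)) / (1 - 0)"
        using P by simp_all
      have 22: "q = (cnj u / P) * cnj (cnj u / P) / (1 - cnj (complex_of_real a) * complex_of_real a)"
      proof -
        have "(cnj u / P) * cnj (cnj u / P) = (p * q - r) / p"
          using u P by (simp add: mult.commute)
        moreover have "1 - cnj (complex_of_real a) * complex_of_real a = (p * q - r) / (p * q)"
          using A pqr by (simp add: field_simps)
        ultimately show ?thesis using pqr u(2) by (simp only: divide_divide_eq_left divide_divide_eq_right) simp
      qed
      have 33: "r = (cnj v / P) * cnj (cnj v / P) / (1 - cnj b * b)"
      proof -
        have "(cnj v / P) * cnj (cnj v / P) = (p * r - q) / p"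
          using v P by (simp add: mult.commute)
        moreover have "1 - cnj b * b = (p * r - q) / (p * r)"
          using B pqr by (simp add: field_simps)
        ultimately show ?thesis using pqr v(2) by (simp only: divide_divide_eq_left divide_divide_eq_right) simp
      qed
      have nz: "v * cnj u \<noteq> 0" "u * cnj v \<noteq> 0" using uvw by auto
      have 23: "w = (cnj u / P) * cnj (cnj v / P) / (1 - cnj (complex_of_real a) * b)"
      proof -
        have "(cnj u / P) * cnj (cnj v / P) = (v * cnj u) / p" using P by (simp add: mult.commute)
        moreover have "1 - cnj (complex_of_real a) * b = (v * cnj u) / (p * w)"
          using AB pqr uvw uv by (simp add: field_simps)
        ultimately show ?thesis using pqr nz by simp
      qed
      have 32: "cnj w = (cnj v / P) * cnj (cnj u / P) / (1 - cnj b * complex_of_real a)"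
      proof -
        have "(cnj v / P) * cnj (cnj u / P) = (u * cnj v) / p" using P by (simp add: mult.commute)
        moreover have "1 - cnj b * complex_of_real a = (u * cnj v) / (p * cnj w)"
          using AB' pqr uvw uv by (simp add: field_simps)
        ultimately show ?thesis using pqr nz by simp
      qed
      have "\<forall>i j. gram X i j = s i * cnj (s j) / (1 - cnj (\<alpha> i) * \<alpha> j)"
        unfolding forall_3 g \<alpha>_def s_def using 22 33 23 32 P by simp
      then show ?thesis by blast
    qed
    have "\<alpha> 2 \<noteq> \<alpha> 3"
    proof
      assume eq: "\<alpha> 2 = \<alpha> 3"
      \<comment> \<open>Equal points would annihilate this minor, which as a cofactor equals p >
        0.\<close>
      have "gram X 2 2 * gram X 3 3 = gram X 2 3 * gram X 3 2"
        unfolding gram eq by simp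
      then have "q * r - w * cnj w = (0 :: complex)" unfolding g by simp
      then show False using c(3) pos by simp
    qed
    moreover have "\<alpha> 1 \<noteq> \<alpha> 2" "\<alpha> 1 \<noteq> \<alpha> 3" using a cb pos by (auto simp: \<alpha>_def)
    ultimately have "\<forall>i j. \<alpha> i = \<alpha> j \<longrightarrow> i = j"
      unfolding forall_3 by (metis (full_types))
    then show "inj \<alpha>" by (simp add: inj_def)
  qed
qed

section \<open>Truncated Toeplitz operators with prescribed eigenvalues\<close>

lemma interpolating_poly:
  fixes \<alpha> \<Lambda> :: "'n::finite \<Rightarrow> complex"
  assumes "inj \<alpha>"
  obtains p where "\<And>i. poly p (\<alpha> i) = \<Lambda> i"
proof
  define q where "q i = (\<Prod>j\<in>UNIV - {i}. [:- \<alpha> j, 1:])" for i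
  have q: "poly (q i) z = (\<Prod>j\<in>UNIV - {i}. z - \<alpha> j)" for i z
    unfolding q_def by (rule poly_prod_linear)
  have nz: "poly (q i) (\<alpha> i) \<noteq> 0" for i
    using assms unfolding q by (auto simp: inj_def)
  have z: "poly (q i) (\<alpha> k) = 0" if "i \<noteq> k" for i k
    using that unfolding q by auto
  fix k
  have "poly (\<Sum>i\<in>UNIV. smult (\<Lambda> i / poly (q i) (\<alpha> i)) (q i)) (\<alpha> k)
      = (\<Sum>i\<in>UNIV. if i = k then \<Lambda> k else 0)"
    unfolding poly_sum by (rule sum.cong) (auto simp: nz z)
  then show "poly (\<Sum>i\<in>UNIV. smult (\<Lambda> i / poly (q i) (\<alpha> i)) (q i)) (\<alpha> k) = \<Lambda> k"
    by simp
qed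

text \<open>The columns of \<open>X\<close> are eigenvectors of the symmetric matrix \<open>S\<close>; their complex conjugates are
  mapped to the multiples \<open>s i\<close> of the kernels at the points \<open>\<alpha> i\<close>, which have the same Gram matrix.\<close>

theorem truncated_toeplitz_of_gram:
  fixes X S :: "complex ^ 'n ^ 'n" and \<alpha> \<Lambda> s :: "'n \<Rightarrow> complex"
  assumes X: "transpose X ** X = mat 1"
    and inj: "inj \<alpha>" and \<alpha>: "\<And>i. cmod (\<alpha> i) < 1" and s: "\<And>i. s i \<noteq> 0"
    and G: "\<And>i j. gram X i j = s i * cnj (s j) / (1 - cnj (\<alpha> i) * \<alpha> j)"
    and S: "\<And>i j. S $ i $ j = (\<Sum>k\<in>UNIV. X $ i $ k * \<Lambda> k * X $ j $ k)"
  obtains \<theta> g where "inner_function \<theta>" "L2.dim (model_space \<theta>) = CARD('n)" "g \<in> Linf \<inter> H2"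
    "crouzeix_truncated_toeplitz \<theta> g \<longleftrightarrow> crouzeix_matrix S"
proof -
  have X1: "(\<Sum>m\<in>UNIV. X $ m $ i * X $ m $ j) = (if i = j then 1 else 0)" for i j
    using X by (simp add: vec_eq_iff matrix_matrix_mult_def transpose_def mat_def)
  have "X ** transpose X = mat 1" using X matrix_left_right_inverse by blast
  then have X2: "(\<Sum>m\<in>UNIV. X $ i $ m * X $ j $ m) = (if i = j then 1 else 0)" for i j
    by (simp add: vec_eq_iff matrix_matrix_mult_def transpose_def mat_def)
  \<comment> \<open>\<open>a x\<close> are the coordinates of x in the basis of conjugated columns
    of X, while \<open>c x\<close> are its Hermitian inner products with that basis;
    \<open>aG\<close> below passes from the first to the second through the Gram matrix.\<close>
  define a where "a x i = (\<Sum>m\<in>UNIV. x $ m * cnj (X $ m $ i))" for x :: "complex ^ 'n" and i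
  define c where "c x i = (\<Sum>m\<in>UNIV. x $ m * X $ m $ i)" for x :: "complex ^ 'n" and i
  define K where "K = L2.span (range (\<lambda>i. L2_szego (\<alpha> i)))"
  define U where "U x = (\<Sum>i\<in>UNIV. L2_scale (a x i * s i) (L2_szego (\<alpha> i)))" for x :: "complex ^ 'n"
  have expand: "(\<Sum>i\<in>UNIV. a x i * cnj (X $ m $ i)) = x $ m" for x m
  proof -
    have "(\<Sum>i\<in>UNIV. a x i * cnj (X $ m $ i))
        = (\<Sum>i\<in>UNIV. \<Sum>l\<in>UNIV. x $ l * (cnj (X $ l $ i) * cnj (X $ m $ i)))"
      by (simp add: a_def sum_distrib_left sum_distrib_right mult_ac)
    also have "\<dots> = (\<Sum>l\<in>UNIV. x $ l * cnj (\<Sum>i\<in>UNIV. X $ l $ i * X $ m $ i))"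
      by (subst sum.swap) (simp add: sum_distrib_left)
    also have "\<dots> = (\<Sum>l\<in>UNIV. if l = m then x $ l else 0)"
      by (rule sum.cong) (auto simp: X2)
    finally show ?thesis by simp
  qed
  have aG: "(\<Sum>i\<in>UNIV. a x i * gram X i j) = c x j" for x j
  proof -
    have "(\<Sum>i\<in>UNIV. a x i * gram X i j) = (\<Sum>i\<in>UNIV. \<Sum>m\<in>UNIV. a x i * cnj (X $ m $ i) * X $ m $ j)"
      by (simp add: gram_def sum_distrib_left mult_ac)
    also have "\<dots> = (\<Sum>m\<in>UNIV. (\<Sum>i\<in>UNIV. a x i * cnj (X $ m $ i)) * X $ m $ j)"
      by (subst sum.swap) (simp add: sum_distrib_right)
    finally show ?thesis by (simp add: expand c_def)
  qed
  have Uk: "L2_inner (U x) (L2_szego (\<alpha> j)) * cnj (s j) = c x j" for x j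
  proof -
    have "L2_inner (U x) (L2_szego (\<alpha> j)) * cnj (s j)
        = (\<Sum>i\<in>UNIV. a x i * (s i * cnj (s j) / (1 - cnj (\<alpha> i) * \<alpha> j)))"
      by (simp add: U_def L2_inner_sum_left L2_inner_scale_left L2_inner_szego \<alpha> sum_distrib_left
          sum_distrib_right mult_ac)
    then show ?thesis by (simp add: G[symmetric] aG)
  qed
  have inner_U: "L2_inner f (U y) = (\<Sum>j\<in>UNIV. cnj (a y j) * (L2_inner f (L2_szego (\<alpha> j)) * cnj (s j)))" for f y
    by (simp add: U_def L2_inner_sum_right L2_inner_scale_right mult_ac)
  have cnj_a: "(\<Sum>j\<in>UNIV. cnj (a y j) * X $ m $ j) = cnj (y $ m)" for y m
    using arg_cong[OF expand[of y m], of cnj] by simp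
  have "L2_inner (U x) (U y) = cvec_inner x y" for x y
  proof -
    have "L2_inner (U x) (U y) = (\<Sum>j\<in>UNIV. \<Sum>m\<in>UNIV. x $ m * (cnj (a y j) * X $ m $ j))"
      unfolding inner_U Uk by (simp add: c_def sum_distrib_left mult_ac)
    also have "\<dots> = (\<Sum>m\<in>UNIV. x $ m * (\<Sum>j\<in>UNIV. cnj (a y j) * X $ m $ j))"
      by (subst sum.swap) (simp add: sum_distrib_left)
    finally show ?thesis by (simp add: cnj_a cvec_inner_def)
  qed
  moreover have add: "U (x + y) = U x + U y" for x y
    by (simp add: U_def a_def distrib_right sum.distrib L2.scale_left_distrib)
  moreover have scale: "U (b *s x) = L2_scale b (U x)" for b x
  proof -
    have "a (b *s x) i = b * a x i" for i by (simp add: a_def sum_distrib_left mult.assoc)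
    then show ?thesis by (simp add: U_def L2.scale_sum_right mult.assoc)
  qed
  moreover have "range U = K"
  proof
    show "range U \<subseteq> K"
      unfolding K_def U_def by (intro image_subsetI L2.span_sum L2.span_scale L2.span_base rangeI)
    have "L2_szego (\<alpha> i) \<in> range U" for i
    proof -
      define x where "x = (\<chi> m. cnj (X $ m $ i) / s i)"
      have "a x j = (if j = i then 1 / s i else 0)" for j
      proof -
        have "a x j = cnj (\<Sum>m\<in>UNIV. X $ m $ j * X $ m $ i) / s i"
          by (simp add: a_def x_def sum_divide_distrib mult_ac)
        then show ?thesis by (simp add: X1)
      qed
      then have "U x = (\<Sum>j\<in>UNIV. if j = i then L2_szego (\<alpha> i) else 0)"
        unfolding U_def by (intro sum.cong refl) (simp add: s)
      then have "U x = L2_szego (\<alpha> i)" by simp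
      then show ?thesis by (metis rangeI)
    qed
    moreover have "L2.subspace (range U)"
    proof -
      have 0: "U 0 = 0" using scale[of 0 0] by simp
      show ?thesis unfolding L2.subspace_def
        by (auto simp flip: add scale intro: range_eqI[where x = 0] simp: 0)
    qed
    ultimately show "K \<subseteq> range U" unfolding K_def by (intro L2.span_minimal) auto
  qed
  ultimately have U: "L2_unitary U K" by (auto simp: L2_unitary_def)
  define \<theta> where "\<theta> = abs_circle_L2 (blaschke \<alpha>)"
  have model: "model_space \<theta> = K"
    unfolding \<theta>_def K_def by (rule model_space_blaschke[OF inj \<alpha> U[unfolded K_def]])
  have KH: "U x \<in> H2" for x
    using U model by (auto simp: L2_unitary_def model_space_def)
  \<comment> \<open>Pairing a product with the kernel at \<open>\<alpha> j\<close> multiplies by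
    \<open>poly p (\<alpha> j)\<close>, so these values make the compression scale the inner
    products \<open>c x j\<close> by the eigenvalues, as S does.\<close>
  obtain p where p: "\<And>i. poly p (\<alpha> i) = \<Lambda> i" using interpolating_poly[OF inj] by blast
  define g where "g = abs_circle_L2 (poly p)"
  have "L2_inner (L2_mult g (U x)) (U y) = cvec_inner (S *v x) y" for x y
  proof -
    have Sx: "(\<Sum>j\<in>UNIV. X $ i $ j * \<Lambda> j * c x j) = (S *v x) $ i" for i
    proof -
      have "(S *v x) $ i = (\<Sum>m\<in>UNIV. \<Sum>j\<in>UNIV. X $ i $ j * \<Lambda> j * (x $ m * X $ m $ j))"
        by (simp add: matrix_vector_mult_def S sum_distrib_left sum_distrib_right mult_ac)
      also have "\<dots> = (\<Sum>j\<in>UNIV. X $ i $ j * \<Lambda> j * c x j)"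
        by (subst sum.swap) (simp add: c_def sum_distrib_left)
      finally show ?thesis by simp
    qed
    have "L2_inner (L2_mult g (U x)) (U y)
        = (\<Sum>j\<in>UNIV. cnj (a y j) * (\<Lambda> j * (L2_inner (U x) (L2_szego (\<alpha> j)) * cnj (s j))))"
      by (simp add: inner_U g_def L2_inner_poly_mult_szego KH \<alpha> p mult_ac)
    also have "\<dots> = (\<Sum>j\<in>UNIV. \<Sum>i\<in>UNIV. cnj (y $ i) * (X $ i $ j * (\<Lambda> j * c x j)))"
      unfolding Uk by (simp add: a_def sum_distrib_left sum_distrib_right mult_ac)
    also have "\<dots> = (\<Sum>i\<in>UNIV. (\<Sum>j\<in>UNIV. X $ i $ j * \<Lambda> j * c x j) * cnj (y $ i))"
      by (subst sum.swap) (simp add: sum_distrib_left mult_ac)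
    finally show ?thesis unfolding Sx by (simp add: cvec_inner_def)
  qed
  then have "crouzeix_truncated_toeplitz \<theta> g \<longleftrightarrow> crouzeix_matrix S"
    by (rule truncated_toeplitz_unitary[OF U[folded model]])
  moreover have "g \<in> Linf \<inter> H2" unfolding g_def using L2_poly by blast
  moreover have "inner_function \<theta>" unfolding \<theta>_def by (rule inner_function_blaschke(1)[of \<alpha>, OF \<alpha>])
  moreover have "L2.dim (model_space \<theta>) = CARD('n)" unfolding model by (rule dim_unitary[OF U])
  ultimately show thesis using that by blast
qed

text \<open>With \<open>M\<close> the antisymmetric matrix with upper entries \<open>1\<close> we have \<open>M\<^sup>3 = - 3 M\<close>, so that
  \<open>N = (3 e\<^sup>2 - 1) + 2 \<i> e M + 2 e\<^sup>2 M\<^sup>2\<close> is Hermitian with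
  \<open>N\<^sup>T N = (3 e\<^sup>2 - 1)\<^sup>2\<close>. Below, \<open>N = e P - 1\<close> is \<open>cayley e\<close>
  and \<open>P\<close> is \<open>turn e\<close>.\<close>

definition turn :: "complex \<Rightarrow> complex ^ 3 ^ 3"
  where "turn e = vector [vector [- e, 2 * \<i> - 2 * e, 2 * \<i> + 2 * e],
    vector [- 2 * \<i> - 2 * e, - e, 2 * \<i> - 2 * e],
    vector [- 2 * \<i> + 2 * e, - 2 * \<i> - 2 * e, - e]]"

lemma turn_entries:
  "turn e $ 1 $ 1 = - e" "turn e $ 1 $ 2 = 2 * \<i> - 2 * e" "turn e $ 1 $ 3 = 2 * \<i> + 2 * e"
  "turn e $ 2 $ 1 = - 2 * \<i> - 2 * e" "turn e $ 2 $ 2 = - e" "turn e $ 2 $ 3 = 2 * \<i> - 2 * e"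
  "turn e $ 3 $ 1 = - 2 * \<i> + 2 * e" "turn e $ 3 $ 2 = - 2 * \<i> - 2 * e" "turn e $ 3 $ 3 = - e"
  by (simp_all add: turn_def vector_3)

definition cayley :: "complex \<Rightarrow> complex ^ 3 ^ 3"
  where "cayley e = (\<chi> i j. e * turn e $ i $ j - (if i = j then 1 else 0))"

lemma cayley_orthogonal: "transpose (cayley e) ** cayley e = (\<chi> i j. if i = j then (3 * e\<^sup>2 - 1)\<^sup>2 else 0)"
proof -
  have "\<i> * (\<i> * x) = - x" for x by (simp flip: mult.assoc)
  then show ?thesis
    by (simp add: vec_eq_iff forall_3 matrix_matrix_mult_def transpose_def cayley_def sum_3 turn_entries
        power2_eq_square algebra_simps)
qed

lemma cayley_hermitian: "cnj (cayley (complex_of_real e) $ i $ j) = cayley (complex_of_real e) $ j $ i"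
proof -
  have "\<forall>i j. cnj (cayley (complex_of_real e) $ i $ j) = cayley (complex_of_real e) $ j $ i"
    by (simp add: forall_3 cayley_def turn_entries)
  then show ?thesis by blast
qed

section \<open>Removing zero entries of the Gram matrix\<close>

lemma gram_mult:
  "gram (X ** Y) i j = (\<Sum>k\<in>UNIV. \<Sum>l\<in>UNIV. cnj (Y $ k $ i) * gram X k l * Y $ l $ j)"
proof -
  have "gram (X ** Y) i j = (\<Sum>m\<in>UNIV. \<Sum>k\<in>UNIV. \<Sum>l\<in>UNIV. cnj (Y $ k $ i) * (cnj (X $ m $ k) * X $ m $ l) * Y $ l $ j)"
    unfolding gram_def matrix_matrix_mult_def
    by (simp add: sum_product mult_ac) (rule sum.cong[OF refl sum.swap])
  also have "\<dots> = (\<Sum>k\<in>UNIV. \<Sum>l\<in>UNIV. \<Sum>m\<in>UNIV. cnj (Y $ k $ i) * (cnj (X $ m $ k) * X $ m $ l) * Y $ l $ j)"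
    by (rule trans[OF sum.swap]) (rule sum.cong[OF refl sum.swap])
  finally show ?thesis by (simp add: gram_def sum_distrib_left sum_distrib_right)
qed

text \<open>As N = e P - 1 is Hermitian, the new Gram matrix is N G N. Splitting off the factor e
  exposes the derivative at 0, which is -(P G + G P) with P taken at 0.\<close>

lemma gram_cayley:
  fixes X :: "complex ^ 3 ^ 3" and e :: real
  defines "P \<equiv> turn (complex_of_real e)"
  shows "gram (X ** cayley (complex_of_real e)) i j = gram X i j + e *
    (e * (\<Sum>k\<in>UNIV. \<Sum>l\<in>UNIV. P $ i $ k * gram X k l * P $ l $ j)
      - (\<Sum>k\<in>UNIV. P $ i $ k * gram X k j) - (\<Sum>l\<in>UNIV. gram X i l * P $ l $ j))"
proof -
  have *: "gram (X ** cayley (complex_of_real e)) i j = (\<Sum>k\<in>UNIV. \<Sum>l\<in>UNIV.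
    (e * P $ i $ k - (if i = k then 1 else 0)) * gram X k l * (e * P $ l $ j - (if l = j then 1 else 0)))"
    unfolding gram_mult cayley_hermitian by (simp add: cayley_def P_def)
  have "\<forall>i j. (\<Sum>k\<in>UNIV. \<Sum>l\<in>UNIV.
      (e * P $ i $ k - (if i = k then 1 else 0)) * gram X k l * (e * P $ l $ j - (if l = j then 1 else 0)))
    = gram X i j + e * (e * (\<Sum>k\<in>UNIV. \<Sum>l\<in>UNIV. P $ i $ k * gram X k l * P $ l $ j)
      - (\<Sum>k\<in>UNIV. P $ i $ k * gram X k j) - (\<Sum>l\<in>UNIV. gram X i l * P $ l $ j))"
    unfolding forall_3 sum_3 by (simp add: algebra_simps)
  then show ?thesis unfolding * by blast
qed

text \<open>Meant for a Gram matrix with one zero entry off the diagonal, x and y being the other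
  two up to sign and conjugation. A cofactor relation makes one of them vanish too. Then one
  diagonal entry is 1, the other two agree, and the remaining entry is smaller in modulus than their
  common value.\<close>

lemma gram_zero_bound:
  fixes p q r :: real and x y :: complex
  assumes "p > 0" "q > 0" "r > 0" "p * q = r" "p * r - (cmod x)\<^sup>2 = q" "q * r - (cmod y)\<^sup>2 = p" "x * y = 0"
  shows "cmod x + cmod y < p + q"
proof -
  have *: "cmod b < t" if "s > 0" "t > 0" "s * r = t" "t * r - (cmod b)\<^sup>2 = s" "s * t = r" for s t b
  proof -
    have "s * s * t = t" using that(3,5) by (metis mult.assoc)
    then have "s * s = 1" using that(2) by simp
    then have "s = 1" using that(1) by (simp add: square_eq_1_iff)
    then have "(cmod b)\<^sup>2 < t\<^sup>2" using that by (simp add: power2_eq_square)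
    then show ?thesis using that(2) by (simp add: power_less_imp_less_base)
  qed
  from assms(7) have "x = 0 \<or> y = 0" by simp
  then show ?thesis
  proof
    assume "x = 0"
    then show ?thesis using *[of p q y] assms by simp
  next
    assume "y = 0"
    then show ?thesis using *[of q p x] assms by (simp add: mult.commute)
  qed
qed

text \<open>One direction has to serve all three positions. With all upper entries of M equal to 1,
  the derivative of a vanishing entry is 2 i times the sum of two positive diagonal entries and, up
  to sign and conjugation, the two other off-diagonal entries, which are too small to cancel it by
  \<open>gram_zero_bound\<close>.\<close>

lemma turn_derivative_nonzero:
  fixes X :: "complex ^ 3 ^ 3"
  assumes X: "transpose X ** X = mat 1" and ij: "(i, j) \<in> {(1, 2), (1, 3), (2, 3)}" and 0: "gram X i j = 0"
  shows "(\<Sum>k\<in>UNIV. turn 0 $ i $ k * gram X k j) + (\<Sum>l\<in>UNIV. gram X i l * turn 0 $ l $ j) \<noteq> 0"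
proof -
  obtain p q r :: real and u v w :: complex where pos: "p > 0" "q > 0" "r > 0"
    and g: "gram X 1 1 = p" "gram X 2 2 = q" "gram X 3 3 = r"
    "gram X 1 2 = u" "gram X 1 3 = v" "gram X 2 3 = w"
    "gram X 2 1 = cnj u" "gram X 3 1 = cnj v" "gram X 3 2 = cnj w"
    and c: "p * q - u * cnj u = r" "p * r - v * cnj v = q" "q * r - w * cnj w = p"
    "p * w - v * cnj u = - cnj w" "r * cnj u - w * cnj v = - u" "cnj u * cnj w - q * cnj v = v"
    by (rule gram_cofactors[OF X])
  have *: "a * b - (cmod z)\<^sup>2 = y" if "complex_of_real (a * b) - z * cnj z = complex_of_real y" for a b y z
  proof -
    have "complex_of_real (a * b - (cmod z)\<^sup>2) = complex_of_real y"
      using that by (simp only: complex_norm_square of_real_diff)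
    then show ?thesis by (simp only: of_real_eq_iff)
  qed
  note n = *[OF c(1)] *[OF c(2)] *[OF c(3)]
  have nz: "2 * \<i> * (complex_of_real a + complex_of_real b + x + y) \<noteq> 0"
    if "cmod x + cmod y < a + b" for a b x y
  proof
    assume "2 * \<i> * (complex_of_real a + complex_of_real b + x + y) = 0"
    then have "complex_of_real a + complex_of_real b + x + y = 0" by simp
    then have "complex_of_real (a + b) = - (x + y)" by (simp only: eq_neg_iff_add_eq_0 of_real_add add.assoc)
    then have "\<bar>a + b\<bar> = cmod (x + y)" by (metis norm_minus_cancel norm_of_real)
    then show False using that norm_triangle_ineq[of x y] by linarith
  qed
  from ij consider "i = 1" "j = 2" | "i = 1" "j = 3" | "i = 2" "j = 3" by auto
  then show ?thesis
  proof cases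
    case 1
    then have u: "u = 0" using 0 g by simp
    then have "cmod (cnj w) + cmod (- v) < q + p"
      using gram_zero_bound[of q p r "cnj w" "- v"] n c(5) pos by (auto simp: mult.commute)
    from nz[OF this] show ?thesis by (simp add: 1 sum_3 turn_entries g u algebra_simps)
  next
    case 2
    then have v: "v = 0" using 0 g by simp
    then have "cmod w + cmod u < r + p"
      using gram_zero_bound[of r p q w u] n c(6) pos by (auto simp: mult.commute)
    from nz[OF this] show ?thesis by (simp add: 2 sum_3 turn_entries g v algebra_simps)
  next
    case 3
    then have w: "w = 0" using 0 g by simp
    then have "cmod (- v) + cmod (cnj u) < r + q"
      using gram_zero_bound[of r q p "- v" "cnj u"] n c(4) pos by (auto simp: mult.commute)
    from nz[OF this] show ?thesis by (simp add: 3 sum_3 turn_entries g w algebra_simps)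
  qed
qed

lemma tendsto_turn: "((\<lambda>e::real. turn (complex_of_real e) $ i $ j) \<longlongrightarrow> turn 0 $ i $ j) (at 0)"
proof -
  have "\<forall>i j. ((\<lambda>e::real. turn (complex_of_real e) $ i $ j) \<longlongrightarrow> turn 0 $ i $ j) (at 0)"
    unfolding forall_3 turn_entries by (auto intro!: tendsto_eq_intros)
  then show ?thesis by blast
qed

text \<open>A nonzero entry stays nonzero by continuity; a zero entry becomes nonzero because its
  derivative does not vanish.\<close>

theorem orthogonal_perturbation:
  fixes X :: "complex ^ 3 ^ 3"
  assumes X: "transpose X ** X = mat 1"
  obtains Y :: "real \<Rightarrow> complex ^ 3 ^ 3" where "(Y \<longlongrightarrow> X) (at 0)"
    "\<forall>\<^sub>F e in at 0. transpose (Y e) ** Y e = mat 1 \<and>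
      gram (Y e) 1 2 \<noteq> 0 \<and> gram (Y e) 1 3 \<noteq> 0 \<and> gram (Y e) 2 3 \<noteq> 0"
proof -
  \<comment> \<open>\<open>Y e\<close> is X times the Cayley transform (1 - i e M)(1 + i e M)^-1,
    and \<open>d e\<close> is minus the determinant 1 - 3 e^2 of the inverted factor. At e = 0 both
    \<open>cayley e\<close> and \<open>d e\<close> become -1 and the signs cancel.\<close>
  define d where "d e = complex_of_real (3 * e\<^sup>2 - 1)" for e :: real
  define Z where "Z e = X ** cayley (complex_of_real e)" for e
  define Y where "Y e = (\<chi> i j. Z e $ i $ j / d e)" for e
  have d: "(d \<longlongrightarrow> - 1) (at 0)" unfolding d_def by (auto intro!: tendsto_eq_intros)
  then have d0: "\<forall>\<^sub>F e in at 0. d e \<noteq> 0" by (rule tendsto_imp_eventually_ne) simp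
  have gramY: "gram (Y e) i j = gram (Z e) i j / (d e)\<^sup>2" for e i j
    by (simp add: gram_def Y_def d_def sum_divide_distrib power2_eq_square)
  have limY: "(Y \<longlongrightarrow> X) (at 0)"
  proof (intro vec_tendstoI)
    fix i j
    have "((\<lambda>e::real. Z e $ i $ j) \<longlongrightarrow> (\<Sum>k\<in>UNIV. X $ i $ k * (complex_of_real 0 * turn 0 $ k $ j - (if k = j then 1 else 0)))) (at 0)"
      unfolding Z_def matrix_matrix_mult_def cayley_def
      by (simp only: vec_lambda_beta) (intro tendsto_intros tendsto_turn)
    moreover have "(\<Sum>k\<in>UNIV. X $ i $ k * (complex_of_real 0 * turn 0 $ k $ j - (if k = j then 1 else 0))) = - X $ i $ j"
      by (simp add: if_distrib sum_negf cong: if_cong)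
    ultimately have "((\<lambda>e::real. Z e $ i $ j / d e) \<longlongrightarrow> - X $ i $ j / (- 1)) (at 0)"
      by (intro tendsto_divide d) auto
    then show "((\<lambda>e. Y e $ i $ j) \<longlongrightarrow> X $ i $ j) (at 0)" by (simp add: Y_def)
  qed
  have orth: "transpose (Y e) ** Y e = mat 1" if "d e \<noteq> 0" for e
  proof -
    have "transpose (Z e) ** Z e = transpose (cayley e) ** ((transpose X ** X) ** cayley e)"
      unfolding Z_def by (simp add: matrix_transpose_mul matrix_mul_assoc)
    also have "\<dots> = (\<chi> i j. if i = j then (d e)\<^sup>2 else 0)"
      unfolding X matrix_mul_lid cayley_orthogonal d_def
      by (simp add: vec_eq_iff)
    finally have "(\<Sum>k\<in>UNIV. Z e $ k $ i * Z e $ k $ j) = (if i = j then (d e)\<^sup>2 else 0)" for i j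
      by (simp add: vec_eq_iff matrix_matrix_mult_def transpose_def)
    then show ?thesis
      using that
      by (simp add: vec_eq_iff matrix_matrix_mult_def transpose_def mat_def Y_def
          flip: sum_divide_distrib power2_eq_square)
  qed
  have ne: "\<forall>\<^sub>F e in at 0. gram (Z e) i j \<noteq> 0" if ij: "(i, j) \<in> {(1, 2), (1, 3), (2, 3)}" for i j
  proof -
    \<comment> \<open>The difference quotient of this entry of the Gram matrix at 0.\<close>
    define H where "H e = complex_of_real e * (\<Sum>k\<in>UNIV. \<Sum>l\<in>UNIV.
        turn (complex_of_real e) $ i $ k * gram X k l * turn (complex_of_real e) $ l $ j)
      - (\<Sum>k\<in>UNIV. turn (complex_of_real e) $ i $ k * gram X k j)
      - (\<Sum>l\<in>UNIV. gram X i l * turn (complex_of_real e) $ l $ j)" for e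
    define L where "L = complex_of_real 0 * (\<Sum>k\<in>UNIV. \<Sum>l\<in>UNIV. turn 0 $ i $ k * gram X k l * turn 0 $ l $ j)
      - (\<Sum>k\<in>UNIV. turn 0 $ i $ k * gram X k j) - (\<Sum>l\<in>UNIV. gram X i l * turn 0 $ l $ j)"
    have ZH: "gram (Z e) i j = gram X i j + e * H e" for e
      unfolding Z_def gram_cayley H_def ..
    have H: "(H \<longlongrightarrow> L) (at 0)"
      unfolding H_def L_def by (intro tendsto_intros tendsto_turn)
    show ?thesis
    proof (cases "gram X i j = 0")
      case True
      have L: "L = - ((\<Sum>k\<in>UNIV. turn 0 $ i $ k * gram X k j) + (\<Sum>l\<in>UNIV. gram X i l * turn 0 $ l $ j))"
        by (simp add: L_def)
      have "L \<noteq> 0"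
        unfolding L neg_equal_0_iff_equal by (rule turn_derivative_nonzero[OF X ij True])
      then have "\<forall>\<^sub>F e in at 0. H e \<noteq> 0" by (rule tendsto_imp_eventually_ne[OF H])
      moreover have "\<forall>\<^sub>F e in at (0 :: real). e \<noteq> 0" by (simp add: eventually_at_filter)
      ultimately show ?thesis by eventually_elim (simp add: ZH True)
    next
      case False
      have "((\<lambda>e. gram X i j + complex_of_real e * H e) \<longlongrightarrow> gram X i j + complex_of_real 0 * L) (at 0)"
        by (intro tendsto_intros H)
      then have "((\<lambda>e. gram (Z e) i j) \<longlongrightarrow> gram X i j) (at 0)" by (simp add: ZH)
      then show ?thesis using False by (rule tendsto_imp_eventually_ne)
    qed
  qed
  have "\<forall>\<^sub>F e in at 0. transpose (Y e) ** Y e = mat 1 \<and>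
      gram (Y e) 1 2 \<noteq> 0 \<and> gram (Y e) 1 3 \<noteq> 0 \<and> gram (Y e) 2 3 \<noteq> 0"
    using d0 ne[of 1 2, simplified] ne[of 1 3, simplified] ne[of 2 3, simplified]
    by eventually_elim (simp add: orth gramY)
  with limY show thesis using that by blast
qed

subsection \<open>Symmetric matrices with distinct eigenvalues\<close>

lemma symmetric_bilinear:
  fixes S :: "complex ^ 'n ^ 'n"
  assumes "S = transpose S"
  shows "(\<Sum>m\<in>UNIV. (S *v x) $ m * y $ m) = (\<Sum>m\<in>UNIV. x $ m * (S *v y) $ m)"
proof -
  have S: "S $ i $ j = S $ j $ i" for i j
    using arg_cong[OF assms, of "\<lambda>M. M $ i $ j"] by (simp add: transpose_def)
  have "(\<Sum>m\<in>UNIV. (S *v x) $ m * y $ m) = (\<Sum>m\<in>UNIV. \<Sum>k\<in>UNIV. S $ m $ k * x $ k * y $ m)"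
    by (simp add: matrix_vector_mult_def sum_distrib_right)
  also have "\<dots> = (\<Sum>k\<in>UNIV. \<Sum>m\<in>UNIV. S $ k $ m * x $ k * y $ m)"
    by (subst sum.swap) (simp add: S)
  also have "\<dots> = (\<Sum>m\<in>UNIV. x $ m * (S *v y) $ m)"
    by (simp add: matrix_vector_mult_def sum_distrib_left mult_ac)
  finally show ?thesis .
qed

text \<open>Eigenvectors for distinct eigenvalues are orthogonal for the bilinear form b, which has
  nonzero isotropic vectors. An isotropic eigenvector would be orthogonal to the whole eigenbasis,
  which nondegeneracy excludes; so every eigenvector can be normalized by a complex square
  root.\<close>

theorem symmetric_diagonalization:
  fixes S :: "complex ^ 'n ^ 'n" and \<Lambda> :: "'n \<Rightarrow> complex"
  assumes S: "S = transpose S" and inj: "inj \<Lambda>" and ev: "\<And>i. det (S - mat (\<Lambda> i)) = 0"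
  obtains X :: "complex ^ 'n ^ 'n" where "transpose X ** X = mat 1"
    "\<And>i j. S $ i $ j = (\<Sum>k\<in>UNIV. X $ i $ k * \<Lambda> k * X $ j $ k)"
proof -
  have "\<exists>v. v \<noteq> 0 \<and> S *v v = \<Lambda> i *s v" for i
  proof -
    have "\<not> invertible (S - mat (\<Lambda> i))" using ev[of i] by (simp add: invertible_det_nz)
    then obtain v where "v \<noteq> 0" "(S - mat (\<Lambda> i)) *v v = 0"
      unfolding invertible_left_inverse matrix_left_invertible_ker by blast
    moreover have "mat (\<Lambda> i) *v v = \<Lambda> i *s v"
    proof -
      have "(\<Sum>k\<in>UNIV. (if j = k then \<Lambda> i else 0) * v $ k) = (\<Sum>k\<in>UNIV. if k = j then \<Lambda> i * v $ k else 0)" for j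
        by (rule sum.cong) auto
      then show ?thesis by (simp add: vec_eq_iff matrix_vector_mult_def mat_def)
    qed
    ultimately show ?thesis by (auto simp: matrix_vector_mult_diff_rdistrib)
  qed
  then obtain v where v: "\<And>i. v i \<noteq> 0" "\<And>i. S *v v i = \<Lambda> i *s v i" by metis
  define b where "b x y = (\<Sum>m\<in>UNIV. x $ m * y $ m)" for x y :: "complex ^ 'n"
  have ortho: "b (v i) (v j) = 0" if "i \<noteq> j" for i j
  proof -
    have "\<Lambda> i * b (v i) (v j) = \<Lambda> j * b (v i) (v j)"
      using symmetric_bilinear[OF S, of "v i" "v j"] unfolding v(2)
      by (simp add: b_def sum_distrib_left mult_ac)
    moreover have "\<Lambda> i \<noteq> \<Lambda> j" using that inj by (simp add: inj_eq)
    ultimately show ?thesis by simp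
  qed
  define V where "V = (\<chi> m i. v i $ m)"
  have ker: "x = 0" if x: "V *v x = 0" for x
  proof -
    have Vx: "V *v y = (\<Sum>i\<in>UNIV. y $ i *s v i)" for y
      by (simp add: vec_eq_iff V_def matrix_vector_mult_def mult.commute)
    \<comment> \<open>Applying a polynomial in S to a vanishing combination of eigenvectors
      multiplies the coefficients by its values at the eigenvalues; an interpolating polynomial then
      isolates a single coefficient.\<close>
    have p: "(\<Sum>i\<in>UNIV. (x $ i * poly p (\<Lambda> i)) *s v i) = 0" for p
    proof (induction p)
      case 0
      show ?case by simp
    next
      case (pCons a p)
      have "(\<Sum>i\<in>UNIV. (x $ i * poly (pCons a p) (\<Lambda> i)) *s v i)
          = a *s (\<Sum>i\<in>UNIV. x $ i *s v i) + (\<Sum>i\<in>UNIV. (x $ i * poly p (\<Lambda> i)) *s (\<Lambda> i *s v i))"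
        by (simp add: vec_eq_iff sum_distrib_left sum.distrib algebra_simps)
      also have "(\<Sum>i\<in>UNIV. (x $ i * poly p (\<Lambda> i)) *s (\<Lambda> i *s v i))
          = S *v (\<Sum>i\<in>UNIV. (x $ i * poly p (\<Lambda> i)) *s v i)"
      proof -
        have "S *v (\<Sum>i\<in>I. f i) = (\<Sum>i\<in>I. S *v f i)" for I :: "'n set" and f
          by (induction I rule: infinite_finite_induct) (simp_all add: matrix_vector_right_distrib)
        then show ?thesis by (simp add: vector_scalar_commute v(2))
      qed
      finally show ?case using pCons.IH x by (simp add: Vx)
    qed
    have "x $ k = 0" for k
    proof -
      obtain p where "\<And>i. poly p (\<Lambda> i) = (if i = k then 1 else 0)"
        by (rule interpolating_poly[OF inj]) (rule that)
      then have "(\<Sum>i\<in>UNIV. (x $ i * poly p (\<Lambda> i)) *s v i) = (\<Sum>i\<in>UNIV. if i = k then x $ k *s v k else 0)"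
        by (intro sum.cong refl) auto
      then have "x $ k *s v k = 0" by (simp add: p)
      then show ?thesis using v(1)[of k] by simp
    qed
    then show ?thesis by (simp add: vec_eq_iff)
  qed
  have "invertible V"
    unfolding invertible_left_inverse matrix_left_invertible_ker using ker by blast
  then have "invertible (transpose V)" by (simp add: invertible_det_nz)
  then have kerT: "transpose V *v x = 0 \<Longrightarrow> x = 0" for x
    unfolding invertible_left_inverse matrix_left_invertible_ker by blast
  have nz: "b (v i) (v i) \<noteq> 0" for i
  proof
    assume "b (v i) (v i) = 0"
    then have "b (v j) (v i) = 0" for j using ortho by (cases "j = i") auto
    then have "transpose V *v v i = 0"
      by (simp add: vec_eq_iff matrix_vector_mult_def transpose_def V_def b_def)
    then show False using kerT v(1) by blast
  qed
  define X where "X = (\<chi> m i. v i $ m / csqrt (b (v i) (v i)))"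
  have X: "transpose X ** X = mat 1"
  proof -
    have "(\<Sum>k\<in>UNIV. X $ k $ i * X $ k $ j) = (if i = j then 1 else 0)" for i j
    proof -
      have "(\<Sum>k\<in>UNIV. X $ k $ i * X $ k $ j) = b (v i) (v j) / (csqrt (b (v i) (v i)) * csqrt (b (v j) (v j)))"
        by (simp add: X_def b_def sum_divide_distrib)
      then show ?thesis using ortho nz by (simp flip: power2_eq_square)
    qed
    then show ?thesis by (simp add: vec_eq_iff matrix_matrix_mult_def transpose_def mat_def)
  qed
  have SX: "(\<Sum>l\<in>UNIV. S $ i $ l * X $ l $ k) = \<Lambda> k * X $ i $ k" for i k
    using arg_cong[OF v(2)[of k], of "\<lambda>x. x $ i / csqrt (b (v k) (v k))"]
    by (simp add: matrix_vector_mult_def X_def sum_divide_distrib)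
  have "S $ i $ j = (\<Sum>k\<in>UNIV. X $ i $ k * \<Lambda> k * X $ j $ k)" for i j
  proof -
    have "S $ i $ j = (\<Sum>l\<in>UNIV. S $ i $ l * (\<Sum>k\<in>UNIV. X $ l $ k * X $ j $ k))"
      by (simp add: orthogonal_rows[OF X] if_distrib cong: if_cong)
    also have "\<dots> = (\<Sum>k\<in>UNIV. (\<Sum>l\<in>UNIV. S $ i $ l * X $ l $ k) * X $ j $ k)"
      unfolding sum_distrib_left sum_distrib_right by (subst sum.swap) (simp add: mult_ac)
    finally show ?thesis by (simp add: SX mult_ac)
  qed
  with X show thesis using that by blast
qed

subsection \<open>Density of the distinct eigenvalues\<close>

text \<open>The discriminant of the characteristic polynomial \<open>z\<^sup>3 - a z\<^sup>2 + b z - c\<close>.\<close>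

definition disc3 :: "'a::comm_ring_1 ^ 3 ^ 3 \<Rightarrow> 'a"
  where "disc3 T = (let
      a = T$1$1 + T$2$2 + T$3$3;
      b = T$1$1 * T$2$2 - T$1$2 * T$2$1 + T$1$1 * T$3$3 - T$1$3 * T$3$1 + T$2$2 * T$3$3 - T$2$3 * T$3$2;
      c = det T
    in a * a * b * b - 4 * b * b * b - 4 * a * a * a * c + 18 * a * b * c - 27 * c * c)"

text \<open>One root comes from the fundamental theorem of algebra, the other two from the quadratic
  formula for the remaining factor.\<close>

lemma eigenvalues_of_disc3:
  fixes T :: "complex ^ 3 ^ 3"
  assumes "disc3 T \<noteq> 0"
  obtains \<Lambda> :: "3 \<Rightarrow> complex" where "inj \<Lambda>" "\<And>i. det (T - mat (\<Lambda> i)) = 0"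
proof -
  define a where "a = T$1$1 + T$2$2 + T$3$3"
  define b where "b = T$1$1 * T$2$2 - T$1$2 * T$2$1 + T$1$1 * T$3$3 - T$1$3 * T$3$1 + T$2$2 * T$3$3 - T$2$3 * T$3$2"
  define c where "c = det T"
  have disc: "a * a * b * b - 4 * b * b * b - 4 * a * a * a * c + 18 * a * b * c - 27 * c * c \<noteq> 0"
    using assms by (simp add: disc3_def Let_def a_def b_def c_def)
  have char: "det (T - mat z) = - (z * z * z - a * z * z + b * z - c)" for z
    by (simp add: det_3 mat_def a_def b_def c_def algebra_simps)
  have "\<not> constant (poly [:- c, b, - a, 1:])" by (simp add: constant_degree)
  then obtain x where "poly [:- c, b, - a, 1:] x = 0"
    using fundamental_theorem_of_algebra by blast
  then have x: "x * x * x - a * x * x + b * x - c = 0" by (simp add: algebra_simps)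
  \<comment> \<open>The quotient of the characteristic polynomial by \<open>z - x\<close> is z^2 + e
    z + f.\<close>
  define e where "e = x - a"
  define f where "f = b + x * e"
  define r where "r = csqrt (e * e - 4 * f)"
  have r: "r * r = e * e - 4 * f" by (simp add: r_def flip: power2_eq_square)
  define y where "y = (- e + r) / 2"
  define z where "z = (- e - r) / 2"
  have yz: "y + z = - e" "y * z = f"
    using r by (simp_all add: y_def z_def field_simps)
  have a: "a = x + y + z" using yz(1) by (simp add: e_def algebra_simps)
  have b: "b = x * y + y * z + z * x" using yz by (simp add: f_def algebra_simps a e_def)
  have c: "c = x * y * z" using x unfolding a b by (simp add: algebra_simps)
  have roots: "w * w * w - a * w * w + b * w - c = (w - x) * (w - y) * (w - z)" for w
    unfolding a b c by (simp add: algebra_simps)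
  \<comment> \<open>The discriminant is the square of the product of the root differences.\<close>
  have "a * a * b * b - 4 * b * b * b - 4 * a * a * a * c + 18 * a * b * c - 27 * c * c
      = ((x - y) * (y - z) * (z - x)) * ((x - y) * (y - z) * (z - x))"
    unfolding a b c by algebra
  with disc have ne: "x \<noteq> y" "y \<noteq> z" "z \<noteq> x" by auto
  show thesis
  proof (rule that[of "\<lambda>i :: 3. if i = 1 then x else if i = 2 then y else z"])
    have "\<forall>i j :: 3. (if i = 1 then x else if i = 2 then y else z) = (if j = 1 then x else if j = 2 then y else z) \<longrightarrow> i = j"
      unfolding forall_3 using ne by auto
    then show "inj (\<lambda>i :: 3. if i = 1 then x else if i = 2 then y else z)"
      unfolding inj_def .
    show "det (T - mat (if i = 1 then x else if i = 2 then y else z)) = 0" for i :: 3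
      unfolding char roots by auto
  qed
qed

lemma tendsto_disc3:
  fixes T :: "'a \<Rightarrow> complex ^ 3 ^ 3"
  assumes "(T \<longlongrightarrow> S) F"
  shows "((\<lambda>t. disc3 (T t)) \<longlongrightarrow> disc3 S) F"
  unfolding disc3_def Let_def det_3 by (intro tendsto_intros assms)

lemma disc3_smult:
  fixes T :: "complex ^ 3 ^ 3"
  shows "disc3 (\<chi> i j. t * T $ i $ j) = t ^ 6 * disc3 T"
proof -
  let ?T = "\<chi> i j. t * T $ i $ j"
  have a: "?T$1$1 + ?T$2$2 + ?T$3$3 = t * (T$1$1 + T$2$2 + T$3$3)"
    by (simp add: distrib_left)
  have b: "?T$1$1 * ?T$2$2 - ?T$1$2 * ?T$2$1 + ?T$1$1 * ?T$3$3 - ?T$1$3 * ?T$3$1 + ?T$2$2 * ?T$3$3 - ?T$2$3 * ?T$3$2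
    = t * t * (T$1$1 * T$2$2 - T$1$2 * T$2$1 + T$1$1 * T$3$3 - T$1$3 * T$3$1 + T$2$2 * T$3$3 - T$2$3 * T$3$2)"
    by (simp add: algebra_simps)
  have c: "det ?T = t * t * t * det T"
    by (simp add: det_3 algebra_simps)
  have *: "(t * a) * (t * a) * (t * t * b) * (t * t * b) - 4 * (t * t * b) * (t * t * b) * (t * t * b)
      - 4 * (t * a) * (t * a) * (t * a) * (t * t * t * c) + 18 * (t * a) * (t * t * b) * (t * t * t * c)
      - 27 * (t * t * t * c) * (t * t * t * c)
    = t ^ 6 * (a * a * b * b - 4 * b * b * b - 4 * a * a * a * c + 18 * a * b * c - 27 * c * c)" for a b c
    by (simp add: algebra_simps eval_nat_numeral)
  show ?thesis
    unfolding disc3_def Let_def a b c by (rule *)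
qed

text \<open>Along the line from \<open>S\<close> in direction \<open>diag(0, 1, 2)\<close> the discriminant is a polynomial, which
  does not vanish since the discriminant of the direction is \<open>4\<close>.\<close>

lemma disc3_perturbation:
  fixes S :: "complex ^ 3 ^ 3"
  defines "B \<equiv> vector [vector [0, 0, 0], vector [0, 1, 0], vector [0, 0, 2]]"
  shows "\<forall>\<^sub>F t in at 0. disc3 (\<chi> i j. S $ i $ j + t * B $ i $ j) \<noteq> 0"
proof -
  have B: "B$1$1 = 0" "B$1$2 = 0" "B$1$3 = 0" "B$2$1 = 0" "B$2$2 = 1" "B$2$3 = 0" "B$3$1 = 0" "B$3$2 = 0" "B$3$3 = 2"
    by (simp_all add: B_def vector_3)
  \<comment> \<open>Taking the discriminant over the polynomial ring gives a polynomial in the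
    parameter of the line at once.\<close>
  define q where "q = disc3 (\<chi> i j. [:S $ i $ j, B $ i $ j:])"
  have q: "poly q t = disc3 (\<chi> i j. S $ i $ j + t * B $ i $ j)" for t
  proof -
    have "poly [:a, b:] t = a + t * b" for a b :: complex by simp
    then show ?thesis
      unfolding q_def disc3_def Let_def det_3
      by (simp only: vec_lambda_beta poly_add poly_diff poly_mult poly_numeral)
  qed
  have "q \<noteq> 0"
  proof
    assume 0: "q = 0"
    \<comment> \<open>The discriminant is homogeneous of degree 6, so vanishing along S + B/t gives
      vanishing along t S + B. There t can tend to 0, which would force the discriminant of B to
      vanish.\<close>
    have "disc3 (\<chi> i j. t * S $ i $ j + B $ i $ j) = 0" if "t \<noteq> 0" for t
    proof -
      have "0 = disc3 (\<chi> i j. S $ i $ j + (1 / t) * B $ i $ j)"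
        using q[of "1 / t"] 0 by simp
      then have "0 = t ^ 6 * disc3 (\<chi> i j. S $ i $ j + (1 / t) * B $ i $ j)" by simp
      also have "\<dots> = disc3 (\<chi> i j. t * (S $ i $ j + (1 / t) * B $ i $ j))"
        using disc3_smult[of t "\<chi> i j. S $ i $ j + (1 / t) * B $ i $ j"] by simp
      also have "\<dots> = disc3 (\<chi> i j. t * S $ i $ j + B $ i $ j)"
        using that by (simp add: distrib_left)
      finally show ?thesis by simp
    qed
    then have "\<forall>\<^sub>F t in at 0. disc3 (\<chi> i j. t * S $ i $ j + B $ i $ j) = 0"
      by (simp add: eventually_at_filter)
    moreover have "((\<lambda>t. disc3 (\<chi> i j. t * S $ i $ j + B $ i $ j)) \<longlongrightarrow> disc3 (\<chi> i j. 0 * S $ i $ j + B $ i $ j)) (at 0)"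
      by (intro tendsto_disc3 vec_tendstoI) (simp only: vec_lambda_beta, intro tendsto_intros)
    ultimately have "disc3 (\<chi> i j. 0 * S $ i $ j + B $ i $ j) = 0"
      by (intro tendsto_unique[OF at_neq_bot _ tendsto_eventually])
    then show False by (simp add: disc3_def Let_def det_3 B)
  qed
  then have "finite {t. poly q t = 0}" by (rule poly_roots_finite)
  \<comment> \<open>The parameter 0 may itself be a root, namely when S has a repeated eigenvalue;
    it is removed so that the complement is a neighbourhood of 0.\<close>
  then have "open (- ({t. poly q t = 0} - {0}))" by (intro open_Compl finite_imp_closed) auto
  then have "\<forall>\<^sub>F t in at 0. t \<in> - ({t. poly q t = 0} - {0})"
    by (intro eventually_at_in_open') auto
  moreover have "\<forall>\<^sub>F t in at (0 :: complex). t \<noteq> 0" by (simp add: eventually_at_filter)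
  ultimately show ?thesis by eventually_elim (auto simp: q)
qed

theorem closed_symmetric_induct:
  fixes C :: "(complex ^ 3 ^ 3) set"
  assumes "closed C" and S: "S = transpose S"
    and C: "\<And>(X :: complex ^ 3 ^ 3) (\<Lambda> :: 3 \<Rightarrow> complex). transpose X ** X = mat 1 \<Longrightarrow> (\<chi> i j. \<Sum>k\<in>UNIV. X $ i $ k * \<Lambda> k * X $ j $ k) \<in> C"
  shows "S \<in> C"
proof -
  define B :: "complex ^ 3 ^ 3" where "B = vector [vector [0, 0, 0], vector [0, 1, 0], vector [0, 0, 2]]"
  define T where "T t = (\<chi> i j. S $ i $ j + t * B $ i $ j)" for t
  have S': "S $ i $ j = S $ j $ i" for i j
    using arg_cong[OF S, of "\<lambda>M. M $ i $ j"] by (simp add: transpose_def)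
  have "\<forall>i j. B $ i $ j = B $ j $ i" unfolding forall_3 by (simp add: B_def vector_3)
  then have T: "T t = transpose (T t)" for t
    using S' by (simp add: T_def transpose_def vec_eq_iff)
  have "T t \<in> C" if disc: "disc3 (T t) \<noteq> 0" for t
  proof -
    obtain \<Lambda> :: "3 \<Rightarrow> complex" where \<Lambda>: "inj \<Lambda>" "\<And>i. det (T t - mat (\<Lambda> i)) = 0"
      by (rule eigenvalues_of_disc3[OF disc]) (rule that)
    obtain X :: "complex ^ 3 ^ 3" where X: "transpose X ** X = mat 1" "\<And>i j. T t $ i $ j = (\<Sum>k\<in>UNIV. X $ i $ k * \<Lambda> k * X $ j $ k)"
      by (rule symmetric_diagonalization[OF T \<Lambda>]) (rule that)
    have "T t = (\<chi> i j. \<Sum>k\<in>UNIV. X $ i $ k * \<Lambda> k * X $ j $ k)" using X(2) by (simp add: vec_eq_iff)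
    then show ?thesis using C[OF X(1)] by simp
  qed
  then have ev: "\<forall>\<^sub>F t in at 0. T t \<in> C"
    using disc3_perturbation[of S] unfolding T_def B_def by (rule eventually_mono[rotated])
  have "(T \<longlongrightarrow> (\<chi> i j. S $ i $ j + 0 * B $ i $ j)) (at 0)"
    unfolding T_def by (intro vec_tendstoI) (simp only: vec_lambda_beta, intro tendsto_intros)
  moreover have "(\<chi> i j. S $ i $ j + 0 * B $ i $ j) = S" by (simp add: vec_eq_iff)
  ultimately have "(T \<longlongrightarrow> S) (at 0)" by simp
  then show ?thesis by (rule Lim_in_closed_set[OF \<open>closed C\<close> ev at_neq_bot])
qed

subsection \<open>The matrices satisfying Crouzeix's inequality form a closed set\<close>

lemma cvec_inner_self: "cvec_inner x x = complex_of_real ((norm x)\<^sup>2)"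
proof -
  have "cvec_inner x x = (\<Sum>i\<in>UNIV. complex_of_real ((norm (x $ i))\<^sup>2))"
    by (simp only: cvec_inner_def complex_norm_square)
  also have "\<dots> = complex_of_real (\<Sum>i\<in>UNIV. (norm (x $ i))\<^sup>2)" by simp
  also have "(\<Sum>i\<in>UNIV. (norm (x $ i))\<^sup>2) = (norm x)\<^sup>2"
    by (simp add: norm_vec_def L2_set_def sum_nonneg)
  finally show ?thesis .
qed

lemma sqrt_cvec_inner_self: "sqrt (Re (cvec_inner x x)) = norm x"
  by (simp add: cvec_inner_self del: of_real_power)

lemma tendsto_matrix_vector_mult:
  fixes S :: "'a \<Rightarrow> complex ^ 'n ^ 'm"
  assumes "(S \<longlongrightarrow> T) F" "(x \<longlongrightarrow> y) F"
  shows "((\<lambda>k. S k *v x k) \<longlongrightarrow> T *v y) F"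
  unfolding matrix_vector_mult_def
  by (intro vec_tendstoI) (simp, intro tendsto_sum tendsto_mult tendsto_vec_nth assms)

lemma tendsto_cvec_inner:
  assumes "(x \<longlongrightarrow> a) F" "(y \<longlongrightarrow> b) F"
  shows "((\<lambda>k. cvec_inner (x k) (y k)) \<longlongrightarrow> cvec_inner a b) F"
  unfolding cvec_inner_def by (intro tendsto_sum tendsto_mult tendsto_cnj tendsto_vec_nth assms)

lemma tendsto_poly_operator:
  fixes S :: "'a \<Rightarrow> complex ^ 'n ^ 'n"
  assumes "(S \<longlongrightarrow> T) F" "(x \<longlongrightarrow> y) F"
  shows "((\<lambda>k. poly_operator (*s) p ((*v) (S k)) (x k)) \<longlongrightarrow> poly_operator (*s) p ((*v) T) y) F"
proof -
  have "((\<lambda>k. (((*v) (S k)) ^^ i) (x k)) \<longlongrightarrow> (((*v) T) ^^ i) y) F" for i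
    by (induction i) (auto intro!: tendsto_matrix_vector_mult assms)
  then show ?thesis
    unfolding poly_operator_def
    by (intro tendsto_sum vec_tendstoI) (auto intro!: tendsto_mult tendsto_vec_nth)
qed

definition crouzeix_value :: "complex poly \<Rightarrow> complex ^ 'n ^ 'n \<Rightarrow> complex ^ 'n \<Rightarrow> real"
  where "crouzeix_value p S u = cmod (poly p (cvec_inner (S *v u) u))"

lemma tendsto_crouzeix_value:
  assumes "(S \<longlongrightarrow> T) F" "(u \<longlongrightarrow> v) F"
  shows "((\<lambda>k. crouzeix_value p (S k) (u k)) \<longlongrightarrow> crouzeix_value p T v) F"
  unfolding crouzeix_value_def
  by (intro tendsto_norm isCont_tendsto_compose[OF poly_isCont] tendsto_cvec_inner
      tendsto_matrix_vector_mult assms)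

lemma continuous_crouzeix_value: "continuous_on A (crouzeix_value p S)"
  unfolding continuous_on_def
  by (intro ballI tendsto_crouzeix_value tendsto_const tendsto_ident_at)

lemma continuous_poly_operator:
  fixes S :: "complex ^ 'n ^ 'n"
  shows "continuous_on A (\<lambda>x. norm (poly_operator (*s) p ((*v) S) x))"
  unfolding continuous_on_def
  by (intro ballI tendsto_norm tendsto_poly_operator tendsto_const tendsto_ident_at)

text \<open>The unit sphere is compact, so the supremum over the numerical range is attained, and
  the bound for a given x is witnessed by a unit vector u. This form survives limits: for a
  convergent sequence of matrices a subsequence of the witnesses converges.\<close>

lemma crouzeix_matrix_iff:
  fixes S :: "complex ^ 'n ^ 'n"
  shows "crouzeix_matrix S \<longleftrightarrow>
    (\<forall>p x. norm x \<le> 1 \<longrightarrow> (\<exists>u. norm u = 1 \<and>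
      norm (poly_operator (*s) p ((*v) S) x) \<le> 2 * crouzeix_value p S u))"
proof -
  have unit: "{x :: complex ^ 'n. sqrt (Re (cvec_inner x x)) \<le> 1} = cball 0 1"
    by (auto simp: sqrt_cvec_inner_self)
  have "cvec_inner x x = 1 \<longleftrightarrow> norm x = 1" for x :: "complex ^ 'n"
  proof -
    have "cvec_inner x x = 1 \<longleftrightarrow> (norm x)\<^sup>2 = 1"
      unfolding cvec_inner_self of_real_eq_1_iff ..
    then show ?thesis using norm_ge_zero[of x] by (auto simp: power2_eq_1_iff)
  qed
  then have "numerical_range cvec_inner UNIV ((*v) S) = (\<lambda>u. cvec_inner (S *v u) u) ` sphere 0 1"
    by (auto simp: numerical_range_def)
  then have sphere: "(\<lambda>z. cmod (poly p z)) ` numerical_range cvec_inner UNIV ((*v) S)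
      = crouzeix_value p S ` sphere 0 1" for p
    by (simp add: image_image crouzeix_value_def[abs_def])
  have ne: "sphere (0 :: complex ^ 'n) 1 \<noteq> {}"
    by simp
  have norm: "operator_norm cvec_inner UNIV B = (SUP x \<in> cball 0 1. norm (B x))"
    for B :: "complex ^ 'n \<Rightarrow> complex ^ 'n"
    unfolding operator_norm_def sqrt_cvec_inner_self by (simp add: cball_def)
  show ?thesis
    unfolding crouzeix_matrix_def crouzeix_def
  proof (intro iff_allI)
    fix p
    let ?B = "poly_operator (*s) p ((*v) S)"
    obtain u0 where u0: "norm u0 = 1" "\<And>u. norm u = 1 \<Longrightarrow> crouzeix_value p S u \<le> crouzeix_value p S u0"
      using continuous_attains_sup[OF compact_sphere ne continuous_crouzeix_value[where p = p and S = S]]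
      by auto
    have sup: "(SUP z \<in> numerical_range cvec_inner UNIV ((*v) S). cmod (poly p z)) = crouzeix_value p S u0"
      unfolding sphere by (rule cSup_eq_maximum) (use u0 in auto)
    have "compact ((\<lambda>x. norm (?B x)) ` cball 0 1)"
      by (intro compact_continuous_image continuous_poly_operator compact_cball)
    then have bdd: "bdd_above ((\<lambda>x. norm (?B x)) ` cball 0 1)"
      by (intro bounded_imp_bdd_above compact_imp_bounded)
    have "(SUP x \<in> cball 0 1. norm (?B x)) \<le> 2 * crouzeix_value p S u0
        \<longleftrightarrow> (\<forall>x\<in>cball 0 1. norm (?B x) \<le> 2 * crouzeix_value p S u0)"
      by (rule cSUP_le_iff[OF _ bdd]) simp
    also have "\<dots> \<longleftrightarrow> (\<forall>x. norm x \<le> 1 \<longrightarrow> (\<exists>u. norm u = 1 \<and> norm (?B x) \<le> 2 * crouzeix_value p S u))"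
    proof -
      have "norm (?B x) \<le> 2 * crouzeix_value p S u0"
        if "norm u = 1" "norm (?B x) \<le> 2 * crouzeix_value p S u" for x u
        using u0(2)[OF that(1)] that(2) by linarith
      then show ?thesis using u0(1) by (auto simp: dist_norm)
    qed
    finally show "operator_norm cvec_inner UNIV ?B \<le> 2 * (SUP z \<in> numerical_range cvec_inner UNIV ((*v) S). cmod (poly p z))
        \<longleftrightarrow> (\<forall>x. norm x \<le> 1 \<longrightarrow> (\<exists>u. norm u = 1 \<and> norm (?B x) \<le> 2 * crouzeix_value p S u))"
      unfolding sup norm .
  qed
qed

lemma closed_crouzeix_matrix: "closed {S :: complex ^ 'n ^ 'n. crouzeix_matrix S}"
  unfolding closed_sequential_limits
proof (intro allI impI, elim conjE, unfold mem_Collect_eq)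
  fix S :: "nat \<Rightarrow> complex ^ 'n ^ 'n" and T
  assume S: "\<forall>k. crouzeix_matrix (S k)" and lim: "S \<longlonglongrightarrow> T"
  show "crouzeix_matrix T"
    unfolding crouzeix_matrix_iff
  proof (intro allI impI)
    fix p and x :: "complex ^ 'n" assume x: "norm x \<le> 1"
    have "\<forall>k. \<exists>u. norm u = 1 \<and> norm (poly_operator (*s) p ((*v) (S k)) x) \<le> 2 * crouzeix_value p (S k) u"
      using S x unfolding crouzeix_matrix_iff by blast
    then obtain u where u: "\<And>k. norm (u k) = 1"
      "\<And>k. norm (poly_operator (*s) p ((*v) (S k)) x) \<le> 2 * crouzeix_value p (S k) (u k)" by metis
    have "\<forall>k. u k \<in> sphere 0 1" using u(1) by simp
    then obtain v r where v: "v \<in> sphere 0 1" "strict_mono r" "(u \<circ> r) \<longlonglongrightarrow> v"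
      using compact_sphere[of "0 :: complex ^ 'n" 1] unfolding compact_def by blast
    have limr: "(\<lambda>k. S (r k)) \<longlonglongrightarrow> T" using LIMSEQ_subseq_LIMSEQ[OF lim v(2)] by (simp add: o_def)
    have "norm (poly_operator (*s) p ((*v) T) x) \<le> 2 * crouzeix_value p T v"
    proof (rule LIMSEQ_le)
      show "(\<lambda>k. norm (poly_operator (*s) p ((*v) (S (r k))) x)) \<longlonglongrightarrow> norm (poly_operator (*s) p ((*v) T) x)"
        by (intro tendsto_norm tendsto_poly_operator limr tendsto_const)
      show "(\<lambda>k. 2 * crouzeix_value p (S (r k)) ((u \<circ> r) k)) \<longlonglongrightarrow> 2 * crouzeix_value p T v"
        by (intro tendsto_mult tendsto_const tendsto_crouzeix_value limr v(3))
    qed (use u(2) in auto)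
    then show "\<exists>u. norm u = 1 \<and> norm (poly_operator (*s) p ((*v) T) x) \<le> 2 * crouzeix_value p T u"
      using v(1) by auto
  qed
qed

subsection \<open>The equivalence\<close>

text \<open>The eigenvalues stay fixed while X moves through orthogonal matrices without zero Gram
  entries. They may coincide, since only the interpolation nodes have to be distinct.\<close>

lemma crouzeix_orthogonal_diagonal:
  fixes X :: "complex ^ 3 ^ 3" and \<Lambda> :: "3 \<Rightarrow> complex"
  assumes toeplitz: "\<And>\<theta> g. inner_function \<theta> \<Longrightarrow> L2.dim (model_space \<theta>) = 3 \<Longrightarrow> g \<in> Linf \<inter> H2 \<Longrightarrow>
      crouzeix_truncated_toeplitz \<theta> g"
    and X: "transpose X ** X = mat 1"
  shows "crouzeix_matrix (\<chi> i j. \<Sum>k\<in>UNIV. X $ i $ k * \<Lambda> k * X $ j $ k)"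
proof -
  define S where "S X = (\<chi> i j. \<Sum>k\<in>UNIV. X $ i $ k * \<Lambda> k * X $ j $ k)" for X :: "complex ^ 3 ^ 3"
  have generic: "crouzeix_matrix (S Y)"
    if Y: "transpose Y ** Y = mat 1" and nz: "gram Y 1 2 \<noteq> 0" "gram Y 1 3 \<noteq> 0" "gram Y 2 3 \<noteq> 0"
    for Y :: "complex ^ 3 ^ 3"
  proof -
    obtain \<alpha> s :: "3 \<Rightarrow> complex" where \<alpha>: "inj \<alpha>" "\<And>i. cmod (\<alpha> i) < 1" "\<And>i. s i \<noteq> 0"
      "\<And>i j. gram Y i j = s i * cnj (s j) / (1 - cnj (\<alpha> i) * \<alpha> j)"
      by (rule gram_szego[OF Y nz]) (rule that)
    obtain \<theta> g where "inner_function \<theta>" "L2.dim (model_space \<theta>) = CARD(3)" "g \<in> Linf \<inter> H2"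
      "crouzeix_truncated_toeplitz \<theta> g \<longleftrightarrow> crouzeix_matrix (S Y)"
      by (rule truncated_toeplitz_of_gram[OF Y \<alpha>, of "S Y" \<Lambda>]) (auto simp: S_def)
    then show ?thesis using toeplitz by simp
  qed
  obtain Y :: "real \<Rightarrow> complex ^ 3 ^ 3" where Y: "(Y \<longlongrightarrow> X) (at 0)"
    "\<forall>\<^sub>F e in at 0. transpose (Y e) ** Y e = mat 1 \<and>
      gram (Y e) 1 2 \<noteq> 0 \<and> gram (Y e) 1 3 \<noteq> 0 \<and> gram (Y e) 2 3 \<noteq> 0"
    by (rule orthogonal_perturbation[OF X])
  have "((\<lambda>e. S (Y e)) \<longlongrightarrow> S X) (at 0)"
    unfolding S_def by (intro vec_tendstoI) (simp only: vec_lambda_beta, intro tendsto_intros Y(1))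
  moreover have "\<forall>\<^sub>F e in at 0. S (Y e) \<in> {S. crouzeix_matrix S}"
    using Y(2) by eventually_elim (simp add: generic)
  ultimately have "S X \<in> {S. crouzeix_matrix S}"
    by (intro Lim_in_closed_set[OF closed_crouzeix_matrix _ at_neq_bot])
  then show ?thesis by (simp add: S_def)
qed

theorem proposition4p3:
  shows
    "((\<forall>\<theta> g. inner_function \<theta> \<and> L2.dim (model_space \<theta>) = 3 \<and> g \<in> Linf \<inter> H2
          \<longrightarrow> crouzeix_truncated_toeplitz \<theta> g)
      \<longleftrightarrow> (\<forall>S :: complex ^ 3 ^ 3. S = transpose S \<longrightarrow> crouzeix_matrix S))
   \<and> ((\<forall>S :: complex ^ 3 ^ 3. S = transpose S \<longrightarrow> crouzeix_matrix S)
      \<longleftrightarrow> (\<forall>\<theta> g. inner_function \<theta> \<and> L2.dim (model_space \<theta>) = 3 \<and> g \<in> Linf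
          \<longrightarrow> crouzeix_truncated_toeplitz \<theta> g))"
proof -
  let ?a = "\<forall>\<theta> g. inner_function \<theta> \<and> L2.dim (model_space \<theta>) = 3 \<and> g \<in> Linf \<inter> H2
      \<longrightarrow> crouzeix_truncated_toeplitz \<theta> g"
  let ?b = "\<forall>S :: complex ^ 3 ^ 3. S = transpose S \<longrightarrow> crouzeix_matrix S"
  let ?c = "\<forall>\<theta> g. inner_function \<theta> \<and> L2.dim (model_space \<theta>) = 3 \<and> g \<in> Linf
      \<longrightarrow> crouzeix_truncated_toeplitz \<theta> g"
  have "?c \<longrightarrow> ?a" by blast
  moreover have "?a \<longrightarrow> ?b"
  proof (intro impI allI)
    fix S :: "complex ^ 3 ^ 3"
    assume a: ?a and S: "S = transpose S"
    have "S \<in> {S. crouzeix_matrix S}"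
    proof (rule closed_symmetric_induct[OF closed_crouzeix_matrix S])
      fix X :: "complex ^ 3 ^ 3" and \<Lambda> :: "3 \<Rightarrow> complex"
      assume "transpose X ** X = mat 1"
      then have "crouzeix_matrix (\<chi> i j. \<Sum>k\<in>UNIV. X $ i $ k * \<Lambda> k * X $ j $ k)"
        using a by (intro crouzeix_orthogonal_diagonal) blast+
      then show "(\<chi> i j. \<Sum>k\<in>UNIV. X $ i $ k * \<Lambda> k * X $ j $ k) \<in> {S. crouzeix_matrix S}" by simp
    qed
    then show "crouzeix_matrix S" by simp
  qed
  moreover have "?b \<longrightarrow> ?c"
  proof (intro impI allI; elim conjE)
    fix \<theta> g
    assume b: ?b and "inner_function \<theta>" "L2.dim (model_space \<theta>) = 3" "g \<in> Linf"
    then obtain S :: "complex ^ 3 ^ 3" where "S = transpose S"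
      "crouzeix_truncated_toeplitz \<theta> g \<longleftrightarrow> crouzeix_matrix S"
      using truncated_toeplitz_unitarily_equivalent_symmetric[where 'n = 3, of \<theta> g] by auto
    then show "crouzeix_truncated_toeplitz \<theta> g" using b by blast
  qed
  ultimately show ?thesis by argo
qed

end
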